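(* For each $d\in\{1,\dots,n\}$, $C_\delta\ge1$, $C_1>0$ and $\gamma>0$, we can find $L=L(n,d,C_\delta,C_1,\gamma)\ge0$ such that the following holds. Let $\mu$ be a Radon measure on $\mathbb{R}^n$ with support $\Sigma$ that is doubling with constant $C_\delta$, let $B=B(x,r)$ be a ball centered on $\Sigma$, and suppose that $$\int_{B(x,2r)}\int_0^{2r}\alpha_d(y,t)\,\frac{dt\,d\mu(y)}{t}\le C_1\,\mu(B).$$ Then there is a Borel set $A\subset B$ such that $\mu(B\setminus A)\le\gamma\,\mu(B)$, there is an $L$-bi-Lipschitz map $f:A\to f(A)\subset\mathbb{R}^d$, and the restrictions of $\mu$ and $\mathcal{H}^d$ to $A$ are mutually absolutely continuous. Moreover $$L^{-1}\frac{\mathcal{H}^d(Z)}{r^d}\le\frac{\mu(Z)}{\mu(B)}\le L\,\frac{\mathcal{H}^d(Z)}{r^d}\qquad\text{for every Borel set }Z\subset A.$$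
   Context: $B(x,r)$ is the open ball, $\mathbb{B}=B(0,1)\subset\mathbb{R}^n$. The support of a Radon measure $\mu$ (locally finite positive Borel measure) is $\Sigma=\{x:\mu(B(x,r))>0\ \forall r>0\}$; $\mu$ is doubling with constant $C_\delta$ if $\mu(B(x,2r))\le C_\delta\,\mu(B(x,r))$ for all $x\in\Sigma$, $r>0$. $\mathcal{H}^d$ is $d$-dimensional Hausdorff measure normalized so that $\mathcal{H}^d(\mathbb{R}^d\cap B(0,1))=1$. For measures $\mu,\nu$ on $\mathbb{R}^n$ whose restrictions to $\mathbb{B}$ are probability measures, $\mathbb{W}_1(\mu,\nu)=\sup_\psi\left|\int\psi\,d\mu-\int\psi\,d\nu\right|$, the supremum over all $1$-Lipschitz $\psi:\mathbb{R}^n\to\mathbb{R}$ supported on $\mathbb{B}$ (vanishing outside $\mathbb{B}$). For $x\in\Sigma$, $r>0$, $\mu_{x,r}(A)=\mu(x+rA)/\mu(B(x,r))$ for Borel $A\subset\mathbb{R}^n$. $A'(d,n)$ is the set of $d$-dimensional affine planes of $\mathbb{R}^n$ meeting $B(0,1/2)$. For $V\in A'(d,n)$, $\nu_V=c_V\mathcal{H}^d|_V$ with $c_V=\mathcal{H}^d(V\cap\mathbb{B})^{-1}$. Then $\alpha_d(x,r)=\inf\{\mathbb{W}_1(\mu_{x,r},\nu_V):V\in A'(d,n)\}$ for $x\in\Sigma$, $r>0$. $f$ is $L$-bi-Lipschitz on $A$ if $L^{-1}|x-y|\le|f(x)-f(y)|\le L|x-y|$ for $x,y\in A$. *)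

theory Defs
  imports "HOL-Analysis.Analysis"
begin

(* Covers by sets of diameter at most delta. bounded is required because diameter is
   unspecified on unbounded sets. Only d > 0 is used: the weight 0 ^ 0 = 1 of the empty set would
   be wrong for d = 0. *)
definition hausdorff_content :: "nat \<Rightarrow> real \<Rightarrow> 'a::metric_space set \<Rightarrow> ennreal" where
  "hausdorff_content d \<delta> A =
     (INF U\<in>{U :: nat \<Rightarrow> 'a set. A \<subseteq> (\<Union>i. U i) \<and> (\<forall>i. bounded (U i) \<and> diameter (U i) \<le> \<delta>)}.
        \<Sum>i. ennreal (diameter (U i) ^ d))"

(* Unnormalized; the normalization is in hausdorff_measure. *)
definition hausdorff_outer :: "nat \<Rightarrow> 'a::metric_space set \<Rightarrow> ennreal" where
  "hausdorff_outer d A = (SUP \<delta>\<in>{0<..}. hausdorff_content d \<delta> A)"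

lemma hausdorff_content_le:
  assumes "A \<subseteq> (\<Union>i. U i)" "\<And>i. bounded (U i)" "\<And>i. diameter (U i) \<le> \<delta>"
  shows "hausdorff_content d \<delta> A \<le> (\<Sum>i::nat. ennreal (diameter (U i) ^ d))"
  unfolding hausdorff_content_def using assms by (intro INF_lower) auto

lemma hausdorff_content_mono: "A \<subseteq> B \<Longrightarrow> hausdorff_content d \<delta> A \<le> hausdorff_content d \<delta> B"
  unfolding hausdorff_content_def by (intro INF_superset_mono) auto

lemma hausdorff_content_antimono: "\<delta> \<le> \<epsilon> \<Longrightarrow> hausdorff_content d \<epsilon> A \<le> hausdorff_content d \<delta> A"
  unfolding hausdorff_content_def by (intro INF_superset_mono) (auto intro: order_trans)

lemma hausdorff_content_le_outer: "0 < \<delta> \<Longrightarrow> hausdorff_content d \<delta> A \<le> hausdorff_outer d A"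
  unfolding hausdorff_outer_def by (intro SUP_upper) auto

lemma hausdorff_outer_mono: "A \<subseteq> B \<Longrightarrow> hausdorff_outer d A \<le> hausdorff_outer d B"
  unfolding hausdorff_outer_def by (intro SUP_mono) (auto intro: hausdorff_content_mono)

lemma hausdorff_content_UN:
  "hausdorff_content d \<delta> (\<Union>n::nat. A n) \<le> (\<Sum>n. hausdorff_content d \<delta> (A n))"
proof (rule ennreal_le_epsilon)
  fix e :: real assume fin: "(\<Sum>n. hausdorff_content d \<delta> (A n)) < top" and e: "e > 0"
  have "\<exists>U. A n \<subseteq> (\<Union>i. U i) \<and> (\<forall>i. bounded (U i) \<and> diameter (U i) \<le> \<delta>) \<and>
     (\<Sum>i::nat. ennreal (diameter (U i) ^ d)) \<le> hausdorff_content d \<delta> (A n) + ennreal (e * (1/2)^Suc n)" for n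
  proof -
    have "hausdorff_content d \<delta> (A n) < top"
      using fin ennreal_suminf_lessD by blast
    then have "hausdorff_content d \<delta> (A n) < hausdorff_content d \<delta> (A n) + ennreal (e * (1/2)^Suc n)"
      using e by (simp add: ennreal_add_left_cancel_less)
    then show ?thesis
      unfolding hausdorff_content_def[of d \<delta> "A n"] INF_less_iff by (auto intro: less_imp_le)
  qed
  then obtain U where U: "\<And>n. A n \<subseteq> (\<Union>i. U n i)" "\<And>n i. bounded (U n i)" "\<And>n i. diameter (U n i) \<le> \<delta>"
    "\<And>n. (\<Sum>i::nat. ennreal (diameter (U n i) ^ d)) \<le> hausdorff_content d \<delta> (A n) + ennreal (e * (1/2)^Suc n)"
    by metis
  define V where "V k = (case prod_decode k of (n, i) \<Rightarrow> U n i)" for k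
  have "(\<Union>n. A n) \<subseteq> (\<Union>k. V k)"
  proof
    fix x assume "x \<in> (\<Union>n. A n)"
    then obtain n i where "x \<in> U n i" using U(1) by blast
    then have "x \<in> V (prod_encode (n, i))" by (simp add: V_def)
    then show "x \<in> (\<Union>k. V k)" by blast
  qed
  then have "hausdorff_content d \<delta> (\<Union>n. A n) \<le> (\<Sum>k. ennreal (diameter (V k) ^ d))"
    by (rule hausdorff_content_le) (auto simp: V_def U split: prod.split)
  also have "\<dots> = (\<Sum>k. (\<lambda>(n,i). ennreal (diameter (U n i) ^ d)) (prod_decode k))"
    by (simp add: V_def split_def)
  also have "\<dots> = (\<Sum>n. \<Sum>i. ennreal (diameter (U n i) ^ d))"
    by (rule suminf_ennreal_2dimen) simp
  also have "\<dots> \<le> (\<Sum>n. hausdorff_content d \<delta> (A n) + ennreal (e * (1/2)^Suc n))"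
    by (intro suminf_le U) auto
  also have "\<dots> = (\<Sum>n. hausdorff_content d \<delta> (A n)) + (\<Sum>n. ennreal (e * (1/2)^Suc n))"
    by (rule suminf_add[symmetric]) auto
  also have "(\<Sum>n. ennreal (e * (1/2)^Suc n)) = ennreal e"
    using e sums_mult[OF power_half_series, of e] by (intro suminf_ennreal_eq) auto
  finally show "hausdorff_content d \<delta> (\<Union>n. A n) \<le> (\<Sum>n. hausdorff_content d \<delta> (A n)) + ennreal e" .
qed

lemma hausdorff_outer_UN:
  "hausdorff_outer d (\<Union>n::nat. A n) \<le> (\<Sum>n. hausdorff_outer d (A n))"
  unfolding hausdorff_outer_def[of d "\<Union>n. A n"]
  by (intro SUP_least order_trans[OF hausdorff_content_UN] suminf_le)
     (auto intro: hausdorff_content_le_outer)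

lemma hausdorff_outer_empty: "d > 0 \<Longrightarrow> hausdorff_outer d {} = 0"
proof -
  assume "d > 0"
  have "hausdorff_content d \<delta> ({}::'a set) \<le> 0" if "\<delta> > 0" for \<delta>
  proof -
    have "hausdorff_content d \<delta> ({}::'a set) \<le> (\<Sum>i::nat. ennreal (diameter ({}::'a set) ^ d))"
      using that by (intro hausdorff_content_le) auto
    also have "\<dots> = 0" using \<open>d > 0\<close> by (simp add: power_0_left)
    finally show ?thesis .
  qed
  then have "hausdorff_outer d ({}::'a set) \<le> 0"
    unfolding hausdorff_outer_def by (intro SUP_least) simp
  then show "hausdorff_outer d ({}::'a set) = 0" by simp
qed

lemma outer_measure_space_hausdorff: "d > 0 \<Longrightarrow> outer_measure_space UNIV (hausdorff_outer d)"
  unfolding outer_measure_space_def positive_def increasing_def countably_subadditive_def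
  by (auto simp: hausdorff_outer_empty hausdorff_outer_mono hausdorff_outer_UN)

lemma hausdorff_outer_Un: 
  assumes "d > 0" shows "hausdorff_outer d (A \<union> B) \<le> hausdorff_outer d A + hausdorff_outer d B"
proof -
  have "hausdorff_outer d (\<Union>n. binaryset A B n) \<le> (\<Sum>n. hausdorff_outer d (binaryset A B n))"
    by (rule hausdorff_outer_UN)
  also have "\<dots> = hausdorff_outer d A + hausdorff_outer d B"
    using assms by (intro suminf_binaryset_eq) (rule hausdorff_outer_empty)
  finally show ?thesis by (simp add: UN_binaryset_eq)
qed

lemma hausdorff_outer_separated:
  assumes d: "d > 0" and e: "\<epsilon> > 0" and sep: "\<And>x y. x \<in> A \<Longrightarrow> y \<in> B \<Longrightarrow> \<epsilon> \<le> dist x y"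
  shows "hausdorff_outer d A + hausdorff_outer d B \<le> hausdorff_outer d (A \<union> B)"
proof -
  have small: "hausdorff_content d \<delta> A + hausdorff_content d \<delta> B \<le> hausdorff_outer d (A \<union> B)"
    if \<delta>: "0 < \<delta>" "\<delta> < \<epsilon>" for \<delta>
  proof -
    have "hausdorff_content d \<delta> A + hausdorff_content d \<delta> B \<le> hausdorff_content d \<delta> (A \<union> B)"
      unfolding hausdorff_content_def[of d \<delta> "A \<union> B"]
    proof (rule INF_greatest)
      fix U :: "nat \<Rightarrow> 'a set"
      assume "U \<in> {U. A \<union> B \<subseteq> (\<Union>i. U i) \<and> (\<forall>i. bounded (U i) \<and> diameter (U i) \<le> \<delta>)}"
      then have U: "A \<union> B \<subseteq> (\<Union>i. U i)" "\<And>i. bounded (U i)" "\<And>i. diameter (U i) \<le> \<delta>" by auto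
      define V where "V S i = (if U i \<inter> S = {} then {} else U i)" for S i
      have V: "bounded (V S i)" "diameter (V S i) \<le> \<delta>" for S i
        using U \<delta> by (auto simp: V_def)
      have "hausdorff_content d \<delta> A + hausdorff_content d \<delta> B
         \<le> (\<Sum>i. ennreal (diameter (V A i) ^ d)) + (\<Sum>i. ennreal (diameter (V B i) ^ d))"
        using U(1) by (intro add_mono hausdorff_content_le V) (auto simp: V_def, blast+)
      also have "\<dots> = (\<Sum>i. ennreal (diameter (V A i) ^ d) + ennreal (diameter (V B i) ^ d))"
        by (rule suminf_add) auto
      also have "\<dots> \<le> (\<Sum>i. ennreal (diameter (U i) ^ d))"
      proof (intro suminf_le)
        fix i
        have "U i \<inter> A = {} \<or> U i \<inter> B = {}"
        proof (rule ccontr)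
          assume "\<not> ?thesis"
          then obtain x y where "x \<in> U i" "x \<in> A" "y \<in> U i" "y \<in> B" by auto
          then show False
            using diameter_bounded_bound[OF U(2), of x i y] sep[of x y] U(3)[of i] \<delta> by auto
        qed
        then show "ennreal (diameter (V A i) ^ d) + ennreal (diameter (V B i) ^ d) \<le> ennreal (diameter (U i) ^ d)"
          using d by (auto simp: V_def power_0_left)
      qed auto
      finally show "hausdorff_content d \<delta> A + hausdorff_content d \<delta> B \<le> (\<Sum>i. ennreal (diameter (U i) ^ d))" .
    qed
    then show ?thesis using hausdorff_content_le_outer[OF \<delta>(1)] by (rule order_trans)
  qed
  have "hausdorff_outer d A + hausdorff_outer d B =
      (SUP \<delta>\<in>{0<..}. SUP \<eta>\<in>{0<..}. hausdorff_content d \<delta> A + hausdorff_content d \<eta> B)"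
    unfolding hausdorff_outer_def
    by (subst ennreal_SUP_add_left[symmetric], simp, subst ennreal_SUP_add_right[symmetric]) auto
  also have "\<dots> \<le> hausdorff_outer d (A \<union> B)"
  proof (intro SUP_least)
    fix \<delta> \<eta> :: real assume "\<delta> \<in> {0<..}" "\<eta> \<in> {0<..}"
    define \<zeta> where "\<zeta> = min (min \<delta> \<eta>) (\<epsilon>/2)"
    have "hausdorff_content d \<delta> A + hausdorff_content d \<eta> B \<le> hausdorff_content d \<zeta> A + hausdorff_content d \<zeta> B"
      by (intro add_mono hausdorff_content_antimono) (auto simp: \<zeta>_def)
    also have "\<dots> \<le> hausdorff_outer d (A \<union> B)"
      using \<open>\<delta> \<in> _\<close> \<open>\<eta> \<in> _\<close> e by (intro small) (auto simp: \<zeta>_def min_def)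
    finally show "hausdorff_content d \<delta> A + hausdorff_content d \<eta> B \<le> hausdorff_outer d (A \<union> B)" .
  qed
  finally show ?thesis .
qed

lemma closed_in_lambda_hausdorff:
  fixes F :: "'a::metric_space set"
  assumes d: "d > 0" and F: "closed F"
  shows "F \<in> lambda_system UNIV UNIV (hausdorff_outer d)"
proof (cases "F = {}")
  case True
  then show ?thesis using hausdorff_outer_empty[OF d] by (auto simp: lambda_system_def)
next
  case False
  let ?H = "hausdorff_outer d :: 'a set \<Rightarrow> ennreal"
  have "?H (F \<inter> A) + ?H ((UNIV - F) \<inter> A) \<le> ?H A" for A
  proof (cases "?H A = top")
    case fin: False
    define S where "S k = {x\<in>A. 1 / real (Suc k) \<le> infdist x F}" for k
    define R where "R k = S (Suc k) - S k" for k
    have sep: "?H B + ?H C \<le> ?H (B \<union> C)"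
      if B: "\<And>x. x \<in> B \<Longrightarrow> a \<le> infdist x F" and C: "\<And>x. x \<in> C \<Longrightarrow> infdist x F \<le> b" and "b < a"
      for a b B C
    proof (rule hausdorff_outer_separated[OF d, of "a - b"])
      fix x y assume "x \<in> B" "y \<in> C"
      then show "a - b \<le> dist x y"
        using B[of x] C[of y] infdist_triangle[of x F y] by simp
    qed (use that in simp)
    have parity: "(\<Sum>j<n. ?H (R (2*j+c))) \<le> ?H (\<Union>j<n. R (2*j+c))" for n c
    proof (induction n)
      case (Suc n)
      show ?case
      proof (cases "n = 0")
        case True
        then show ?thesis by (simp add: lessThan_Suc)
      next
        case False
        have "(\<Sum>j<Suc n. ?H (R (2*j+c))) \<le> ?H (\<Union>j<n. R (2*j+c)) + ?H (R (2*n+c))"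
          using Suc by (simp add: add_right_mono)
        also have "\<dots> \<le> ?H ((\<Union>j<n. R (2*j+c)) \<union> R (2*n+c))"
        proof (rule sep)
          fix x assume "x \<in> (\<Union>j<n. R (2*j+c))"
          then obtain j where j: "j < n" "1 / real (Suc (Suc (2*j+c))) \<le> infdist x F"
            by (auto simp: R_def S_def)
          have "1 / real (2*n+c) \<le> 1 / real (Suc (Suc (2*j+c)))"
            using j(1) by (intro divide_left_mono) auto
          then show "1 / real (2*n+c) \<le> infdist x F" using j(2) by linarith
        next
          fix x assume "x \<in> R (2*n+c)"
          then show "infdist x F \<le> 1 / real (Suc (2*n+c))" by (auto simp: R_def S_def)
        next
          show "1 / real (Suc (2*n+c)) < 1 / real (2*n+c)"
            using False by (intro divide_strict_left_mono) auto
        qed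
        also have "(\<Union>j<n. R (2*j+c)) \<union> R (2*n+c) = (\<Union>j<Suc n. R (2*j+c))"
          by (auto simp: less_Suc_eq)
        finally show ?thesis .
      qed
    qed simp
    have RA: "(\<Union>j<n. R (2*j+c)) \<subseteq> A" for n c by (auto simp: R_def S_def)
    have "(\<Sum>k. ?H (R k)) \<le> ?H A + ?H A"
    proof (rule suminf_le_const[OF summableI])
      fix n
      have "(\<Sum>k<n. ?H (R k)) \<le> (\<Sum>k<2*n. ?H (R k))"
        by (intro sum_mono2) auto
      also have "\<dots> = (\<Sum>j<n. ?H (R (2*j+0))) + (\<Sum>j<n. ?H (R (2*j+1)))"
        by (induction n) (simp_all add: ac_simps)
      also have "\<dots> \<le> ?H A + ?H A"
        by (intro add_mono order_trans[OF parity] hausdorff_outer_mono RA)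
      finally show "(\<Sum>k<n. ?H (R k)) \<le> ?H A + ?H A" .
    qed
    also have "\<dots> < top" using fin by (simp add: less_top)
    finally have sumfin: "(\<Sum>k. ?H (R k)) < top" .
    show ?thesis
    proof (rule ennreal_le_epsilon)
      fix e :: real assume "e > 0"
      have rfin: "?H (R k) < top" for k using sumfin by (rule ennreal_suminf_lessD)
      define h where "h k = enn2real (?H (R k))" for k
      have h: "?H (R k) = ennreal (h k)" "h k \<ge> 0" for k using rfin by (simp_all add: h_def)
      have sh: "summable h"
        using sumfin h by (intro summable_suminf_not_top) auto
      obtain k where k: "norm (\<Sum>i. h (i + k)) < e"
        using suminf_exist_split[OF \<open>e > 0\<close> sh] by blast
      have tail: "(\<Sum>i. ?H (R (i + k))) \<le> ennreal e"
      proof -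
        have "(\<Sum>i. ?H (R (i + k))) = ennreal (\<Sum>i. h (i + k))"
          using h sh by (simp add: suminf_ennreal2 summable_ignore_initial_segment)
        also have "\<dots> \<le> ennreal e" using k by (intro ennreal_leI) auto
        finally show ?thesis .
      qed
      have "(UNIV - F) \<inter> A \<subseteq> S k \<union> (\<Union>i. R (i + k))"
      proof
        fix x assume x: "x \<in> (UNIV - F) \<inter> A"
        then have "infdist x F > 0"
          using F False by (simp add: infdist_pos_not_in_closed)
        then obtain m where "1 / real (Suc m) < infdist x F"
          using nat_approx_posE by auto
        then have ex: "\<exists>m. x \<in> S m" using x by (auto simp: S_def intro: less_imp_le)
        define m where "m = (LEAST m. x \<in> S m)"
        have m: "x \<in> S m" unfolding m_def using ex by (rule LeastI_ex)
        show "x \<in> S k \<union> (\<Union>i. R (i + k))"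
        proof (cases "m \<le> k")
          case True
          have "1 / real (Suc k) \<le> 1 / real (Suc m)" using True by (intro divide_left_mono) auto
          then show ?thesis using m by (auto simp: S_def)
        next
          case False
          then have "x \<notin> S (m - 1)" unfolding m_def by (intro not_less_Least) auto
          with m False have "x \<in> R ((m - 1 - k) + k)" by (simp add: R_def)
          then show ?thesis by blast
        qed
      qed
      then have "?H ((UNIV - F) \<inter> A) \<le> ?H (S k \<union> (\<Union>i. R (i + k)))"
        by (rule hausdorff_outer_mono)
      also have "\<dots> \<le> ?H (S k) + (\<Sum>i. ?H (R (i + k)))"
        by (rule order_trans[OF hausdorff_outer_Un[OF d]]) (intro add_left_mono hausdorff_outer_UN)
      also have "\<dots> \<le> ?H (S k) + ennreal e" by (intro add_left_mono tail)
      finally have "?H (F \<inter> A) + ?H ((UNIV - F) \<inter> A) \<le> (?H (S k) + ?H (F \<inter> A)) + ennreal e"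
        by (simp add: ac_simps add_left_mono)
      also have "?H (S k) + ?H (F \<inter> A) \<le> ?H (S k \<union> (F \<inter> A))"
        by (rule sep[of _ "1 / real (Suc k)" _ 0]) (auto simp: S_def)
      also have "\<dots> \<le> ?H A" by (intro hausdorff_outer_mono) (auto simp: S_def)
      finally show "?H (F \<inter> A) + ?H ((UNIV - F) \<inter> A) \<le> ?H A + ennreal e"
        by (simp add: add_right_mono)
    qed
  qed simp
  moreover have "?H A \<le> ?H (F \<inter> A) + ?H ((UNIV - F) \<inter> A)" for A
    using hausdorff_outer_Un[OF d, of "F \<inter> A" "(UNIV - F) \<inter> A"]
    by (simp add: Int_Un_distrib2[symmetric])
  ultimately show ?thesis by (auto simp: lambda_system_def intro: antisym)
qed

lemma emeasure_measure_of_hausdorff_outer: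
  fixes A :: "'a::metric_space set"
  assumes d: "d > 0" and A: "A \<in> sets borel"
  shows "emeasure (measure_of UNIV (sets borel) (hausdorff_outer d)) A = hausdorff_outer d A"
proof -
  let ?L = "lambda_system (UNIV :: 'a set) UNIV (hausdorff_outer d)"
  interpret P: sigma_algebra "UNIV :: 'a set" UNIV
    using sigma_algebra_Pow[of "UNIV :: 'a set"] by simp
  have ms: "measure_space UNIV ?L (hausdorff_outer d)"
    by (rule P.caratheodory_lemma[OF outer_measure_space_hausdorff[OF d]])
  then have "sigma_algebra UNIV ?L" by (simp add: measure_space_def)
  then have "sigma_sets UNIV (Collect closed) \<subseteq> ?L"
    using closed_in_lambda_hausdorff[OF d] by (intro sigma_algebra.sigma_sets_subset) auto
  then have sub: "sets (borel :: 'a measure) \<subseteq> ?L"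
    by (simp add: borel_eq_closed)
  have "positive (sets borel) (hausdorff_outer d :: 'a set \<Rightarrow> ennreal)"
    by (simp add: positive_def hausdorff_outer_empty d)
  moreover have "countably_additive (sets borel) (hausdorff_outer d :: 'a set \<Rightarrow> ennreal)"
    using ms sub by (auto simp: measure_space_def countably_additive_def)
  ultimately show ?thesis
    using A sets.sigma_algebra_axioms[of "borel :: 'a measure"]
    by (intro emeasure_measure_of_sigma) auto
qed

lemma hausdorff_outer_unit_ball_ge:
  "1 \<le> hausdorff_outer CARD('d) (ball (0::real^'d) 1)"
proof -
  have "1 \<le> hausdorff_content CARD('d) 1 (ball (0::real^'d) 1)"
    unfolding hausdorff_content_def
  proof (rule INF_greatest)
    fix U :: "nat \<Rightarrow> (real^'d) set"
    assume "U \<in> {U. ball 0 1 \<subseteq> (\<Union>i. U i) \<and> (\<forall>i. bounded (U i) \<and> diameter (U i) \<le> 1)}"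
    then have U: "ball 0 1 \<subseteq> (\<Union>i. U i)" "\<And>i. bounded (U i)" by auto
    define D where "D i = diameter (U i)" for i
    have D: "D i \<ge> 0" for i unfolding D_def by (rule diameter_ge_0[OF U(2)])
    define c where "c i = (SOME x. x \<in> U i)" for i
    have sub: "U i \<subseteq> cball (c i) (D i)" for i
    proof
      fix x assume x: "x \<in> U i"
      then have "c i \<in> U i" unfolding c_def by (rule someI)
      then show "x \<in> cball (c i) (D i)"
        using x diameter_bounded_bound[OF U(2)] by (auto simp: D_def)
    qed
    define v where "v = unit_ball_vol (real CARD('d))"
    have v: "v > 0" by (simp add: v_def)
    have "ennreal v = emeasure lborel (ball (0::real^'d) 1)"
      by (subst emeasure_ball) (auto simp: v_def)
    also have "\<dots> \<le> emeasure lborel (\<Union>i. cball (c i) (D i))"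
      using U(1) sub by (intro emeasure_mono) (blast, measurable)
    also have "\<dots> \<le> (\<Sum>i. emeasure lborel (cball (c i) (D i)))"
      by (rule emeasure_subadditive_countably) auto
    also have "\<dots> = (\<Sum>i. ennreal v * ennreal (D i ^ CARD('d)))"
      using D v by (intro suminf_cong) (simp add: emeasure_cball v_def ennreal_mult)
    also have "\<dots> = ennreal v * (\<Sum>i. ennreal (D i ^ CARD('d)))"
      by (rule ennreal_suminf_cmult)
    finally have "ennreal v * 1 \<le> ennreal v * (\<Sum>i. ennreal (D i ^ CARD('d)))" by simp
    then show "1 \<le> (\<Sum>i. ennreal (diameter (U i) ^ CARD('d)))"
      using v by (subst (asm) ennreal_mult_le_mult_iff) (auto simp: D_def)
  qed
  then show ?thesis
    using hausdorff_content_le_outer[of 1] order_trans zero_less_one by blast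
qed

lemma hausdorff_outer_unit_ball_le:
  "hausdorff_outer CARD('d) (ball (0::real^'d) 1) \<le> ennreal ((2 * real CARD('d)) ^ CARD('d))"
  unfolding hausdorff_outer_def
proof (rule SUP_least)
  fix \<delta> :: real assume "\<delta> \<in> {0<..}"
  then have \<delta>: "\<delta> > 0" by simp
  let ?d = "CARD('d)"
  obtain N :: nat where N: "real ?d / \<delta> < real N" using reals_Archimedean2 by blast
  then have N0: "N > 0" using \<delta> by (metis divide_nonneg_pos gr0I not_less of_nat_0 of_nat_0_le_iff)
  have Nd: "real ?d / real N \<le> \<delta>" using N N0 \<delta> by (simp add: field_simps)
  define K where "K = (UNIV :: 'd set) \<rightarrow>\<^sub>E {..<2*N}"
  have finK: "finite K" and cardK: "card K = (2*N)^?d"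
    by (auto simp: K_def finite_PiE card_PiE)
  define Q :: "('d \<Rightarrow> nat) \<Rightarrow> (real^'d) set" where
    "Q k = {x. \<forall>i. real (k i) / N - 1 \<le> x $ i \<and> x $ i \<le> (real (k i) + 1) / N - 1}" for k
  have distQ: "dist x y \<le> real ?d / real N" if "x \<in> Q k" "y \<in> Q k" for x y k
  proof -
    have "\<bar>(x - y) $ i\<bar> \<le> 1 / real N" for i
    proof -
      have "real (k i) / N - 1 \<le> x $ i \<and> x $ i \<le> (real (k i) + 1) / N - 1"
           "real (k i) / N - 1 \<le> y $ i \<and> y $ i \<le> (real (k i) + 1) / N - 1"
        using that by (auto simp: Q_def)
      then show ?thesis by (auto simp: add_divide_distrib)
    qed
    then have "(\<Sum>i\<in>UNIV. \<bar>(x - y) $ i\<bar>) \<le> (\<Sum>i\<in>(UNIV::'d set). 1 / real N)"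
      by (intro sum_mono)
    then show ?thesis using norm_le_l1_cart[of "x - y"] by (simp add: dist_norm)
  qed
  have bQ: "bounded (Q k)" for k
    unfolding bounded_def
  proof (cases "Q k = {}")
    case False
    then obtain x where "x \<in> Q k" by auto
    then show "\<exists>x e. \<forall>y\<in>Q k. dist x y \<le> e" using distQ by blast
  qed simp
  have dQ: "diameter (Q k) \<le> real ?d / real N" for k
    using distQ by (intro diameter_le) (auto simp: dist_norm)
  obtain g where g: "bij_betw g {..<(2*N)^?d} K"
    using ex_bij_betw_nat_finite[OF finK] by (auto simp: cardK lessThan_atLeast0)
  define U where "U j = (if j < (2*N)^?d then Q (g j) else {})" for j
  have "ball (0::real^'d) 1 \<subseteq> (\<Union>j. U j)"
  proof
    fix x :: "real^'d" assume "x \<in> ball 0 1"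
    then have x: "\<bar>x $ i\<bar> < 1" for i
      using component_le_norm_cart[of x i] by simp
    define k where "k i = nat \<lfloor>(x $ i + 1) * N\<rfloor>" for i
    have kp: "real (k i) = of_int \<lfloor>(x $ i + 1) * N\<rfloor>" for i
      using x[of i] by (simp add: k_def)
    have k1: "real (k i) \<le> (x $ i + 1) * N" "(x $ i + 1) * N \<le> real (k i) + 1" for i
      unfolding kp by linarith+
    have "(x $ i + 1) * N < 2 * N" for i
      using x[of i] N0 mult_strict_right_mono[of "x $ i + 1" 2 "real N"] by simp
    then have "real (k i) < real (2 * N)" for i
      using k1(1)[of i] by (metis le_less_trans of_nat_mult of_nat_numeral)
    then have "k i < 2 * N" for i by (simp only: of_nat_less_iff)
    then have "k \<in> K" by (auto simp: K_def)
    then obtain j where "j < (2*N)^?d" "g j = k"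
      using g by (auto simp: bij_betw_def)
    moreover have "x \<in> Q k" using k1 N0 by (auto simp: Q_def field_simps)
    ultimately have "x \<in> U j" by (simp add: U_def)
    then show "x \<in> (\<Union>j. U j)" by blast
  qed
  then have "hausdorff_content ?d \<delta> (ball (0::real^'d) 1) \<le> (\<Sum>j. ennreal (diameter (U j) ^ ?d))"
    using \<delta> bQ order_trans[OF dQ Nd] by (intro hausdorff_content_le) (auto simp: U_def)
  also have "\<dots> = (\<Sum>j<(2*N)^?d. ennreal (diameter (U j) ^ ?d))"
    by (intro suminf_finite) (auto simp: U_def power_0_left)
  also have "\<dots> \<le> (\<Sum>j<(2*N)^?d. ennreal ((real ?d / real N) ^ ?d))"
    using dQ diameter_ge_0[OF bQ] by (intro sum_mono ennreal_leI power_mono) (auto simp: U_def)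
  also have "\<dots> = ennreal ((2 * real ?d) ^ ?d)"
    using N0 by (simp add: ennreal_of_nat_eq_real_of_nat ennreal_mult[symmetric] power_mult_distrib power_divide)
  finally show "hausdorff_content ?d \<delta> (ball (0::real^'d) 1) \<le> ennreal ((2 * real ?d) ^ ?d)" .
qed

(* d is carried by the finite index type 'd with CARD('d) = d >= 1, so that the unit ball of R^d
   which fixes the normalization (see emeasure_hausdorff_measure_unit_ball) is available. By
   emeasure_measure_of_hausdorff_outer, measure_of does not degenerate here. *)
definition hausdorff_measure :: "'d::finite itself \<Rightarrow> 'a::metric_space measure" where
  "hausdorff_measure _ =
     scale_measure (1 / hausdorff_outer CARD('d) (ball (0::real^'d) 1))
       (measure_of UNIV (sets borel) (hausdorff_outer CARD('d)))"

lemma sets_hausdorff_measure [simp, measurable_cong]: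
  "sets (hausdorff_measure TYPE('d::finite)) = sets borel"
  using sets.sigma_sets_eq[of borel] by (simp add: hausdorff_measure_def)

lemma emeasure_hausdorff_measure:
  assumes "A \<in> sets borel"
  shows "emeasure (hausdorff_measure TYPE('d::finite)) A =
           hausdorff_outer CARD('d) A / hausdorff_outer CARD('d) (ball (0::real^'d) 1)"
  using emeasure_measure_of_hausdorff_outer[OF _ assms, of "CARD('d)"]
  by (simp add: hausdorff_measure_def divide_ennreal_def mult.commute)

lemma emeasure_hausdorff_measure_unit_ball:
  "emeasure (hausdorff_measure TYPE('d::finite)) (ball (0::real^'d) 1) = 1"
proof -
  have "hausdorff_outer CARD('d) (ball (0::real^'d) 1) < top"
    using hausdorff_outer_unit_ball_le ennreal_less_top by (rule le_less_trans)
  moreover have "hausdorff_outer CARD('d) (ball (0::real^'d) 1) \<noteq> 0"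
    using hausdorff_outer_unit_ball_ge[where 'd='d] by auto
  ultimately show ?thesis
    by (subst emeasure_hausdorff_measure) (auto intro!: ennreal_divide_self)
qed

definition radon_measure :: "'a::euclidean_space measure \<Rightarrow> bool" where
  "radon_measure \<mu> \<longleftrightarrow>
     sets \<mu> = sets borel \<and> (\<forall>x. \<exists>U. open U \<and> x \<in> U \<and> emeasure \<mu> U < \<infinity>)"

definition measure_support :: "'a::euclidean_space measure \<Rightarrow> 'a set" where
  "measure_support \<mu> = {x. \<forall>r>0. emeasure \<mu> (ball x r) > 0}"

definition doubling_measure :: "real \<Rightarrow> 'a::euclidean_space measure \<Rightarrow> bool" where
  "doubling_measure C \<mu> \<longleftrightarrow>
     (\<forall>x\<in>measure_support \<mu>. \<forall>r>0. emeasure \<mu> (ball x (2 * r)) \<le> ennreal C * emeasure \<mu> (ball x r))"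

definition wasserstein1 :: "'a::euclidean_space measure \<Rightarrow> 'a measure \<Rightarrow> ennreal" where
  "wasserstein1 \<mu> \<nu> =
     (SUP \<psi>\<in>{\<psi> :: 'a \<Rightarrow> real. 1-lipschitz_on UNIV \<psi> \<and> (\<forall>x. x \<notin> ball 0 1 \<longrightarrow> \<psi> x = 0)}.
        ennreal \<bar>(\<integral>x. \<psi> x \<partial>\<mu>) - (\<integral>x. \<psi> x \<partial>\<nu>)\<bar>)"

(* The rescaled measure A |-> mu(x + r A) / mu(B(x,r)), as a push-forward; see emeasure_blowup. *)
definition blowup :: "'a::euclidean_space measure \<Rightarrow> 'a \<Rightarrow> real \<Rightarrow> 'a measure" where
  "blowup \<mu> x r = scale_measure (1 / emeasure \<mu> (ball x r)) (distr \<mu> borel (\<lambda>y. (y - x) /\<^sub>R r))"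

lemma emeasure_blowup:
  assumes "sets \<mu> = sets borel" "r > 0" "A \<in> sets borel"
  shows "emeasure (blowup \<mu> x r) A = emeasure \<mu> ((\<lambda>z. x + r *\<^sub>R z) ` A) / emeasure \<mu> (ball x r)"
proof -
  have "(\<lambda>y. (y - x) /\<^sub>R r) \<in> measurable \<mu> borel"
    unfolding measurable_cong_sets[OF assms(1) refl] by measurable
  moreover have "(\<lambda>y. (y - x) /\<^sub>R r) -` A \<inter> space \<mu> = (\<lambda>z. x + r *\<^sub>R z) ` A"
    using assms(2) sets_eq_imp_space_eq[OF assms(1)]
    by (auto simp: image_iff intro!: bexI[of _ "(_ - x) /\<^sub>R r"])
  ultimately show ?thesis
    using assms(3) by (simp add: blowup_def emeasure_distr divide_ennreal_def mult.commute)
qed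

definition planes_near_origin :: "nat \<Rightarrow> 'a::euclidean_space set set" where
  "planes_near_origin d = {V. affine V \<and> aff_dim V = int d \<and> V \<inter> ball 0 (1/2) \<noteq> {}}"

definition plane_measure :: "'d::finite itself \<Rightarrow> 'a::euclidean_space set \<Rightarrow> 'a measure" where
  "plane_measure T V =
     scale_measure (1 / emeasure (hausdorff_measure T) (V \<inter> ball 0 1))
       (density (hausdorff_measure T) (indicator V))"

definition alpha_number ::
    "'d::finite itself \<Rightarrow> 'a::euclidean_space measure \<Rightarrow> 'a \<Rightarrow> real \<Rightarrow> ennreal" where
  "alpha_number T \<mu> x r =
     (INF V\<in>planes_near_origin CARD('d). wasserstein1 (blowup \<mu> x r) (plane_measure T V))"

definition bi_lipschitz_on :: "real \<Rightarrow> 'a::metric_space set \<Rightarrow> ('a \<Rightarrow> 'b::metric_space) \<Rightarrow> bool" where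
  "bi_lipschitz_on L A f \<longleftrightarrow>
     (\<forall>x\<in>A. \<forall>y\<in>A. inverse L * dist x y \<le> dist (f x) (f y) \<and> dist (f x) (f y) \<le> L * dist x y)"

end

theory Submission
  imports Defs
begin

text \<open>At a point where the \<open>\<alpha>\<close>-numbers have a small sum over the scales, the approximating planes turn
  by a small total amount (comparing two planes costs only a constant times the sum of the two errors),
  so projection onto the top plane is bi-Lipschitz on the set of such points. A bound on the Carleson integral
  gives, off a set of small measure, a bounded sum for every point. One stops at the first
  scale at which the sum exceeds a threshold \<open>\<epsilon>\<close>, covers the stopped points by disjoint pieces of balls of the
  corresponding sizes, discards thin shells around the boundaries of these balls, and starts afresh inside each of
  them with a budget diminished by \<open>\<epsilon>\<close>. After boundedly many generations the partial maps are glued: each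
  is rescaled and placed at the projection of the centre of its ball. The density
  \<open>\<mu> (B (y, t)) / t ^ d\<close> varies along the scales by factors whose logarithms are bounded by the same sum,
  which gives the comparison of \<open>\<mu>\<close> with Hausdorff measure.\<close>

section \<open>Hausdorff measure under similarities\<close>

lemma ennreal_le_mult_iff_inverse:
  fixes x y :: ennreal
  assumes "c > 0" "ennreal (1 / c) * x \<le> y"
  shows "x \<le> ennreal c * y"
proof -
  have "x = ennreal c * (ennreal (1 / c) * x)"
    using assms(1) by (simp add: mult.assoc[symmetric] ennreal_mult[symmetric])
  also have "\<dots> \<le> ennreal c * y" using assms(2) by (rule mult_left_mono) simp
  finally show ?thesis .
qed

lemma hausdorff_content_lipschitz_image:
  fixes h :: "'a::metric_space \<Rightarrow> 'b::metric_space"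
  assumes K: "K > 0" and h: "\<And>x y. x \<in> A \<Longrightarrow> y \<in> A \<Longrightarrow> dist (h x) (h y) \<le> K * dist x y"
  shows "hausdorff_content d (K * \<delta>) (h ` A) \<le> ennreal (K ^ d) * hausdorff_content d \<delta> A"
proof (rule ennreal_le_mult_iff_inverse)
  show "ennreal (1 / K ^ d) * hausdorff_content d (K * \<delta>) (h ` A) \<le> hausdorff_content d \<delta> A"
    unfolding hausdorff_content_def[of d \<delta> A]
  proof (rule INF_greatest)
    fix U :: "nat \<Rightarrow> 'a set"
    assume "U \<in> {U. A \<subseteq> (\<Union>i. U i) \<and> (\<forall>i. bounded (U i) \<and> diameter (U i) \<le> \<delta>)}"
    then have U: "A \<subseteq> (\<Union>i. U i)" "\<And>i. bounded (U i)" "\<And>i. diameter (U i) \<le> \<delta>" by auto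
    have dist: "dist x y \<le> K * diameter (U i)" if "x \<in> h ` (A \<inter> U i)" "y \<in> h ` (A \<inter> U i)" for x y i
    proof -
      obtain u v where uv: "u \<in> A" "v \<in> A" "u \<in> U i" "v \<in> U i" "x = h u" "y = h v" using \<open>x \<in> _\<close> \<open>y \<in> _\<close> by auto
      have "dist x y \<le> K * dist u v" using h uv by simp
      also have "\<dots> \<le> K * diameter (U i)"
        using K diameter_bounded_bound[OF U(2) uv(3,4)] by simp
      finally show ?thesis .
    qed
    have b: "bounded (h ` (A \<inter> U i))" for i
    proof (cases "h ` (A \<inter> U i) = {}")
      case False
      then obtain z where "z \<in> h ` (A \<inter> U i)" by auto
      then show ?thesis unfolding bounded_def using dist by blast
    qed simp
    have dm: "diameter (h ` (A \<inter> U i)) \<le> K * diameter (U i)" for i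
    proof (cases "h ` (A \<inter> U i) = {}")
      case True
      then show ?thesis using K diameter_ge_0[OF U(2)[of i]] by simp
    next
      case False
      then show ?thesis unfolding diameter_def[of "h ` (A \<inter> U i)"] using dist by (auto intro!: cSUP_least)
    qed
    have "hausdorff_content d (K * \<delta>) (h ` A) \<le> (\<Sum>i. ennreal (diameter (h ` (A \<inter> U i)) ^ d))"
    proof (rule hausdorff_content_le)
      show "h ` A \<subseteq> (\<Union>i. h ` (A \<inter> U i))" using U(1) by blast
      show "diameter (h ` (A \<inter> U i)) \<le> K * \<delta>" for i
        using dm[of i] mult_left_mono[OF U(3)[of i], of K] K by linarith
    qed (rule b)
    also have "\<dots> \<le> (\<Sum>i. ennreal (K ^ d) * ennreal (diameter (U i) ^ d))"
      using K dm by (intro suminf_le)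
         (auto simp: ennreal_mult[symmetric] power_mult_distrib[symmetric] diameter_ge_0 U b
               intro!: ennreal_leI power_mono)
    also have "\<dots> = ennreal (K ^ d) * (\<Sum>i. ennreal (diameter (U i) ^ d))" by (rule ennreal_suminf_cmult)
    finally have "ennreal (1 / K ^ d) * hausdorff_content d (K * \<delta>) (h ` A)
       \<le> ennreal (1 / K ^ d) * (ennreal (K ^ d) * (\<Sum>i. ennreal (diameter (U i) ^ d)))"
      by (rule mult_left_mono) simp
    also have "\<dots> = (\<Sum>i. ennreal (diameter (U i) ^ d))"
      using K by (simp add: mult.assoc[symmetric] ennreal_mult[symmetric])
    finally show "ennreal (1 / K ^ d) * hausdorff_content d (K * \<delta>) (h ` A) \<le> (\<Sum>i. ennreal (diameter (U i) ^ d))" .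
  qed
qed (use K in simp)

lemma hausdorff_outer_lipschitz_image:
  fixes h :: "'a::metric_space \<Rightarrow> 'b::metric_space"
  assumes K: "K > 0" and h: "\<And>x y. x \<in> A \<Longrightarrow> y \<in> A \<Longrightarrow> dist (h x) (h y) \<le> K * dist x y"
  shows "hausdorff_outer d (h ` A) \<le> ennreal (K ^ d) * hausdorff_outer d A"
  unfolding hausdorff_outer_def[of d "h ` A"]
proof (rule SUP_least)
  fix \<delta> :: real assume "\<delta> \<in> {0<..}"
  then have "hausdorff_content d (K * (\<delta> / K)) (h ` A) \<le> ennreal (K ^ d) * hausdorff_content d (\<delta> / K) A"
    by (intro hausdorff_content_lipschitz_image assms)
  also have "\<dots> \<le> ennreal (K ^ d) * hausdorff_outer d A"
    using K \<open>\<delta> \<in> _\<close> by (intro mult_left_mono hausdorff_content_le_outer) auto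
  finally show "hausdorff_content d \<delta> (h ` A) \<le> ennreal (K ^ d) * hausdorff_outer d A" using K by simp
qed

lemma hausdorff_outer_similarity_image:
  fixes h :: "'a::metric_space \<Rightarrow> 'b::metric_space"
  assumes K: "K > 0" and h: "\<And>x y. x \<in> A \<Longrightarrow> y \<in> A \<Longrightarrow> dist (h x) (h y) = K * dist x y"
  shows "hausdorff_outer d (h ` A) = ennreal (K ^ d) * hausdorff_outer d A"
proof (rule antisym)
  have inj: "inj_on h A" using h K by (metis dist_eq_0_iff inj_onI mult_eq_0_iff order_less_irrefl)
  have "hausdorff_outer d (inv_into A h ` (h ` A)) \<le> ennreal ((1 / K) ^ d) * hausdorff_outer d (h ` A)"
    using inj h K by (intro hausdorff_outer_lipschitz_image) (auto simp: field_simps)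
  then have "hausdorff_outer d A \<le> ennreal (1 / K ^ d) * hausdorff_outer d (h ` A)"
    using inj by (simp add: inv_into_image_cancel power_one_over)
  then have "ennreal (K ^ d) * hausdorff_outer d A \<le> ennreal (K ^ d) * (ennreal (1 / K ^ d) * hausdorff_outer d (h ` A))"
    by (rule mult_left_mono) simp
  also have "\<dots> = hausdorff_outer d (h ` A)"
    using K by (simp add: mult.assoc[symmetric] ennreal_mult[symmetric])
  finally show "ennreal (K ^ d) * hausdorff_outer d A \<le> hausdorff_outer d (h ` A)" .
qed (use h K in \<open>auto intro!: hausdorff_outer_lipschitz_image\<close>)

lemma hausdorff_outer_unit_ball_finite: "hausdorff_outer CARD('d) (ball (0::real^'d::finite) 1) \<noteq> top"
  using hausdorff_outer_unit_ball_le[where 'd='d] by (auto simp: top_unique)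

lemma emeasure_hausdorff_measure_similarity:
  fixes h :: "'a::metric_space \<Rightarrow> 'b::metric_space"
  assumes K: "K > 0" and h: "\<And>x y. x \<in> A \<Longrightarrow> y \<in> A \<Longrightarrow> dist (h x) (h y) = K * dist x y"
    and A: "A \<in> sets borel" "h ` A \<in> sets borel"
  shows "emeasure (hausdorff_measure TYPE('d::finite)) (h ` A)
     = ennreal (K ^ CARD('d)) * emeasure (hausdorff_measure TYPE('d)) A"
  using A by (simp add: emeasure_hausdorff_measure hausdorff_outer_similarity_image[OF K h] ennreal_times_divide)

lemma emeasure_hausdorff_measure_ball:
  assumes "s \<ge> 0"
  shows "emeasure (hausdorff_measure TYPE('d::finite)) (ball (u::real^'d) s) = ennreal (s ^ CARD('d))"
proof (cases "s = 0")
  case False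
  with assms have s: "s > 0" by simp
  have "ball u s = (\<lambda>v. u + s *\<^sub>R v) ` ball 0 1"
  proof safe
    fix x assume "x \<in> ball u s"
    then have "(x - u) /\<^sub>R s \<in> ball 0 1" "x = u + s *\<^sub>R ((x - u) /\<^sub>R s)" using s
      by (auto simp: dist_norm norm_minus_commute divide_simps)
    then show "x \<in> (\<lambda>v. u + s *\<^sub>R v) ` ball 0 1" by blast
  qed (use s in \<open>auto simp: dist_norm\<close>)
  then have "emeasure (hausdorff_measure TYPE('d)) (ball u s) =
     emeasure (hausdorff_measure TYPE('d)) ((\<lambda>v. u + s *\<^sub>R v) ` ball (0::real^'d) 1)" by simp
  also have "\<dots> = ennreal (s ^ CARD('d)) * emeasure (hausdorff_measure TYPE('d)) (ball (0::real^'d) 1)"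
    using s \<open>ball u s = _\<close>[symmetric]
    by (intro emeasure_hausdorff_measure_similarity) (auto simp: dist_norm scaleR_diff_right[symmetric])
  finally show ?thesis by (simp add: emeasure_hausdorff_measure_unit_ball)
qed (simp add: power_0_left)

lemma distr_hausdorff_measure_isometry:
  fixes h :: "'a::metric_space \<Rightarrow> 'b::metric_space"
  assumes h: "\<And>x y. dist (h x) (h y) = dist x y" and R: "range h \<in> sets borel"
  shows "density (hausdorff_measure TYPE('d::finite)) (indicator (range h)) = distr (hausdorff_measure TYPE('d)) borel h"
proof (rule measure_eqI)
  have "continuous_on UNIV h" unfolding continuous_on_iff using h by auto
  then have m: "h \<in> borel_measurable borel" by (rule borel_measurable_continuous_onI)
  then have m': "h \<in> measurable (hausdorff_measure TYPE('d)) borel"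
    by (simp add: measurable_def space_borel sets_eq_imp_space_eq[OF sets_hausdorff_measure])
  fix A assume "A \<in> sets (density (hausdorff_measure TYPE('d)) (indicator (range h)))"
  then have A: "A \<in> sets borel" by simp
  have sp: "space (hausdorff_measure TYPE('d)::'a measure) = UNIV"
    using sets_eq_imp_space_eq[OF sets_hausdorff_measure] by simp
  have im: "h ` (h -` A) = A \<inter> range h" by auto
  have hA: "h -` A \<in> sets borel" using measurable_sets[OF m A] by (simp add: space_borel)
  have "emeasure (hausdorff_measure TYPE('d)) (h ` (h -` A)) = ennreal (1 ^ CARD('d)) * emeasure (hausdorff_measure TYPE('d)) (h -` A)"
    using hA A R im h by (intro emeasure_hausdorff_measure_similarity) auto
  moreover have "emeasure (density (hausdorff_measure TYPE('d)) (indicator (range h))) A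
      = emeasure (hausdorff_measure TYPE('d)) (A \<inter> range h)"
  proof -
    have "emeasure (density (hausdorff_measure TYPE('d)) (indicator (range h))) A
      = (\<integral>\<^sup>+x. indicator (range h) x * indicator A x \<partial>hausdorff_measure TYPE('d))"
      using A R by (intro emeasure_density) auto
    also have "\<dots> = (\<integral>\<^sup>+x. indicator (A \<inter> range h) x \<partial>hausdorff_measure TYPE('d))"
      by (rule nn_integral_cong) (auto split: split_indicator)
    also have "\<dots> = emeasure (hausdorff_measure TYPE('d)) (A \<inter> range h)"
      using A R by (subst nn_integral_indicator) auto
    finally show ?thesis .
  qed
  ultimately show "emeasure (density (hausdorff_measure TYPE('d)) (indicator (range h))) A =
       emeasure (distr (hausdorff_measure TYPE('d)) borel h) A"
    using A by (simp add: emeasure_distr[OF m' A] sp im)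
qed simp

lemma distr_hausdorff_measure_surj_isometry:
  fixes h :: "'a::metric_space \<Rightarrow> 'a"
  assumes "\<And>x y. dist (h x) (h y) = dist x y" "surj h"
  shows "distr (hausdorff_measure TYPE('d::finite)) borel h = hausdorff_measure TYPE('d)"
  using distr_hausdorff_measure_isometry[of h, where 'd='d] assms by (simp add: density_1)

section \<open>Isometric embeddings and planes\<close>

definition isometric :: "('b::euclidean_space \<Rightarrow> 'a::euclidean_space) \<Rightarrow> bool" where
  "isometric \<phi> \<longleftrightarrow> linear \<phi> \<and> (\<forall>u. norm (\<phi> u) = norm u)"

definition perp :: "('b::euclidean_space \<Rightarrow> 'a::euclidean_space) \<Rightarrow> 'a \<Rightarrow> 'a" where
  "perp \<phi> x = x - \<phi> (adjoint \<phi> x)"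

context
  fixes \<phi> :: "'b::euclidean_space \<Rightarrow> 'a::euclidean_space"
  assumes iso: "isometric \<phi>"
begin

lemma isometric_linear: "linear \<phi>" and isometric_norm: "norm (\<phi> u) = norm u"
  using iso by (auto simp: isometric_def)

lemma isometric_dist: "dist (p + \<phi> u) (p + \<phi> v) = dist u v"
  using isometric_norm[of "u - v"] by (simp add: dist_norm linear_diff[OF isometric_linear])

lemma isometric_inner: "\<phi> u \<bullet> \<phi> v = u \<bullet> v"
  using isometric_norm by (simp add: dot_norm linear_add[OF isometric_linear, symmetric])

lemma adjoint_isometric: "adjoint \<phi> (\<phi> u) = u"
  by (rule vector_eq_rdot[THEN iffD1]) (simp add: adjoint_clauses[OF isometric_linear] isometric_inner)

lemma norm_adjoint_isometric: "norm (adjoint \<phi> x) \<le> norm x"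
proof -
  have "norm (adjoint \<phi> x) * norm (adjoint \<phi> x) = \<phi> (adjoint \<phi> x) \<bullet> x"
    using adjoint_works[OF isometric_linear, of "adjoint \<phi> x" x]
    by (simp add: power2_norm_eq_inner power2_eq_square[symmetric])
  also have "\<dots> \<le> norm (adjoint \<phi> x) * norm x"
    using norm_cauchy_schwarz[of "\<phi> (adjoint \<phi> x)" x] by (simp add: isometric_norm)
  finally show ?thesis
    by (cases "norm (adjoint \<phi> x) = 0") (auto simp: mult_le_cancel_left_pos)
qed

lemma linear_perp: "linear (perp \<phi>)"
  by (intro linearI)
    (simp_all add: perp_def scaleR_diff_right linear_add linear_scale isometric_linear adjoint_linear[OF isometric_linear])

lemma perp_isometric: "perp \<phi> (\<phi> u) = 0"
  by (simp add: perp_def adjoint_isometric)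

lemma norm_perp: "norm (perp \<phi> x) \<le> norm x"
proof -
  have "perp \<phi> x \<bullet> \<phi> (adjoint \<phi> x) = 0"
    using adjoint_works[OF isometric_linear, of "adjoint \<phi> x" "perp \<phi> x"]
    by (simp add: perp_def linear_diff[OF adjoint_linear[OF isometric_linear]] adjoint_isometric inner_commute)
  then have "(norm (perp \<phi> x + \<phi> (adjoint \<phi> x)))\<^sup>2 = (norm (perp \<phi> x))\<^sup>2 + (norm (\<phi> (adjoint \<phi> x)))\<^sup>2"
    by (intro norm_add_Pythagorean) (simp add: orthogonal_def)
  then have "(norm (perp \<phi> x))\<^sup>2 \<le> (norm x)\<^sup>2"
    by (simp add: perp_def)
  then show ?thesis by (simp add: abs_le_square_iff[symmetric])
qed

lemma perp_decomposition: "x = \<phi> (adjoint \<phi> x) + perp \<phi> x"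
  by (simp add: perp_def)

end

lemma integral_ge_on_set:
  fixes f :: "'a \<Rightarrow> real"
  assumes "integrable N f" "\<And>x. 0 \<le> f x" "\<And>x. x \<in> A \<Longrightarrow> c \<le> f x" "A \<in> sets N" "emeasure N A < \<infinity>"
  shows "c * measure N A \<le> (\<integral>x. f x \<partial>N)"
proof -
  have "(\<integral>x. c * indicator A x \<partial>N) \<le> (\<integral>x. f x \<partial>N)"
    using assms by (intro integral_mono) (auto simp: split: split_indicator)
  then show ?thesis using assms by simp
qed

lemma integral_le_on_set:
  fixes f :: "'a \<Rightarrow> real"
  assumes "integrable N f" "\<And>x. x \<in> A \<Longrightarrow> f x \<le> c" "\<And>x. x \<notin> A \<Longrightarrow> f x \<le> 0" "A \<in> sets N" "emeasure N A < \<infinity>"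
  shows "(\<integral>x. f x \<partial>N) \<le> c * measure N A"
proof -
  have "(\<integral>x. f x \<partial>N) \<le> (\<integral>x. c * indicator A x \<partial>N)"
    using assms by (intro integral_mono) (auto simp: split: split_indicator)
  then show ?thesis using assms by simp
qed

lemma lipschitz_integrable:
  fixes \<psi> :: "'a::euclidean_space \<Rightarrow> real"
  assumes N: "sets N = sets borel" "\<And>s. emeasure N (ball y s) < \<infinity>"
    and \<psi>: "L-lipschitz_on UNIV \<psi>" "\<And>x. x \<notin> ball y s \<Longrightarrow> \<psi> x = 0"
  shows "integrable N \<psi>"
proof -
  have c: "continuous_on UNIV \<psi>" using lipschitz_on_continuous_on[OF \<psi>(1)] .
  then have "\<psi> \<in> borel_measurable N"
    using N(1) borel_measurable_continuous_onI measurable_cong_sets by blast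
  have "bounded (\<psi> ` cball y s)"
    by (intro compact_imp_bounded compact_continuous_image continuous_on_subset[OF c]) auto
  then obtain B where "\<forall>x\<in>cball y s. norm (\<psi> x) \<le> B" unfolding bounded_iff by auto
  then have "AE x\<in>ball y s in N. norm (\<psi> x) \<le> B" by (intro AE_I2) auto
  with \<open>\<psi> \<in> borel_measurable N\<close> show ?thesis
    using N \<psi> by (intro integrableI_bounded_set[where A="ball y s"]) auto
qed

lemma space_hausdorff_measure: "space (hausdorff_measure TYPE('d::finite)) = UNIV"
  using sets_eq_imp_space_eq[OF sets_hausdorff_measure] by simp

lemma measure_hausdorff_measure_ball:
  "s \<ge> 0 \<Longrightarrow> measure (hausdorff_measure TYPE('d::finite)) (ball (u::real^'d) s) = s ^ CARD('d)"
  by (simp add: measure_def emeasure_hausdorff_measure_ball)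

lemma emeasure_hausdorff_measure_ball_finite:
  "emeasure (hausdorff_measure TYPE('d::finite)) (ball (u::real^'d) s) < \<infinity>"
  by (cases "s \<ge> 0") (simp_all add: emeasure_hausdorff_measure_ball ball_empty)

lemma lipschitz_on_isometric:
  assumes "isometric \<phi>" "L-lipschitz_on UNIV \<psi>"
  shows "L-lipschitz_on UNIV (\<lambda>u. \<psi> (p + \<phi> u))"
proof (rule lipschitz_onI)
  show "dist (\<psi> (p + \<phi> x)) (\<psi> (p + \<phi> y)) \<le> L * dist x y" for x y
    using lipschitz_onD[OF assms(2), of "p + \<phi> x" "p + \<phi> y"] by (simp only: isometric_dist[OF assms(1)] UNIV_I)
qed (rule lipschitz_on_nonneg[OF assms(2)])

lemma isometric_plane_integrable:
  fixes \<psi> :: "'a::euclidean_space \<Rightarrow> real" and \<phi> :: "real^'d \<Rightarrow> 'a"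
  assumes \<phi>: "isometric \<phi>" and \<psi>: "L-lipschitz_on UNIV \<psi>" "\<And>x. x \<notin> ball y s \<Longrightarrow> \<psi> x = 0"
  shows "integrable (hausdorff_measure TYPE('d::finite)) (\<lambda>u. \<psi> (p + \<phi> u))"
proof (rule lipschitz_integrable[where y=0])
  show "L-lipschitz_on UNIV (\<lambda>u. \<psi> (p + \<phi> u))" by (rule lipschitz_on_isometric[OF \<phi> \<psi>(1)])
  fix u :: "real^'d" assume u: "u \<notin> ball 0 (dist p y + s)"
  have "p + \<phi> u \<notin> ball y s"
    using u isometric_norm[OF \<phi>, of u] norm_triangle_ineq[of "p + \<phi> u - y" "y - p"]
    by (auto simp: dist_norm norm_minus_commute)
  then show "\<psi> (p + \<phi> u) = 0" by (rule \<psi>(2))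
qed (simp_all add: emeasure_hausdorff_measure_ball_finite[simplified])

lemma isometric_plane_integral_recenter:
  fixes \<psi> :: "'a::euclidean_space \<Rightarrow> real" and \<phi> :: "real^'d::finite \<Rightarrow> 'a"
  assumes \<phi>: "isometric \<phi>" and \<psi>: "continuous_on UNIV \<psi>"
  shows "(\<integral>u. \<psi> (p + \<phi> w + \<phi> u) \<partial>hausdorff_measure TYPE('d)) = (\<integral>u. \<psi> (p + \<phi> u) \<partial>hausdorff_measure TYPE('d))"
proof -
  let ?H = "hausdorff_measure TYPE('d) :: (real^'d) measure"
  have cont: "continuous_on UNIV (\<lambda>u. \<psi> (p + \<phi> u))"
    using \<psi> by (intro continuous_on_compose2[OF \<psi>] continuous_intros linear_continuous_on[OF linear_conv_bounded_linear[THEN iffD1, OF isometric_linear[OF \<phi>]]]) auto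
  have "(\<integral>u. \<psi> (p + \<phi> u) \<partial>?H) = (\<integral>u. \<psi> (p + \<phi> u) \<partial>distr ?H borel (\<lambda>u. w + u))"
    by (subst distr_hausdorff_measure_surj_isometry) (auto intro: surj_plus)
  also have "\<dots> = (\<integral>u. \<psi> (p + \<phi> (w + u)) \<partial>?H)"
    using cont by (intro integral_distr) (auto intro!: borel_measurable_continuous_onI)
  finally show ?thesis by (simp add: linear_add[OF isometric_linear[OF \<phi>]] add.assoc)
qed

lemma hausdorff_measure_integral_reflect:
  fixes g :: "real^'d::finite \<Rightarrow> real"
  assumes "g \<in> borel_measurable borel"
  shows "(\<integral>u. g (2 *\<^sub>R w - u) \<partial>hausdorff_measure TYPE('d)) = (\<integral>u. g u \<partial>hausdorff_measure TYPE('d))"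
proof -
  let ?H = "hausdorff_measure TYPE('d) :: (real^'d) measure"
  have "surj (\<lambda>u. 2 *\<^sub>R w - u)" by (rule surjI[of _ "\<lambda>u. 2 *\<^sub>R w - u"]) simp
  then have "(\<integral>u. g u \<partial>?H) = (\<integral>u. g u \<partial>distr ?H borel (\<lambda>u. 2 *\<^sub>R w - u))"
    by (subst distr_hausdorff_measure_surj_isometry) (auto simp: dist_norm norm_minus_commute)
  also have "\<dots> = (\<integral>u. g (2 *\<^sub>R w - u) \<partial>?H)"
    using assms by (intro integral_distr) simp_all
  finally show ?thesis by simp
qed

section \<open>Flatness of doubling measures\<close>

text \<open>The plane is the range of \<open>u \<mapsto> p + \<phi> u\<close>, so that Hausdorff measure on it becomes Hausdorff measure
  on the parameter space; \<open>m\<close> absorbs the normalisation of both measures.\<close>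

definition plane_approx :: "'a::euclidean_space measure \<Rightarrow> 'a \<Rightarrow> real \<Rightarrow> 'a \<Rightarrow> (real^'d::finite \<Rightarrow> 'a) \<Rightarrow> real \<Rightarrow> real \<Rightarrow> bool" where
  "plane_approx \<mu> y \<rho> p \<phi> m \<delta> \<longleftrightarrow>
     (\<forall>\<psi>. 1-lipschitz_on UNIV \<psi> \<and> (\<forall>x. x \<notin> ball y \<rho> \<longrightarrow> \<psi> x = 0) \<longrightarrow>
       \<bar>(\<integral>x. \<psi> x \<partial>\<mu>) - m * (\<integral>u. \<psi> (p + \<phi> u) \<partial>hausdorff_measure TYPE('d))\<bar> \<le> \<delta> * \<rho> * measure \<mu> (ball y \<rho>))"

definition flat :: "'a::euclidean_space measure \<Rightarrow> 'a \<Rightarrow> real \<Rightarrow> (real^'d::finite \<Rightarrow> 'a) \<Rightarrow> real \<Rightarrow> real \<Rightarrow> bool" where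
  "flat \<mu> y \<rho> \<phi> m \<delta> \<longleftrightarrow> isometric \<phi> \<and> (\<exists>p. plane_approx \<mu> y \<rho> p \<phi> m \<delta>)"

lemma flat_isometric: "flat \<mu> y \<rho> \<phi> m \<delta> \<Longrightarrow> isometric \<phi>"
  by (simp add: flat_def)

lemma flat_shrink:
  assumes "flat \<mu> z t \<phi> m \<delta>" "ball y \<rho> \<subseteq> ball z t"
    and "\<delta> * t * measure \<mu> (ball z t) \<le> \<delta>' * \<rho> * measure \<mu> (ball y \<rho>)"
  shows "flat \<mu> y \<rho> \<phi> m \<delta>'"
  using assms unfolding flat_def plane_approx_def by (meson order_trans subsetD)

lemma flat_mono:
  assumes "flat \<mu> y \<rho> \<phi> m \<delta>" "\<delta> \<le> \<delta>'" "\<rho> \<ge> 0"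
  shows "flat \<mu> y \<rho> \<phi> m \<delta>'"
  using assms by (intro flat_shrink[OF assms(1)]) (auto intro!: mult_right_mono)

lemma plane_approxD:
  fixes \<phi> :: "real^'d::finite \<Rightarrow> 'a::euclidean_space"
  assumes p: "plane_approx \<mu> y \<rho> p \<phi> m \<delta>" and L: "L > 0" "L-lipschitz_on UNIV \<psi>"
    and v: "\<And>x. x \<notin> ball y \<rho> \<Longrightarrow> \<psi> x = 0"
  shows "\<bar>(\<integral>x. \<psi> x \<partial>\<mu>) - m * (\<integral>u. \<psi> (p + \<phi> u) \<partial>hausdorff_measure TYPE('d))\<bar> \<le> L * \<delta> * \<rho> * measure \<mu> (ball y \<rho>)"
proof -
  have "(inverse L * L)-lipschitz_on UNIV (\<lambda>x. inverse L *\<^sub>R \<psi> x)"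
    using lipschitz_on_cmult[OF L(2), of "inverse L"] L(1) by simp
  then have "1-lipschitz_on UNIV (\<lambda>x. \<psi> x / L)" using L(1) by (simp add: field_simps)
  then have "\<bar>(\<integral>x. \<psi> x / L \<partial>\<mu>) - m * (\<integral>u. \<psi> (p + \<phi> u) / L \<partial>hausdorff_measure TYPE('d))\<bar> \<le> \<delta> * \<rho> * measure \<mu> (ball y \<rho>)"
    using v p unfolding plane_approx_def by (elim allE[where x = "\<lambda>x. \<psi> x / L"]) auto
  moreover have "(\<integral>x. \<psi> x / L \<partial>\<mu>) - m * (\<integral>u. \<psi> (p + \<phi> u) / L \<partial>hausdorff_measure TYPE('d))
     = ((\<integral>x. \<psi> x \<partial>\<mu>) - m * (\<integral>u. \<psi> (p + \<phi> u) \<partial>hausdorff_measure TYPE('d))) / L"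
    by (simp add: diff_divide_distrib)
  ultimately show ?thesis using L(1) by (simp add: abs_divide field_simps)
qed

definition bump :: "'a::euclidean_space \<Rightarrow> real \<Rightarrow> 'a \<Rightarrow> real" where
  "bump c s x = max 0 (s - dist x c)"

lemma lipschitz_bump: "1-lipschitz_on UNIV (bump c s)"
proof (rule lipschitz_onI)
  fix x y :: 'a
  show "dist (bump c s x) (bump c s y) \<le> 1 * dist x y"
    using dist_triangle[of x c y] dist_triangle[of y c x] by (auto simp: bump_def dist_real_def dist_commute)
qed simp

lemma bump_nonneg [simp]: "0 \<le> bump c s x"
  and bump_outside: "x \<notin> ball c s \<Longrightarrow> bump c s x = 0"
  and bump_le: "0 \<le> s \<Longrightarrow> bump c s x \<le> s"
  and bump_ge: "x \<in> ball c t \<Longrightarrow> s - t \<le> bump c s x"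
  and bump_le_dist: "bump c s x \<le> bump c' s x + dist c c'"
  using dist_triangle[of x c' c] by (auto simp: bump_def dist_commute)

locale doubling_radon =
  fixes \<mu> :: "'a::euclidean_space measure" and C :: real
  assumes radon: "radon_measure \<mu>" and doubling: "doubling_measure C \<mu>" and C_ge_1: "1 \<le> C"
begin

abbreviation "S \<equiv> measure_support \<mu>"
abbreviation "M y s \<equiv> measure \<mu> (ball y s)"

lemma sets_mu [measurable_cong, simp]: "sets \<mu> = sets borel" and space_mu [simp]: "space \<mu> = UNIV"
  using radon sets_eq_imp_space_eq[of \<mu> borel] by (auto simp: radon_measure_def)

lemma finite_ball: "emeasure \<mu> (ball y s) < \<infinity>"
proof -
  have "\<forall>x. \<exists>U. open U \<and> x \<in> U \<and> emeasure \<mu> U < \<infinity>" using radon by (simp add: radon_measure_def)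
  then obtain U where U: "\<And>x. open (U x)" "\<And>x. x \<in> U x" "\<And>x. emeasure \<mu> (U x) < \<infinity>" by metis
  obtain D where D: "D \<subseteq> cball y s" "finite D" "cball y s \<subseteq> (\<Union>x\<in>D. U x)"
    by (rule compactE_image[OF compact_cball[of y s], of "cball y s" U]) (use U in auto)
  have "emeasure \<mu> (ball y s) \<le> emeasure \<mu> (\<Union>x\<in>D. U x)"
    using D(3) ball_subset_cball[of y s] U(1) D(2) by (intro emeasure_mono) auto
  also have "\<dots> \<le> (\<Sum>x\<in>D. emeasure \<mu> (U x))"
    using D(2) U(1) by (intro emeasure_subadditive_finite) auto
  also have "\<dots> < \<infinity>" using U(3) D(2) by (simp add: less_top)
  finally show ?thesis .
qed

lemma ball_fmeasurable [simp, intro]: "ball y s \<in> fmeasurable \<mu>"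
  using finite_ball by (intro fmeasurableI) auto

lemma emeasure_ball_eq: "emeasure \<mu> (ball y s) = ennreal (M y s)"
  using finite_ball[of y s] by (intro emeasure_eq_ennreal_measure) auto

lemma M_pos: "y \<in> S \<Longrightarrow> s > 0 \<Longrightarrow> 0 < M y s"
  by (auto simp: measure_support_def emeasure_ball_eq)

lemma M_double: "y \<in> S \<Longrightarrow> s > 0 \<Longrightarrow> M y (2 * s) \<le> C * M y s"
  using doubling C_ge_1 by (auto simp: doubling_measure_def emeasure_ball_eq ennreal_mult[symmetric])

lemma M_double_pow:
  assumes "y \<in> S" "s > 0"
  shows "M y (2 ^ j * s) \<le> C ^ j * M y s"
proof (induction j)
  case (Suc j)
  have "M y (2 ^ Suc j * s) \<le> C * M y (2 ^ j * s)"
    using M_double[OF assms(1), of "2 ^ j * s"] assms by (simp add: mult.assoc)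
  also have "\<dots> \<le> C * (C ^ j * M y s)" using Suc C_ge_1 by (intro mult_left_mono) auto
  finally show ?case by (simp add: mult.assoc)
qed simp

lemma M_mono: "ball z t \<subseteq> ball y s \<Longrightarrow> M z t \<le> M y s"
  by (rule measure_mono_fmeasurable) auto

lemma M_compare:
  assumes "y \<in> S" "s > 0" "dist z y + t \<le> 2 ^ j * s"
  shows "M z t \<le> C ^ j * M y s"
proof -
  have "ball z t \<subseteq> ball y (2 ^ j * s)"
  proof
    fix w assume "w \<in> ball z t"
    then show "w \<in> ball y (2 ^ j * s)" using assms(3) dist_triangle[of y w z] by (simp add: dist_commute)
  qed
  from M_mono[OF this] M_double_pow[OF assms(1,2), of j] show ?thesis by linarith
qed

lemma lipschitz_integrable_mu:
  assumes "L-lipschitz_on UNIV \<psi>" "\<And>x. x \<notin> ball y s \<Longrightarrow> (\<psi> x :: real) = 0"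
  shows "integrable \<mu> \<psi>"
  using lipschitz_integrable[OF _ _ assms] finite_ball by simp

lemma integral_bump_ge:
  assumes "s > 0" shows "s / 2 * M c (s / 2) \<le> (\<integral>x. bump c s x \<partial>\<mu>)"
proof (rule integral_ge_on_set)
  show "integrable \<mu> (bump c s)" by (rule lipschitz_integrable_mu[OF lipschitz_bump bump_outside])
  show "x \<in> ball c (s / 2) \<Longrightarrow> s / 2 \<le> bump c s x" for x using bump_ge[of x c "s/2" s] by simp
qed (use finite_ball in auto)

lemma integral_bump_le:
  assumes "s > 0" shows "(\<integral>x. bump c s x \<partial>\<mu>) \<le> s * M c s"
proof (rule integral_le_on_set)
  show "integrable \<mu> (bump c s)" by (rule lipschitz_integrable_mu[OF lipschitz_bump bump_outside])
  show "bump c s x \<le> s" for x using bump_le[of s c x] assms by auto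
  show "x \<notin> ball c s \<Longrightarrow> bump c s x \<le> 0" for x using bump_outside[of x c s] by simp
qed (use finite_ball in auto)

lemma flat_center:
  fixes \<phi> :: "real^'d::finite \<Rightarrow> 'a"
  assumes y: "y \<in> S" and \<rho>: "\<rho> > 0" and fl: "flat \<mu> y \<rho> \<phi> m \<delta>" and \<delta>: "\<delta> < 1 / (32 * C ^ 4)"
  obtains p where "dist p y < \<rho> / 8" "m > 0"
     "plane_approx \<mu> y \<rho> p \<phi> m \<delta>"
     "M y \<rho> \<le> 32 * C ^ 4 * (m * \<rho> ^ CARD('d))" "m * \<rho> ^ CARD('d) \<le> 4 ^ (CARD('d) + 1) * M y \<rho>"
proof -
  let ?H = "hausdorff_measure TYPE('d) :: (real^'d) measure"
  note iso = flat_isometric[OF fl]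
  have C0: "C > 0" using C_ge_1 by simp
  have Mp: "M y \<rho> > 0" using M_pos[OF y \<rho>] .
  obtain q where q: "plane_approx \<mu> y \<rho> q \<phi> m \<delta>"
    using fl unfolding flat_def by blast
  let ?f = "bump y (\<rho> / 8)"
  have "M y \<rho> \<le> C ^ 4 * M y (\<rho> / 16)" using M_double_pow[OF y, of "\<rho> / 16" 4] \<rho> by simp
  then have "\<rho> / 16 * (M y \<rho> / C ^ 4) \<le> \<rho> / 16 * M y (\<rho> / 16)"
    using C0 \<rho> by (intro mult_left_mono) (auto simp: divide_simps mult.commute)
  also have "\<dots> \<le> (\<integral>x. ?f x \<partial>\<mu>)" using integral_bump_ge[of "\<rho> / 8" y] \<rho> by simp
  finally have 1: "\<rho> / 16 * (M y \<rho> / C ^ 4) \<le> (\<integral>x. ?f x \<partial>\<mu>)" .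
  have 2: "\<bar>(\<integral>x. ?f x \<partial>\<mu>) - m * (\<integral>u. ?f (q + \<phi> u) \<partial>?H)\<bar> \<le> 1 * \<delta> * \<rho> * M y \<rho>"
    using \<rho> by (intro plane_approxD[OF q] lipschitz_bump bump_outside) auto
  have "\<delta> * (\<rho> * M y \<rho>) < 1 / (32 * C ^ 4) * (\<rho> * M y \<rho>)"
    using \<delta> \<rho> Mp by (intro mult_strict_right_mono) auto
  then have \<delta>': "1 * \<delta> * \<rho> * M y \<rho> < \<rho> / 32 * (M y \<rho> / C ^ 4)" by (simp add: mult.assoc)
  have 3: "\<rho> / 32 * (M y \<rho> / C ^ 4) < m * (\<integral>u. ?f (q + \<phi> u) \<partial>?H)"
    using 1 2 \<delta>' by linarith
  have pos: "\<rho> / 32 * (M y \<rho> / C ^ 4) > 0" using \<rho> Mp C0 by simp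
  have I0: "(\<integral>u. ?f (q + \<phi> u) \<partial>?H) \<ge> 0" by (rule Bochner_Integration.integral_nonneg) simp
  have "0 < m * (\<integral>u. ?f (q + \<phi> u) \<partial>?H)" using pos 3 by (rule less_trans)
  then have m: "m > 0" and I: "(\<integral>u. ?f (q + \<phi> u) \<partial>?H) \<noteq> 0"
    using I0 by (auto simp: zero_less_mult_iff)
  obtain w where w: "?f (q + \<phi> w) \<noteq> 0"
  proof (rule ccontr)
    assume "\<not> thesis"
    then have "\<And>w. ?f (q + \<phi> w) = 0" using that by blast
    then show False using I by simp
  qed
  define p where "p = q + \<phi> w"
  have py: "dist p y < \<rho> / 8" using w bump_outside[of p y "\<rho>/8"] by (force simp: p_def dist_commute)
  have rec: "(\<integral>u. \<psi> (p + \<phi> u) \<partial>?H) = (\<integral>u. \<psi> (q + \<phi> u) \<partial>?H)" if "L-lipschitz_on UNIV \<psi>" for \<psi> :: "'a \<Rightarrow> real" and L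
    unfolding p_def by (rule isometric_plane_integral_recenter[OF iso lipschitz_on_continuous_on[OF that]])
  have p: "plane_approx \<mu> y \<rho> p \<phi> m \<delta>" using q rec unfolding plane_approx_def by metis
  have nrm: "norm u \<le> dist (p + \<phi> u) z + dist p z" for u z
    using isometric_norm[OF iso, of u] dist_triangle[of "p + \<phi> u" p z] by (simp add: dist_norm norm_minus_commute)
  have "(\<integral>u. ?f (p + \<phi> u) \<partial>?H) \<le> \<rho> / 8 * measure ?H (ball 0 (\<rho> / 4))"
  proof (rule integral_le_on_set)
    show "integrable ?H (\<lambda>u. ?f (p + \<phi> u))" by (rule isometric_plane_integrable[OF iso lipschitz_bump bump_outside])
    show "?f (p + \<phi> u) \<le> 0" if "u \<notin> ball 0 (\<rho> / 4)" for u
    proof -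
      have "p + \<phi> u \<notin> ball y (\<rho> / 8)" using that py nrm[of u y] by (auto simp: dist_commute)
      then show ?thesis using bump_outside[of "p + \<phi> u" y "\<rho>/8"] by simp
    qed
  qed (use bump_le[of "\<rho> / 8"] \<rho> emeasure_hausdorff_measure_ball_finite in auto)
  also have "\<dots> = \<rho> / 8 * (\<rho> / 4) ^ CARD('d)" using \<rho> by (simp add: measure_hausdorff_measure_ball)
  also have "\<dots> \<le> \<rho> * \<rho> ^ CARD('d)" using \<rho> by (intro mult_mono power_mono) auto
  finally have "m * (\<integral>u. ?f (q + \<phi> u) \<partial>?H) \<le> m * (\<rho> * \<rho> ^ CARD('d))"
    using m rec[OF lipschitz_bump, of y "\<rho>/8"] by (intro mult_left_mono) auto
  with 3 have "\<rho> / 32 * (M y \<rho> / C ^ 4) \<le> \<rho> * (m * \<rho> ^ CARD('d))" by (simp add: ac_simps)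
  then have lower: "M y \<rho> \<le> 32 * C ^ 4 * (m * \<rho> ^ CARD('d))" using \<rho> C0 by (simp add: field_simps)
  let ?g = "bump p (\<rho> / 2)"
  have sub: "ball p (\<rho> / 2) \<subseteq> ball y \<rho>"
  proof
    fix x assume "x \<in> ball p (\<rho> / 2)"
    then show "x \<in> ball y \<rho>" using py \<rho> dist_triangle[of y x p] by (simp add: dist_commute)
  qed
  have "\<rho> / 4 * measure ?H (ball 0 (\<rho> / 4)) \<le> (\<integral>u. ?g (p + \<phi> u) \<partial>?H)"
  proof (rule integral_ge_on_set)
    show "integrable ?H (\<lambda>u. ?g (p + \<phi> u))" by (rule isometric_plane_integrable[OF iso lipschitz_bump bump_outside])
    show "\<rho> / 4 \<le> ?g (p + \<phi> u)" if "u \<in> ball 0 (\<rho> / 4)" for u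
      using bump_ge[of "p + \<phi> u" p "\<rho> / 4" "\<rho> / 2"] that isometric_norm[OF iso, of u] by (simp add: dist_norm)
  qed (use emeasure_hausdorff_measure_ball_finite in auto)
  then have "(\<rho> / 4) ^ (CARD('d) + 1) \<le> (\<integral>u. ?g (p + \<phi> u) \<partial>?H)"
    using \<rho> by (simp add: measure_hausdorff_measure_ball)
  then have "m * (\<rho> / 4) ^ (CARD('d) + 1) \<le> m * (\<integral>u. ?g (p + \<phi> u) \<partial>?H)"
    using m by (intro mult_left_mono) auto
  also have "\<dots> \<le> (\<integral>x. ?g x \<partial>\<mu>) + 1 * \<delta> * \<rho> * M y \<rho>"
  proof -
    have "\<bar>(\<integral>x. ?g x \<partial>\<mu>) - m * (\<integral>u. ?g (p + \<phi> u) \<partial>?H)\<bar> \<le> 1 * \<delta> * \<rho> * M y \<rho>"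
    proof (rule plane_approxD[OF p _ lipschitz_bump])
      show "?g x = 0" if "x \<notin> ball y \<rho>" for x using that sub by (intro bump_outside) auto
    qed simp
    then show ?thesis by linarith
  qed
  also have "(\<integral>x. ?g x \<partial>\<mu>) \<le> \<rho> / 2 * M p (\<rho> / 2)" using integral_bump_le[of "\<rho> / 2" p] \<rho> by simp
  also have "\<rho> / 2 * M p (\<rho> / 2) \<le> \<rho> / 2 * M y \<rho>" using M_mono[OF sub] \<rho> by simp
  also have "1 * \<delta> * \<rho> * M y \<rho> \<le> 1 / 2 * \<rho> * M y \<rho>"
  proof -
    have "1 / (32 * C ^ 4) \<le> 1 / (32::real)" using one_le_power[OF C_ge_1, of 4] by (intro divide_left_mono) auto
    then show ?thesis using \<delta> \<rho> by (intro mult_right_mono) auto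
  qed
  finally have "m * (\<rho> / 4) ^ (CARD('d) + 1) \<le> \<rho> * M y \<rho>" by simp
  then have "m * (\<rho> ^ CARD('d) * \<rho>) \<le> 4 ^ (CARD('d) + 1) * (\<rho> * M y \<rho>)"
    by (simp add: power_divide divide_simps mult.commute)
  then have upper: "m * \<rho> ^ CARD('d) \<le> 4 ^ (CARD('d) + 1) * M y \<rho>" using \<rho> by (simp add: field_simps)
  show ?thesis by (rule that[OF py m p lower upper])
qed

end

context doubling_radon begin

definition flat_const :: "nat \<Rightarrow> real" where
  "flat_const d = 192 * 4 ^ d * C ^ 4"

definition mass_const :: "nat \<Rightarrow> real" where
  "mass_const d = 4 ^ (d + 1) * (1 + flat_const d) * (32 * C ^ 4)"

lemma flat_const_ge: "192 \<le> flat_const d"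
proof -
  have "192 * 1 * 1 \<le> 192 * 4 ^ d * C ^ 4"
    using C_ge_1 by (intro mult_mono one_le_power) auto
  then show ?thesis by (simp add: flat_const_def)
qed

lemma flat_const_small: "\<delta> \<le> 1 / (8 * flat_const d) \<Longrightarrow> \<delta> < 1 / (32 * C ^ 4)"
proof -
  assume \<delta>: "\<delta> \<le> 1 / (8 * flat_const d)"
  have C4: "1 \<le> C ^ 4" using C_ge_1 by (rule one_le_power)
  have "192 * 1 * C ^ 4 \<le> 192 * 4 ^ d * C ^ 4"
    using C4 by (intro mult_right_mono mult_left_mono one_le_power) auto
  then have "32 * C ^ 4 < 8 * flat_const d" using C4 unfolding flat_const_def by linarith
  then have "1 / (8 * flat_const d) < 1 / (32 * C ^ 4)"
    using C4 flat_const_ge[of d] by (intro divide_strict_left_mono mult_pos_pos) linarith+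
  with \<delta> show ?thesis by linarith
qed

lemma mass_const_ge_1: "1 \<le> mass_const d"
proof -
  have "1 * 1 * 1 \<le> 4 ^ (d + 1) * (1 + flat_const d) * (32 * C ^ 4)"
    using one_le_power[OF C_ge_1, of 4] flat_const_ge[of d] by (intro mult_mono one_le_power) auto
  then show ?thesis by (simp add: mass_const_def)
qed

lemma flat_nonneg:
  assumes "y \<in> S" "\<rho> > 0" "flat \<mu> y \<rho> \<phi> m \<delta>"
  shows "0 \<le> \<delta>"
proof -
  obtain p where "plane_approx \<mu> y \<rho> p \<phi> m \<delta>"
    using assms(3) unfolding flat_def by blast
  from plane_approxD[OF this, of 1 "\<lambda>_. 0"] have "0 \<le> \<delta> * (\<rho> * M y \<rho>)" by (simp add: lipschitz_on_def mult.assoc)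
  moreover have "\<rho> * M y \<rho> > 0" using assms(2) M_pos[OF assms(1,2)] by simp
  ultimately show ?thesis by (metis mult.commute zero_le_mult_iff not_less)
qed

lemma bump_integral_diff:
  assumes "ball p s \<subseteq> ball y \<rho>" "ball q s \<subseteq> ball y \<rho>"
  shows "\<bar>(\<integral>x. bump p s x \<partial>\<mu>) - (\<integral>x. bump q s x \<partial>\<mu>)\<bar> \<le> dist p q * M y \<rho>"
proof -
  have i: "integrable \<mu> (bump c s)" for c by (rule lipschitz_integrable_mu[OF lipschitz_bump bump_outside])
  have "(\<integral>x. bump a s x \<partial>\<mu>) - (\<integral>x. bump b s x \<partial>\<mu>) \<le> dist p q * M y \<rho>"
    if "ball a s \<subseteq> ball y \<rho>" "dist a b = dist p q" for a b
  proof -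
    have "(\<integral>x. bump a s x \<partial>\<mu>) - (\<integral>x. bump b s x \<partial>\<mu>) = (\<integral>x. bump a s x - bump b s x \<partial>\<mu>)"
      using i by simp
    also have "\<dots> \<le> dist p q * M y \<rho>"
    proof (rule integral_le_on_set)
      show "bump a s x - bump b s x \<le> dist p q" for x
        using bump_le_dist[of a s x b] that(2) by simp
      show "bump a s x - bump b s x \<le> 0" if "x \<notin> ball y \<rho>" for x
      proof -
        have "x \<notin> ball a s" using \<open>ball a s \<subseteq> ball y \<rho>\<close> that by blast
        then show ?thesis using bump_outside[of x a s] by simp
      qed
    qed (use i finite_ball in auto)
    finally show ?thesis .
  qed
  from this[OF assms(1), of q] this[OF assms(2), of p] show ?thesis by (simp add: dist_commute abs_le_iff)
qed

lemma flat_plane_dist: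
  fixes \<phi> \<phi>' :: "real^'d::finite \<Rightarrow> 'a"
  assumes \<rho>: "\<rho> > 0" and iso: "isometric \<phi>" and iso': "isometric \<phi>'"
    and py: "dist p y < \<rho> / 8" and py': "dist p' y < \<rho> / 8" and m': "m' > 0"
    and p: "plane_approx \<mu> y \<rho> p \<phi> m \<delta>"
    and p': "plane_approx \<mu> y \<rho> p' \<phi>' m' \<delta>'"
    and mass': "M y \<rho> \<le> 32 * C ^ 4 * (m' * \<rho> ^ CARD('d))"
    and \<delta>: "0 \<le> \<delta> + \<delta>'" and w: "norm w \<le> \<rho> / 4"
  shows "norm (perp \<phi> (p' + \<phi>' w - p)) \<le> flat_const CARD('d) * (\<delta> + \<delta>') * \<rho>"
proof -
  let ?H = "hausdorff_measure TYPE('d) :: (real^'d) measure"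
  define g where "g x = norm (perp \<phi> (x - p))" for x
  txt \<open>The distance \<open>g\<close> to the first plane, cut off by a minimum rather than a product so that it stays
    Lipschitz. It vanishes on the first plane, and since \<open>g\<close> is convex its value at a point of the second
    plane is at most its mean over a ball there, which is symmetric under reflection.\<close>
  define \<psi> where "\<psi> x = min (g x) (6 * bump y \<rho> x)" for x
  note lin = linear_perp[OF iso] and lin' = isometric_linear[OF iso']
  have g_lip: "g x - g x' \<le> dist x x'" for x x'
  proof -
    have "g x - g x' \<le> norm (perp \<phi> (x - p) - perp \<phi> (x' - p))" unfolding g_def by (rule norm_triangle_ineq2)
    also have "\<dots> \<le> dist x x'"
      using norm_perp[OF iso, of "x - x'"] by (simp add: linear_diff[OF lin, symmetric] dist_norm)
    finally show ?thesis .
  qed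
  have \<psi>_lip: "6-lipschitz_on UNIV \<psi>"
  proof (rule lipschitz_onI)
    fix x x' :: 'a
    have "\<bar>bump y \<rho> x - bump y \<rho> x'\<bar> \<le> dist x x'"
      using lipschitz_onD[OF lipschitz_bump, of x x' y \<rho>] by (simp add: dist_real_def)
    then show "dist (\<psi> x) (\<psi> x') \<le> 6 * dist x x'"
      using g_lip[of x x'] g_lip[of x' x] zero_le_dist[of x x'] unfolding \<psi>_def dist_real_def
      by (auto simp: min_def dist_commute abs_le_iff)
  qed simp
  have \<psi>_out: "\<psi> x = 0" if "x \<notin> ball y \<rho>" for x
    using bump_outside[OF that] by (simp add: \<psi>_def g_def)
  have \<psi>_nn: "0 \<le> \<psi> x" for x by (simp add: \<psi>_def g_def)
  have "\<psi> (p + \<phi> u) = 0" for u by (simp add: \<psi>_def g_def perp_isometric[OF iso])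
  then have "\<bar>\<integral>x. \<psi> x \<partial>\<mu>\<bar> \<le> 6 * \<delta> * \<rho> * M y \<rho>" using plane_approxD[OF p _ \<psi>_lip \<psi>_out] by simp
  moreover have "\<bar>(\<integral>x. \<psi> x \<partial>\<mu>) - m' * (\<integral>u. \<psi> (p' + \<phi>' u) \<partial>?H)\<bar> \<le> 6 * \<delta>' * \<rho> * M y \<rho>"
    using plane_approxD[OF p' _ \<psi>_lip \<psi>_out] by simp
  ultimately have "m' * (\<integral>u. \<psi> (p' + \<phi>' u) \<partial>?H) \<le> 6 * \<delta> * \<rho> * M y \<rho> + 6 * \<delta>' * \<rho> * M y \<rho>"
    by linarith
  also have "\<dots> = 6 * (\<delta> + \<delta>') * \<rho> * M y \<rho>" by (simp add: algebra_simps)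
  finally have 1: "m' * (\<integral>u. \<psi> (p' + \<phi>' u) \<partial>?H) \<le> 6 * (\<delta> + \<delta>') * \<rho> * M y \<rho>" .
  define F where "F u = \<psi> (p' + \<phi>' u)" for u
  define q where "q = p' + \<phi>' w"
  have intF: "integrable ?H F" unfolding F_def by (rule isometric_plane_integrable[OF iso' \<psi>_lip \<psi>_out])
  have mF: "F \<in> borel_measurable borel"
    unfolding F_def using lipschitz_on_continuous_on[OF lipschitz_on_isometric[OF iso' \<psi>_lip]]
    by (rule borel_measurable_continuous_onI)
  have reflF: "(\<integral>u. F (2 *\<^sub>R w - u) \<partial>?H) = (\<integral>u. F u \<partial>?H)"
    by (rule hausdorff_measure_integral_reflect[OF mF])
  have intFr: "integrable ?H (\<lambda>u. F (2 *\<^sub>R w - u))"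
  proof -
    have d: "distr ?H borel (\<lambda>u. 2 *\<^sub>R w - u) = ?H"
    proof (rule distr_hausdorff_measure_surj_isometry)
      show "surj (\<lambda>u. 2 *\<^sub>R w - u)" by (rule surjI[of _ "\<lambda>u. 2 *\<^sub>R w - u"]) simp
    qed (auto simp: dist_norm norm_minus_commute)
    have "integrable (distr ?H borel (\<lambda>u. 2 *\<^sub>R w - u)) F" using intF d by simp
    then show ?thesis using mF by (subst (asm) integrable_distr_eq) auto
  qed
  have Fg: "F u = g (p' + \<phi>' u)" if "u \<in> ball w (\<rho> / 4)" for u
  proof -
    have "norm u \<le> \<rho> / 2" using that w norm_triangle_ineq2[of u w] by (simp add: dist_norm norm_minus_commute)
    then have "dist (p' + \<phi>' u) p' \<le> \<rho> / 2" using isometric_norm[OF iso', of u] by (simp add: dist_norm)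
    then have dy: "dist (p' + \<phi>' u) y \<le> 5 / 8 * \<rho>" using py' dist_triangle[of "p' + \<phi>' u" y p'] by linarith
    have "g (p' + \<phi>' u) \<le> dist (p' + \<phi>' u) p"
      using norm_perp[OF iso] by (simp add: g_def dist_norm)
    also have "\<dots> \<le> 3 / 4 * \<rho>" using dy py dist_triangle2[of "p' + \<phi>' u" p y] by linarith
    also have "\<dots> \<le> 6 * bump y \<rho> (p' + \<phi>' u)" using dy \<rho> by (simp add: bump_def dist_commute)
    finally show ?thesis by (simp add: F_def \<psi>_def)
  qed
  have "2 * g q * measure ?H (ball w (\<rho> / 4)) \<le> (\<integral>u. F u + F (2 *\<^sub>R w - u) \<partial>?H)"
  proof (rule integral_ge_on_set)
    fix u assume u: "u \<in> ball w (\<rho> / 4)"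
    then have u': "2 *\<^sub>R w - u \<in> ball w (\<rho> / 4)"
      by (simp add: dist_norm scaleR_2 norm_minus_commute)
    have "p' + \<phi>' u - p + (p' + \<phi>' (2 *\<^sub>R w - u) - p) = 2 *\<^sub>R (q - p)"
      by (simp only: q_def linear_diff[OF lin'] linear_scale[OF lin']) (simp add: scaleR_2)
    then have "perp \<phi> (p' + \<phi>' u - p) + perp \<phi> (p' + \<phi>' (2 *\<^sub>R w - u) - p) = 2 *\<^sub>R perp \<phi> (q - p)"
      by (simp only: linear_add[OF lin, symmetric] linear_scale[OF lin, symmetric])
    then have "2 * g q \<le> g (p' + \<phi>' u) + g (p' + \<phi>' (2 *\<^sub>R w - u))"
      unfolding g_def using norm_triangle_ineq[of "perp \<phi> (p' + \<phi>' u - p)" "perp \<phi> (p' + \<phi>' (2 *\<^sub>R w - u) - p)"]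
      by simp
    then show "2 * g q \<le> F u + F (2 *\<^sub>R w - u)" using Fg[OF u] Fg[OF u'] by simp
  next
    show "0 \<le> F u + F (2 *\<^sub>R w - u)" for u using \<psi>_nn by (simp add: F_def)
    show "integrable ?H (\<lambda>u. F u + F (2 *\<^sub>R w - u))" using intF intFr by simp
  qed (use emeasure_hausdorff_measure_ball_finite in auto)
  also have "\<dots> = 2 * (\<integral>u. F u \<partial>?H)" using intF intFr reflF by simp
  finally have "g q * (\<rho> / 4) ^ CARD('d) \<le> (\<integral>u. F u \<partial>?H)"
    using \<rho> by (simp add: measure_hausdorff_measure_ball)
  then have "m' * (g q * (\<rho> / 4) ^ CARD('d)) \<le> m' * (\<integral>u. F u \<partial>?H)" using m' by (intro mult_left_mono) auto
  also have "\<dots> \<le> 6 * (\<delta> + \<delta>') * \<rho> * M y \<rho>" using 1 by (simp add: F_def)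
  also have "\<dots> \<le> 6 * (\<delta> + \<delta>') * \<rho> * (32 * C ^ 4 * (m' * \<rho> ^ CARD('d)))"
    using mass' \<delta> \<rho> by (intro mult_left_mono) auto
  finally have "(m' * \<rho> ^ CARD('d)) * g q \<le> (m' * \<rho> ^ CARD('d)) * (flat_const CARD('d) * (\<delta> + \<delta>') * \<rho>)"
    by (simp add: flat_const_def power_divide divide_simps algebra_simps)
  then have "g q \<le> flat_const CARD('d) * (\<delta> + \<delta>') * \<rho>"
    using m' \<rho> by (subst (asm) mult_le_cancel_left_pos) auto
  then show ?thesis by (simp add: g_def q_def)
qed

lemma flat_compare:
  fixes \<phi> \<phi>' :: "real^'d::finite \<Rightarrow> 'a"
  assumes y: "y \<in> S" and \<rho>: "\<rho> > 0" and fl: "flat \<mu> y \<rho> \<phi> m \<delta>" and fl': "flat \<mu> y \<rho> \<phi>' m' \<delta>'"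
    and \<delta>: "\<delta> \<le> 1 / (8 * flat_const CARD('d))" and \<delta>': "\<delta>' \<le> 1 / (8 * flat_const CARD('d))"
  shows "norm (perp \<phi> (\<phi>' u)) \<le> 8 * flat_const CARD('d) * (\<delta> + \<delta>') * norm u"
    and "\<bar>m - m'\<bar> \<le> mass_const CARD('d) * (\<delta> + \<delta>') * m"
proof -
  let ?D = "flat_const CARD('d)" and ?H = "hausdorff_measure TYPE('d) :: (real^'d) measure"
  note iso = flat_isometric[OF fl] and iso' = flat_isometric[OF fl']
  obtain p where p: "dist p y < \<rho> / 8" "m > 0"
     "plane_approx \<mu> y \<rho> p \<phi> m \<delta>"
     "M y \<rho> \<le> 32 * C ^ 4 * (m * \<rho> ^ CARD('d))"
    using flat_center[OF y \<rho> fl flat_const_small[OF \<delta>]] by metis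
  obtain p' where p': "dist p' y < \<rho> / 8" "m' > 0"
     "plane_approx \<mu> y \<rho> p' \<phi>' m' \<delta>'"
     "M y \<rho> \<le> 32 * C ^ 4 * (m' * \<rho> ^ CARD('d))"
    using flat_center[OF y \<rho> fl' flat_const_small[OF \<delta>']] by metis
  have nn: "0 \<le> \<delta>" "0 \<le> \<delta>'" using flat_nonneg[OF y \<rho>] fl fl' by auto
  have D: "?D \<ge> 192" by (rule flat_const_ge)
  have K: "?D * (\<delta> + \<delta>') \<le> 1 / 4"
  proof -
    have "?D * (\<delta> + \<delta>') \<le> ?D * (2 * (1 / (8 * ?D)))" using \<delta> \<delta>' D by (intro mult_left_mono) linarith+
    then show ?thesis using D by simp
  qed
  have g: "norm (perp \<phi> (p' + \<phi>' w - p)) \<le> ?D * (\<delta> + \<delta>') * \<rho>" if "norm w \<le> \<rho> / 4" for w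
  proof (rule flat_plane_dist[OF \<rho> iso iso' p(1) p'(1) p'(2) p(3) p'(3) p'(4) _ that])
    show "0 \<le> \<delta> + \<delta>'" using nn by simp
  qed
  note lin = linear_perp[OF iso] and lin' = isometric_linear[OF iso']
  have g0: "norm (perp \<phi> (p' - p)) \<le> ?D * (\<delta> + \<delta>') * \<rho>"
    using g[of 0] \<rho> by (simp add: linear_0[OF lin'])
  show "norm (perp \<phi> (\<phi>' u)) \<le> 8 * ?D * (\<delta> + \<delta>') * norm u"
  proof (cases "u = 0")
    case True
    then show ?thesis by (simp add: linear_0[OF lin'] linear_0[OF lin])
  next
    case False
    define s where "s = \<rho> / (4 * norm u)"
    have s: "s > 0" using \<rho> False by (simp add: s_def)
    have "norm (s *\<^sub>R u) \<le> \<rho> / 4" using \<rho> False by (simp add: s_def)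
    note g1 = g[OF this]
    have "s *\<^sub>R perp \<phi> (\<phi>' u) = perp \<phi> (p' + \<phi>' (s *\<^sub>R u) - p) - perp \<phi> (p' - p)"
      by (simp add: linear_diff[OF lin, symmetric] linear_scale[OF lin, symmetric] linear_scale[OF lin'])
    then have "s * norm (perp \<phi> (\<phi>' u)) = norm (perp \<phi> (p' + \<phi>' (s *\<^sub>R u) - p) - perp \<phi> (p' - p))"
      using s by (metis abs_of_pos norm_scaleR)
    also have "\<dots> \<le> 2 * (?D * (\<delta> + \<delta>') * \<rho>)"
      using norm_triangle_ineq4[of "perp \<phi> (p' + \<phi>' (s *\<^sub>R u) - p)" "perp \<phi> (p' - p)"] g1 g0 by linarith
    finally have "\<rho> * norm (perp \<phi> (\<phi>' u)) \<le> \<rho> * (8 * ?D * (\<delta> + \<delta>') * norm u)"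
      using False by (simp add: s_def field_simps)
    then show ?thesis using \<rho> by (subst (asm) mult_le_cancel_left_pos) auto
  qed
  define q where "q = p + \<phi> (adjoint \<phi> (p' - p))"
  have "p' - q = perp \<phi> (p' - p)" by (simp add: q_def perp_def)
  then have pq: "dist p' q \<le> ?D * (\<delta> + \<delta>') * \<rho>" using g0 by (simp add: dist_norm)
  also have "\<dots> \<le> 1 / 4 * \<rho>" using K \<rho> by (intro mult_right_mono) auto
  finally have pq': "dist p' q \<le> \<rho> / 4" by simp
  have sub': "ball p' (\<rho> / 2) \<subseteq> ball y \<rho>"
  proof
    fix x assume "x \<in> ball p' (\<rho> / 2)"
    then show "x \<in> ball y \<rho>" using p'(1) \<rho> dist_triangle[of y x p'] by (simp add: dist_commute)
  qed
  have sub: "ball q (\<rho> / 2) \<subseteq> ball y \<rho>"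
  proof
    fix x assume x: "x \<in> ball q (\<rho> / 2)"
    have "dist y x \<le> dist p' y + dist p' q + dist q x"
      using dist_triangle[of y x q] dist_triangle3[of y q p'] by linarith
    then show "x \<in> ball y \<rho>" using p'(1) \<rho> pq' x by simp
  qed
  define J where "J = (\<integral>u. max 0 (\<rho> / 2 - norm u) \<partial>?H)"
  have J': "(\<integral>u. bump p' (\<rho> / 2) (p' + \<phi>' u) \<partial>?H) = J"
    by (simp add: J_def bump_def dist_norm isometric_norm[OF iso'])
  have "(\<integral>u. bump q (\<rho> / 2) (p + \<phi> u) \<partial>?H) = (\<integral>u. bump q (\<rho> / 2) (q + \<phi> u) \<partial>?H)"
    unfolding q_def by (rule isometric_plane_integral_recenter[OF iso lipschitz_on_continuous_on[OF lipschitz_bump], symmetric])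
  also have "\<dots> = J" by (simp add: J_def bump_def dist_norm isometric_norm[OF iso])
  finally have J: "(\<integral>u. bump q (\<rho> / 2) (p + \<phi> u) \<partial>?H) = J" .
  have "\<bar>(\<integral>x. bump q (\<rho> / 2) x \<partial>\<mu>) - m * J\<bar> \<le> 1 * \<delta> * \<rho> * M y \<rho>"
    unfolding J[symmetric] using sub by (intro plane_approxD[OF p(3)] lipschitz_bump bump_outside) auto
  moreover have "\<bar>(\<integral>x. bump p' (\<rho> / 2) x \<partial>\<mu>) - m' * J\<bar> \<le> 1 * \<delta>' * \<rho> * M y \<rho>"
    unfolding J'[symmetric] using sub' by (intro plane_approxD[OF p'(3)] lipschitz_bump bump_outside) auto
  moreover have "\<bar>(\<integral>x. bump p' (\<rho> / 2) x \<partial>\<mu>) - (\<integral>x. bump q (\<rho> / 2) x \<partial>\<mu>)\<bar> \<le> ?D * (\<delta> + \<delta>') * \<rho> * M y \<rho>"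
    using bump_integral_diff[OF sub' sub] mult_right_mono[OF pq, of "M y \<rho>"] by (simp add: mult.assoc)
  ultimately have "\<bar>m * J - m' * J\<bar> \<le> 1 * \<delta> * \<rho> * M y \<rho> + 1 * \<delta>' * \<rho> * M y \<rho> + ?D * (\<delta> + \<delta>') * \<rho> * M y \<rho>"
    by linarith
  also have "\<dots> = (1 + ?D) * (\<delta> + \<delta>') * \<rho> * M y \<rho>" by (simp add: algebra_simps)
  also have "\<dots> \<le> (1 + ?D) * (\<delta> + \<delta>') * \<rho> * (32 * C ^ 4 * (m * \<rho> ^ CARD('d)))"
    using p(4) D \<rho> nn by (intro mult_left_mono) auto
  finally have 1: "\<bar>m - m'\<bar> * J \<le> (1 + ?D) * (\<delta> + \<delta>') * \<rho> * (32 * C ^ 4 * (m * \<rho> ^ CARD('d)))"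
    using Bochner_Integration.integral_nonneg[of ?H "\<lambda>u. max 0 (\<rho> / 2 - norm u)"]
    by (simp add: left_diff_distrib[symmetric] abs_mult J_def)
  have "\<rho> / 4 * measure ?H (ball 0 (\<rho> / 4)) \<le> J"
    unfolding J_def
  proof (rule integral_ge_on_set)
    show "integrable ?H (\<lambda>u. max 0 (\<rho> / 2 - norm u))"
    proof -
      have "integrable ?H (\<lambda>u. bump p' (\<rho> / 2) (p' + \<phi>' u))"
        by (rule isometric_plane_integrable[OF iso' lipschitz_bump bump_outside])
      then show ?thesis by (simp add: bump_def dist_norm isometric_norm[OF iso'])
    qed
    show "\<rho> / 4 \<le> max 0 (\<rho> / 2 - norm u)" if "u \<in> ball 0 (\<rho> / 4)" for u :: "real^'d"
    proof -
      have "norm u < \<rho> / 4" using that by simp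
      then show ?thesis by linarith
    qed
  qed (use emeasure_hausdorff_measure_ball_finite in auto)
  then have "(\<rho> / 4) ^ (CARD('d) + 1) \<le> J" using \<rho> by (simp add: measure_hausdorff_measure_ball)
  then have "\<bar>m - m'\<bar> * (\<rho> / 4) ^ (CARD('d) + 1) \<le> \<bar>m - m'\<bar> * J" by (intro mult_left_mono) auto
  with 1 have "\<bar>m - m'\<bar> * (\<rho> / 4) ^ (CARD('d) + 1) \<le> (1 + ?D) * (\<delta> + \<delta>') * \<rho> * (32 * C ^ 4 * (m * \<rho> ^ CARD('d)))"
    by linarith
  then have "\<rho> ^ (CARD('d) + 1) * \<bar>m - m'\<bar>
      \<le> (1 + ?D) * (\<delta> + \<delta>') * \<rho> * (32 * C ^ 4 * (m * \<rho> ^ CARD('d))) * 4 ^ (CARD('d) + 1)"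
    by (simp only: power_divide times_divide_eq_right mult.commute[of "\<bar>m - m'\<bar>"]
        pos_divide_le_eq zero_less_power zero_less_numeral)
  also have "\<dots> = \<rho> ^ (CARD('d) + 1) * (mass_const CARD('d) * (\<delta> + \<delta>') * m)"
    by (simp only: mass_const_def power_add power_one_right mult_ac)
  finally show "\<bar>m - m'\<bar> \<le> mass_const CARD('d) * (\<delta> + \<delta>') * m"
    using \<rho> by (subst (asm) mult_le_cancel_left_pos) auto
qed

lemma flat_near:
  fixes \<phi> :: "real^'d::finite \<Rightarrow> 'a"
  assumes y: "y \<in> S" and \<rho>: "\<rho> > 0" and fl: "flat \<mu> y \<rho> \<phi> m \<delta>" and \<delta>: "\<delta> < 1 / (32 * C ^ 4)"
    and \<theta>: "0 < \<theta>" "\<theta> \<le> 1 / 2" "4 \<le> 2 ^ j * \<theta>" "\<delta> < \<theta> / (2 * C ^ j)"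
    and z: "z \<in> S" "dist z y < \<rho> / 2" and z': "z' \<in> S" "dist z' y < \<rho> / 2"
  shows "norm (perp \<phi> (z - z')) \<le> 2 * \<theta> * \<rho>"
proof -
  note iso = flat_isometric[OF fl]
  note lin = linear_perp[OF iso]
  have Mp: "M y \<rho> > 0" using M_pos[OF y \<rho>] .
  have Cj: "C ^ j > 0" using C_ge_1 by simp
  obtain p where p: "plane_approx \<mu> y \<rho> p \<phi> m \<delta>"
    using flat_center[OF y \<rho> fl \<delta>] by metis
  have *: "norm (perp \<phi> (z - p)) \<le> \<theta> * \<rho>" if z: "z \<in> S" "dist z y < \<rho> / 2" for z
  proof (rule ccontr)
    assume far: "\<not> ?thesis"
    let ?f = "bump z (\<theta> * \<rho>)"
    have "?f (p + \<phi> u) = 0" for u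
    proof (rule bump_outside)
      have "norm (perp \<phi> (z - (p + \<phi> u))) \<le> dist (p + \<phi> u) z"
        using norm_perp[OF iso, of "z - (p + \<phi> u)"] by (simp add: dist_norm norm_minus_commute)
      moreover have "perp \<phi> (z - (p + \<phi> u)) = perp \<phi> (z - p)"
      proof -
        have "z - (p + \<phi> u) = (z - p) - \<phi> u" by simp
        then show ?thesis by (simp only: linear_diff[OF lin] perp_isometric[OF iso] diff_zero)
      qed
      ultimately show "p + \<phi> u \<notin> ball z (\<theta> * \<rho>)" using far by (simp add: dist_commute)
    qed
    moreover have "\<bar>(\<integral>x. ?f x \<partial>\<mu>) - m * (\<integral>u. ?f (p + \<phi> u) \<partial>hausdorff_measure TYPE('d))\<bar> \<le> 1 * \<delta> * \<rho> * M y \<rho>"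
    proof (rule plane_approxD[OF p _ lipschitz_bump bump_outside])
      fix x assume "x \<notin> ball y \<rho>"
      moreover have "\<theta> * \<rho> \<le> 1 / 2 * \<rho>" using \<theta> \<rho> by (intro mult_right_mono) auto
      ultimately show "x \<notin> ball z (\<theta> * \<rho>)" using z dist_triangle[of y x z] by (auto simp: dist_commute)
    qed simp
    ultimately have 1: "(\<integral>x. ?f x \<partial>\<mu>) \<le> \<delta> * \<rho> * M y \<rho>" by simp
    have "M y \<rho> \<le> C ^ j * M z (\<theta> * \<rho> / 2)"
    proof (rule M_compare)
      have "4 * \<rho> \<le> 2 ^ j * \<theta> * \<rho>" using \<theta> \<rho> by (intro mult_right_mono) auto
      then have "4 * \<rho> \<le> 2 ^ j * (\<theta> * \<rho>)" by (simp only: mult.assoc)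
      moreover have "2 ^ j * (\<theta> * \<rho> / 2) = 2 ^ j * (\<theta> * \<rho>) / 2" by simp
      ultimately show "dist y z + \<rho> \<le> 2 ^ j * (\<theta> * \<rho> / 2)"
        using z(2) \<rho> dist_commute[of y z] by linarith
    qed (use z \<theta> \<rho> in auto)
    then have "\<theta> * \<rho> / 2 * (M y \<rho> / C ^ j) \<le> \<theta> * \<rho> / 2 * M z (\<theta> * \<rho> / 2)"
      using \<theta> \<rho> Cj by (intro mult_left_mono) (auto simp: divide_simps mult.commute)
    also have "\<dots> \<le> \<delta> * \<rho> * M y \<rho>"
      using \<theta> \<rho> by (intro order_trans[OF integral_bump_ge 1]) simp
    also have "\<dots> < \<theta> / (2 * C ^ j) * \<rho> * M y \<rho>"
      using \<theta>(4) \<rho> Mp by (intro mult_strict_right_mono) auto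
    finally show False by (simp add: ac_simps)
  qed
  have "z - z' = (z - p) - (z' - p)" by simp
  then have "perp \<phi> (z - z') = perp \<phi> (z - p) - perp \<phi> (z' - p)" by (simp only: linear_diff[OF lin])
  then show ?thesis
    using norm_triangle_ineq4[of "perp \<phi> (z - p)" "perp \<phi> (z' - p)"] *[OF z] *[OF z'] by simp
qed

end

section \<open>Gluing bi-Lipschitz maps\<close>

lemma bi_lipschitz_onI:
  assumes "\<And>x y. x \<in> A \<Longrightarrow> y \<in> A \<Longrightarrow> dist x y \<le> L * dist (f x) (f y)"
    and "\<And>x y. x \<in> A \<Longrightarrow> y \<in> A \<Longrightarrow> dist (f x) (f y) \<le> L * dist x y" and "L > 0"
  shows "bi_lipschitz_on L A f"
  using assms by (auto simp: bi_lipschitz_on_def field_simps)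

lemma bi_lipschitz_onD:
  assumes "bi_lipschitz_on L A f" "L > 0" "x \<in> A" "y \<in> A"
  shows "dist x y \<le> L * dist (f x) (f y)" "dist (f x) (f y) \<le> L * dist x y"
  using assms by (auto simp: bi_lipschitz_on_def field_simps)

lemma bi_lipschitz_on_mono:
  assumes "bi_lipschitz_on l A f" "0 < l" "l \<le> l'"
  shows "bi_lipschitz_on l' A f"
proof (rule bi_lipschitz_onI)
  fix x y assume "x \<in> A" "y \<in> A"
  note * = bi_lipschitz_onD[OF assms(1,2) this]
  show "dist x y \<le> l' * dist (f x) (f y)" "dist (f x) (f y) \<le> l' * dist x y"
    using * assms(3) by (meson mult_right_mono order_trans zero_le_dist)+
qed (use assms in simp)

definition glue_const :: "real \<Rightarrow> real \<Rightarrow> real \<Rightarrow> real" where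
  "glue_const l L \<eta> = 40 * l * L + 42 * l + 2 * l * (1 + 2 / \<eta>)"

lemma bi_lipschitz_glue:
  fixes p :: "'a::metric_space \<Rightarrow> 'a" and h :: "'a \<Rightarrow> 'a \<Rightarrow> 'b::real_normed_vector"
  assumes l: "1 \<le> l" and L: "1 \<le> L" and \<eta>: "0 < \<eta>"
    and pu: "\<And>u. u \<in> A \<Longrightarrow> dist u (p u) \<le> \<sigma> (p u)"
    and hu: "\<And>u. u \<in> A \<Longrightarrow> norm (h (p u) u) \<le> \<sigma> (p u)"
    and h: "\<And>c. c \<in> p ` A \<Longrightarrow> bi_lipschitz_on L {u \<in> A. p u = c} (h c)"
    and sep: "\<And>c c'. c \<in> p ` A \<Longrightarrow> c' \<in> p ` A \<Longrightarrow> c \<noteq> c' \<Longrightarrow> (\<sigma> c + \<sigma> c') / 20 \<le> dist c c'"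
    and gap: "\<And>u v. u \<in> A \<Longrightarrow> v \<in> A \<Longrightarrow> p u \<noteq> p v \<Longrightarrow> \<eta> * max (\<sigma> (p u)) (\<sigma> (p v)) \<le> dist u v"
    and g: "bi_lipschitz_on l (p ` A) g"
  shows "bi_lipschitz_on (glue_const l L \<eta>) A (\<lambda>u. g (p u) + (1 / (40 * l)) *\<^sub>R h (p u) u)" (is "bi_lipschitz_on ?L A ?f")
proof (rule bi_lipschitz_onI)
  have lL: "0 \<le> 40 * l * L" using l L by simp
  have nn: "2 * l * (1 + 2 / \<eta>) \<ge> 0" using l \<eta> by simp
  show "?L > 0" unfolding glue_const_def using l lL nn by linarith
  fix u v assume u: "u \<in> A" and v: "v \<in> A"
  let ?d = "dist u v"
  have "?d \<le> ?L * dist (?f u) (?f v) \<and> dist (?f u) (?f v) \<le> ?L * ?d"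
  proof (cases "p u = p v")
    case True
    have e: "dist (?f u) (?f v) = dist (h (p u) u) (h (p u) v) / (40 * l)"
      using l True by (simp add: dist_norm scaleR_diff_right[symmetric])
    have b: "?d \<le> L * dist (h (p u) u) (h (p u) v)" "dist (h (p u) u) (h (p u) v) \<le> L * ?d"
      using bi_lipschitz_onD[OF h[of "p u"], of u v] u v True L by auto
    have "?d \<le> 40 * l * L * dist (?f u) (?f v)" using b(1) l by (simp add: e)
    also have "\<dots> \<le> ?L * dist (?f u) (?f v)"
      using l nn by (intro mult_right_mono) (auto simp: glue_const_def)
    finally have 1: "?d \<le> ?L * dist (?f u) (?f v)" .
    have "dist (?f u) (?f v) \<le> dist (h (p u) u) (h (p u) v) / 1"
      unfolding e using l by (intro divide_left_mono) auto
    also have "\<dots> \<le> L * ?d" using b(2) by simp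
    also have "\<dots> \<le> ?L * ?d"
    proof (rule mult_right_mono)
      have "1 * L \<le> (40 * l) * L" using l L by (intro mult_right_mono) auto
      then show "L \<le> ?L" using l nn by (simp add: glue_const_def)
    qed simp
    finally show ?thesis using 1 by simp
  next
    case False
    define c c' where "c = p u" and "c' = p v"
    have cc: "c \<in> p ` A" "c' \<in> p ` A" "c \<noteq> c'" using u v False by (auto simp: c_def c'_def)
    let ?D = "dist c c'"
    have \<sigma>: "\<sigma> c \<ge> 0" "\<sigma> c' \<ge> 0"
      using pu[OF u] pu[OF v] zero_le_dist[of u "p u"] zero_le_dist[of v "p v"] by (auto simp: c_def c'_def simp del: zero_le_dist)
    have s: "\<sigma> c + \<sigma> c' \<le> 20 * ?D" using sep[OF cc] by simp
    have gD: "?D \<le> l * dist (g c) (g c')" "dist (g c) (g c') \<le> l * ?D"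
      using bi_lipschitz_onD[OF g] cc l by auto
    have err: "\<bar>dist (?f u) (?f v) - dist (g c) (g c')\<bar> \<le> ?D / (2 * l)"
    proof -
      have n1: "norm (g c - g c' + w) \<le> norm (g c - g c') + norm w"
        and n2: "norm (g c - g c') - norm w \<le> norm (g c - g c' + w)" for w
        using norm_triangle_ineq[of "g c - g c'" w] norm_diff_ineq[of "g c - g c'" w] by auto
      define w where "w = (1 / (40 * l)) *\<^sub>R (h c u - h c' v)"
      have fuv: "?f u - ?f v = g c - g c' + w" by (simp add: c_def c'_def w_def algebra_simps)
      have "norm (h c u - h c' v) \<le> \<sigma> c + \<sigma> c'"
        using hu[OF u] hu[OF v] norm_triangle_ineq4[of "h c u" "h c' v"] by (simp add: c_def c'_def)
      then have "norm (h c u - h c' v) \<le> 20 * ?D" using s by linarith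
      then have "norm w \<le> (1 / (40 * l)) * (20 * ?D)" using l unfolding w_def
        by (simp only: norm_scaleR) (intro mult_mono, auto)
      then have "norm w \<le> ?D / (2 * l)" by simp
      with n1[of w] n2[of w] show ?thesis by (simp add: dist_norm fuv abs_le_iff)
    qed
    have lowD: "?D / (2 * l) \<le> dist (?f u) (?f v)"
    proof -
      have "?D / l \<le> dist (g c) (g c')" using gD(1) l by (simp add: field_simps)
      moreover have "?D / l = ?D / (2 * l) + ?D / (2 * l)" by simp
      ultimately show ?thesis using err by linarith
    qed
    have "?d \<le> ?D + \<sigma> c + \<sigma> c'"
      using pu[OF u] pu[OF v] dist_triangle[of u v c] dist_triangle[of c v c'] by (simp add: c_def c'_def dist_commute)
    then have "?d \<le> 21 * ?D" using s by linarith
    also have "\<dots> \<le> 42 * l * dist (?f u) (?f v)" using lowD l by (simp add: field_simps)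
    also have "\<dots> \<le> ?L * dist (?f u) (?f v)"
      using l L nn by (intro mult_right_mono) (auto simp: glue_const_def)
    finally have 1: "?d \<le> ?L * dist (?f u) (?f v)" .
    have "?D / (2 * l) \<le> ?D / 1" using l by (intro divide_left_mono) auto
    also have "\<dots> \<le> l * ?D" using l mult_right_mono[of 1 l ?D] by simp
    finally have up: "dist (?f u) (?f v) \<le> 2 * l * ?D" using err gD(2) by linarith
    have "\<sigma> c + \<sigma> c' \<le> 2 * max (\<sigma> c) (\<sigma> c')" by simp
    also have "\<dots> \<le> 2 / \<eta> * ?d" using gap[OF u v] False \<eta> by (simp add: c_def c'_def field_simps)
    finally have "\<sigma> c + \<sigma> c' \<le> 2 / \<eta> * ?d" .
    moreover have "?D \<le> ?d + \<sigma> c + \<sigma> c'"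
      using pu[OF u] pu[OF v] dist_triangle[of c c' u] dist_triangle[of u c' v] by (simp add: c_def c'_def dist_commute)
    ultimately have "?D \<le> (1 + 2 / \<eta>) * ?d" by (simp add: algebra_simps)
    then have "2 * l * ?D \<le> 2 * l * ((1 + 2 / \<eta>) * ?d)" using l by (intro mult_left_mono) auto
    then have "dist (?f u) (?f v) \<le> (2 * l * (1 + 2 / \<eta>)) * ?d" using up by (simp add: mult.assoc)
    also have "\<dots> \<le> ?L * ?d" using l L by (intro mult_right_mono) (auto simp: glue_const_def)
    finally show ?thesis using 1 by simp
  qed
  then show "?d \<le> ?L * dist (?f u) (?f v)" "dist (?f u) (?f v) \<le> ?L * ?d" by auto
qed

section \<open>The stopping-time recursion\<close>

text \<open>The budget \<open>a\<close> dominates the flatness \<open>b\<close> at all points nearby; thus a point stopped because of a large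
  sum of \<open>b\<close> forces a large sum of \<open>a\<close> on a whole ball around it.\<close>

locale flat_scales = doubling_radon \<mu> C for \<mu> :: "'a::euclidean_space measure" and C +
  fixes d :: nat and r K :: real and a b :: "nat \<Rightarrow> 'a \<Rightarrow> real"
  assumes d_eq: "d = CARD('d::finite)" and r_pos: "0 < r" and K_ge_1: "1 \<le> K"
    and a_pos: "\<And>k y. y \<in> S \<Longrightarrow> 0 < a k y" and b_nonneg: "\<And>k y. y \<in> S \<Longrightarrow> 0 \<le> b k y"
    and b_le_a: "\<And>k y z. y \<in> S \<Longrightarrow> z \<in> S \<Longrightarrow> dist y z \<le> r / 2 ^ k \<Longrightarrow> b k y \<le> a k z"
    and b_flat: "\<And>k y. y \<in> S \<Longrightarrow> b k y < 1 \<Longrightarrow>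
        \<exists>(\<phi> :: real^'d \<Rightarrow> 'a) m. flat \<mu> y (8 * (r / 2 ^ k)) \<phi> m (K * b k y)"
begin

definition s :: "nat \<Rightarrow> real" where "s k = r / 2 ^ k"

lemmas b_flat_s = b_flat[folded s_def] and b_le_a_s = b_le_a[folded s_def]

abbreviation D :: real where "D \<equiv> flat_const d"

definition \<epsilon> :: real where "\<epsilon> = 1 / (10240 * D * C ^ 14 * K)"

lemmas flat_cmp = flat_compare[where 'd='d, folded d_eq]

lemma s_pos: "0 < s k" using r_pos by (simp add: s_def)

lemma s_Suc: "s (Suc k) = s k / 2" by (simp add: s_def)

lemma s_antimono: "k \<le> j \<Longrightarrow> s j \<le> s k"
  unfolding s_def using r_pos by (intro divide_left_mono power_increasing) auto

lemma C14: "1 \<le> C ^ 14" "C ^ 2 \<le> C ^ 14" "C \<le> C ^ 2"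
  using C_ge_1 one_le_power[of C 14] power_increasing[of 2 14 C] power_increasing[of 1 2 C] by auto

lemma \<epsilon>_bounds: "0 < \<epsilon>" "\<epsilon> < 1" "2 * C ^ 2 * (K * \<epsilon>) \<le> 1 / (8 * D)" "K * \<epsilon> \<le> 1 / (8 * D)"
  "2 * C * (K * \<epsilon>) \<le> 1 / (8 * D)"
  "K * \<epsilon> < 1 / (5120 * C ^ 14)" "64 * D * C ^ 2 * (K * \<epsilon>) \<le> 1 / 4"
proof -
  have D: "D \<ge> 192" by (rule flat_const_ge)
  have pos: "10240 * D * C ^ 14 > 0" using D C14(1) by (intro mult_pos_pos) auto
  show "0 < \<epsilon>" using pos K_ge_1 by (simp add: \<epsilon>_def)
  have Ke: "K * \<epsilon> = 1 / (10240 * D * C ^ 14)" using K_ge_1 by (simp add: \<epsilon>_def)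
  have "10240 * 192 * 1 \<le> 10240 * D * C ^ 14" using D C14(1) by (intro mult_mono) auto
  then have "K * \<epsilon> < 1" unfolding Ke using pos by (simp add: divide_less_eq)
  moreover have "1 * \<epsilon> \<le> K * \<epsilon>" using K_ge_1 \<open>0 < \<epsilon>\<close> by (intro mult_right_mono) auto
  ultimately show "\<epsilon> < 1" by linarith
  have Cr: "C ^ 2 * (K * \<epsilon>) \<le> 1 / (10240 * D)"
  proof -
    have "C ^ 2 * (K * \<epsilon>) \<le> C ^ 14 * (K * \<epsilon>)" using C14 \<open>0 < \<epsilon>\<close> K_ge_1 by (intro mult_right_mono) auto
    also have "\<dots> = 1 / (10240 * D)" unfolding Ke using C_ge_1 by simp
    finally show ?thesis .
  qed
  then show 2: "2 * C ^ 2 * (K * \<epsilon>) \<le> 1 / (8 * D)" using D by (simp add: field_simps)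
  have Ke0: "0 < K * \<epsilon>" using K_ge_1 \<open>0 < \<epsilon>\<close> by simp
  have "2 * C * (K * \<epsilon>) \<le> 2 * C ^ 2 * (K * \<epsilon>)" using C14 Ke0 by (intro mult_right_mono) auto
  then show 3: "2 * C * (K * \<epsilon>) \<le> 1 / (8 * D)" using 2 by linarith
  have "1 * (K * \<epsilon>) \<le> 2 * C * (K * \<epsilon>)" using C_ge_1 Ke0 by (intro mult_right_mono) auto
  then show "K * \<epsilon> \<le> 1 / (8 * D)" using 3 by linarith
  have "5120 * 1 * C ^ 14 < 10240 * D * C ^ 14" using D C14(1) by (intro mult_strict_right_mono) auto
  then have "1 / (10240 * D * C ^ 14) < 1 / (5120 * C ^ 14)"
    using C14(1) by (intro frac_less2) auto
  then show "K * \<epsilon> < 1 / (5120 * C ^ 14)" unfolding Ke .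
  have "64 * D * (C ^ 2 * (K * \<epsilon>)) \<le> 64 * D * (1 / (10240 * D))" using D by (intro mult_left_mono[OF Cr]) auto
  also have "\<dots> \<le> 1 / 4" using D by simp
  finally show "64 * D * C ^ 2 * (K * \<epsilon>) \<le> 1 / 4" by (simp add: mult.assoc)
qed

lemma flat_halve:
  fixes \<phi> :: "real^'e::finite \<Rightarrow> 'a"
  assumes "y \<in> S" "flat \<mu> y (8 * s k) \<phi> m \<delta>" "0 \<le> \<delta>"
  shows "flat \<mu> y (8 * s (Suc k)) \<phi> m (2 * C * \<delta>)"
proof (rule flat_shrink[OF assms(2)])
  have "M y (8 * s k) \<le> C * M y (8 * s (Suc k))"
    using M_double[OF assms(1), of "8 * s (Suc k)"] s_pos[of "Suc k"] by (simp add: s_Suc)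
  then have "\<delta> * (8 * s k) * M y (8 * s k) \<le> \<delta> * (8 * s k) * (C * M y (8 * s (Suc k)))"
    using assms(3) s_pos[of k] by (intro mult_left_mono) auto
  then show "\<delta> * (8 * s k) * M y (8 * s k) \<le> 2 * C * \<delta> * (8 * s (Suc k)) * M y (8 * s (Suc k))"
    by (simp add: s_Suc ac_simps)
  show "ball y (8 * s (Suc k)) \<subseteq> ball y (8 * s k)" using s_pos[of k] by (intro subset_ball) (simp add: s_Suc)
qed

lemma flat_shift:
  fixes \<phi> :: "real^'e::finite \<Rightarrow> 'a"
  assumes y: "y \<in> S" and y0: "dist y0 y < 2 * s k" and fl: "flat \<mu> y0 (8 * s k) \<phi> m \<delta>" and \<delta>: "0 \<le> \<delta>"
  shows "flat \<mu> y (4 * s k) \<phi> m (2 * C ^ 2 * \<delta>)"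
proof (rule flat_shrink[OF fl])
  have "M y0 (8 * s k) \<le> C ^ 2 * M y (4 * s k)"
    using y0 s_pos[of k] by (intro M_compare y) auto
  then have "\<delta> * (8 * s k) * M y0 (8 * s k) \<le> \<delta> * (8 * s k) * (C ^ 2 * M y (4 * s k))"
    using \<delta> s_pos[of k] by (intro mult_left_mono) auto
  then show "\<delta> * (8 * s k) * M y0 (8 * s k) \<le> 2 * C ^ 2 * \<delta> * (4 * s k) * M y (4 * s k)"
    by (simp add: ac_simps)
  show "ball y (4 * s k) \<subseteq> ball y0 (8 * s k)"
  proof
    fix x assume "x \<in> ball y (4 * s k)"
    moreover have "s k > 0" by (rule s_pos)
    ultimately show "x \<in> ball y0 (8 * s k)" unfolding mem_ball using y0 dist_triangle[of y0 x y] by linarith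
  qed
qed

lemma flat_chain:
  fixes \<phi>0 :: "real^'d \<Rightarrow> 'a"
  assumes y: "y \<in> S" and y0: "y0 \<in> S" "dist y0 y < 2 * s k"
    and fl0: "flat \<mu> y0 (8 * s k) \<phi>0 m0 (K * \<epsilon>)"
    and \<phi>: "\<And>i. k \<le> i \<Longrightarrow> i \<le> j \<Longrightarrow> flat \<mu> y (8 * s i) (\<phi> i :: real^'d \<Rightarrow> 'a) (m i) (K * b i y)"
    and kj: "k \<le> j" and sum: "(\<Sum>i\<in>{k..j}. b i y) \<le> \<epsilon>"
  shows "norm (perp \<phi>0 (\<phi> j u)) \<le> 1 / 4 * norm u"
proof -
  have bi: "b i y \<le> \<epsilon>" if "k \<le> i" "i \<le> j" for i
    using member_le_sum[of i "{k..j}" "\<lambda>i. b i y"] that sum b_nonneg[OF y] by auto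
  have KE: "K * b i y \<le> K * \<epsilon>" "0 \<le> K * b i y" if "k \<le> i" "i \<le> j" for i
    using bi[OF that] K_ge_1 b_nonneg[OF y] by auto
  have e0: "0 \<le> K * \<epsilon>" using K_ge_1 \<epsilon>_bounds(1) by simp
  have D: "D \<ge> 192" by (rule flat_const_ge)
  have C0: "C > 0" using C_ge_1 by simp
  have iso0: "isometric \<phi>0" by (rule flat_isometric[OF fl0])
  have *: "norm (perp \<phi>0 (\<phi> n u)) \<le>
       (32 * D * C ^ 2 * (K * \<epsilon>) + 16 * D * C * K * ((\<Sum>i\<in>{k..n}. b i y) + (\<Sum>i\<in>{k..<n}. b i y))) * norm u"
    if "k \<le> n" "n \<le> j" for n u
    using that
  proof (induction n arbitrary: u rule: dec_induct)
    case base
    have k1: "flat \<mu> y (4 * s k) (\<phi> k) (m k) (2 * C ^ 2 * (K * \<epsilon>))"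
      using flat_shift[OF y _ \<phi>[of k]] flat_mono[of \<mu> y "4 * s k" "\<phi> k" "m k" "2 * C ^ 2 * (K * b k y)" "2 * C ^ 2 * (K * \<epsilon>)"]
        kj KE[of k] s_pos[of k] C0 by (auto intro!: mult_left_mono)
    have k0: "flat \<mu> y (4 * s k) \<phi>0 m0 (2 * C ^ 2 * (K * \<epsilon>))"
      by (rule flat_shift[OF y y0(2) fl0 e0])
    have "norm (perp \<phi>0 (\<phi> k u)) \<le> 8 * D * (2 * C ^ 2 * (K * \<epsilon>) + 2 * C ^ 2 * (K * \<epsilon>)) * norm u"
      by (rule flat_cmp(1)[OF y _ k0 k1 \<epsilon>_bounds(3) \<epsilon>_bounds(3)]) (use s_pos[of k] in simp)
    also have "\<dots> = (32 * D * C ^ 2 * (K * \<epsilon>)) * norm u" by simp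
    also have "\<dots> \<le> (32 * D * C ^ 2 * (K * \<epsilon>) + 16 * D * C * K * ((\<Sum>i\<in>{k..k}. b i y) + (\<Sum>i\<in>{k..<k}. b i y))) * norm u"
      using D C0 K_ge_1 b_nonneg[OF y] by (intro mult_right_mono) auto
    finally show ?case .
  next
    case (step n)
    let ?B = "\<lambda>n. 32 * D * C ^ 2 * (K * \<epsilon>) + 16 * D * C * K * ((\<Sum>i\<in>{k..n}. b i y) + (\<Sum>i\<in>{k..<n}. b i y))"
    have n: "k \<le> n" "n \<le> j" "k \<le> Suc n" "Suc n \<le> j" using step by auto
    have ison: "isometric (\<phi> n)" and ison1: "isometric (\<phi> (Suc n))"
      using flat_isometric[OF \<phi>[OF n(1,2)]] flat_isometric[OF \<phi>[OF n(3,4)]] .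
    define e where "e = perp (\<phi> n) (\<phi> (Suc n) u)"
    define v where "v = adjoint (\<phi> n) (\<phi> (Suc n) u)"
    have split: "\<phi> (Suc n) u = \<phi> n v + e" unfolding e_def v_def by (rule perp_decomposition[OF ison])
    have nv: "norm v \<le> norm u"
      using norm_adjoint_isometric[OF ison] isometric_norm[OF ison1] unfolding v_def by metis
    have h: "flat \<mu> y (8 * s (Suc n)) (\<phi> n) (m n) (2 * C * (K * b n y))"
      by (rule flat_halve[OF y \<phi>[OF n(1,2)] KE(2)[OF n(1,2)]])
    have "norm e \<le> 8 * D * (2 * C * (K * b n y) + K * b (Suc n) y) * norm u"
      unfolding e_def
    proof (rule flat_cmp(1)[OF y _ h \<phi>[OF n(3,4)]])
      have "2 * C * (K * b n y) \<le> 2 * C * (K * \<epsilon>)" by (rule mult_left_mono[OF KE(1)[OF n(1,2)]]) (use C0 in simp)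
      then show "2 * C * (K * b n y) \<le> 1 / (8 * D)" using \<epsilon>_bounds(5) by linarith
      show "K * b (Suc n) y \<le> 1 / (8 * D)" using KE[OF n(3,4)] \<epsilon>_bounds(4) by linarith
    qed (use s_pos[of "Suc n"] in simp)
    also have "\<dots> \<le> 8 * D * (2 * C * (K * b n y) + 2 * C * (K * b (Suc n) y)) * norm u"
    proof -
      have "1 * (K * b (Suc n) y) \<le> 2 * C * (K * b (Suc n) y)" using KE[OF n(3,4)] C_ge_1 by (intro mult_right_mono) auto
      then show ?thesis using D by (intro mult_right_mono mult_left_mono) auto
    qed
    also have "\<dots> = 16 * D * C * K * (b n y + b (Suc n) y) * norm u" by (simp add: algebra_simps)
    finally have e: "norm e \<le> 16 * D * C * K * (b n y + b (Suc n) y) * norm u" .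
    have Bn: "0 \<le> ?B n" using D C0 K_ge_1 \<epsilon>_bounds(1) b_nonneg[OF y] by (intro add_nonneg_nonneg mult_nonneg_nonneg sum_nonneg) auto
    have "norm (perp \<phi>0 (\<phi> (Suc n) u)) \<le> norm (perp \<phi>0 (\<phi> n v)) + norm (perp \<phi>0 e)"
      unfolding split linear_add[OF linear_perp[OF iso0]] by (rule norm_triangle_ineq)
    also have "\<dots> \<le> ?B n * norm v + norm e"
      using step.IH[of v] n norm_perp[OF iso0, of e] by simp
    also have "\<dots> \<le> ?B n * norm u + 16 * D * C * K * (b n y + b (Suc n) y) * norm u"
      using nv Bn e by (intro add_mono mult_left_mono) auto
    also have "\<dots> = ?B (Suc n) * norm u"
      using n by (simp add: algebra_simps)
    finally show ?case .
  qed
  have "norm (perp \<phi>0 (\<phi> j u)) \<le>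
       (32 * D * C ^ 2 * (K * \<epsilon>) + 16 * D * C * K * ((\<Sum>i\<in>{k..j}. b i y) + (\<Sum>i\<in>{k..<j}. b i y))) * norm u"
    by (rule *[OF kj order_refl])
  also have "\<dots> \<le> (32 * D * C ^ 2 * (K * \<epsilon>) + 16 * D * C ^ 2 * K * (\<epsilon> + \<epsilon>)) * norm u"
  proof (rule mult_right_mono[OF add_left_mono])
    have "(\<Sum>i\<in>{k..<j}. b i y) \<le> (\<Sum>i\<in>{k..j}. b i y)" using b_nonneg[OF y] by (intro sum_mono2) auto
    then have "(\<Sum>i\<in>{k..j}. b i y) + (\<Sum>i\<in>{k..<j}. b i y) \<le> \<epsilon> + \<epsilon>" using sum by linarith
    moreover have "16 * D * C * K \<le> 16 * D * C ^ 2 * K"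
      using C14(3) D K_ge_1 by (intro mult_right_mono mult_left_mono) auto
    ultimately show "16 * D * C * K * ((\<Sum>i\<in>{k..j}. b i y) + (\<Sum>i\<in>{k..<j}. b i y)) \<le> 16 * D * C ^ 2 * K * (\<epsilon> + \<epsilon>)"
      using D K_ge_1 C0 b_nonneg[OF y] by (intro mult_mono add_nonneg_nonneg sum_nonneg) auto
  qed simp
  also have "\<dots> = (64 * D * C ^ 2 * (K * \<epsilon>)) * norm u" by (simp add: algebra_simps)
  also have "\<dots> \<le> 1 / 4 * norm u" using \<epsilon>_bounds(7) by (rule mult_right_mono) simp
  finally show ?thesis .
qed

end

definition center_const :: "real \<Rightarrow> real" where
  "center_const C = 4 * real (nat \<lceil>C ^ 6\<rceil>) + 5"

lemma center_const_ge_5: "5 \<le> center_const C"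
  unfolding center_const_def using of_nat_0_le_iff[of "nat \<lceil>C ^ 6\<rceil>"] by linarith

lemma norm_adjoint_isometric_ge:
  assumes "isometric \<phi>" "norm (perp \<phi> x) \<le> norm x / 2"
  shows "norm x / 2 \<le> norm (adjoint \<phi> x)"
  using norm_triangle_ineq[of "\<phi> (adjoint \<phi> x)" "perp \<phi> x"] assms
  by (simp add: perp_decomposition[OF assms(1), symmetric] isometric_norm)

context flat_scales begin

lemma flat_perp_le:
  fixes \<phi> :: "real^'d \<Rightarrow> 'a"
  assumes y: "y \<in> S" and fl: "flat \<mu> y (8 * s j) \<phi> m \<delta>" and \<delta>: "\<delta> \<le> K * \<epsilon>"
    and z: "z \<in> S" "dist z y < 4 * s j" and z': "z' \<in> S" "dist z' y < 4 * s j"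
  shows "norm (perp \<phi> (z - z')) \<le> s j / 160"
proof -
  have "norm (perp \<phi> (z - z')) \<le> 2 * (1 / 2560) * (8 * s j)"
  proof (rule flat_near[OF y _ fl, where j = 14])
    show "\<delta> < 1 / (32 * C ^ 4)" using \<delta> \<epsilon>_bounds(4) by (intro flat_const_small[of _ d]) linarith
    show "\<delta> < 1 / 2560 / (2 * C ^ 14)" using \<delta> \<epsilon>_bounds(6) by simp
  qed (use s_pos[of j] z z' in auto)
  then show ?thesis by simp
qed

lemma center_projection:
  fixes \<phi>0 :: "real^'d \<Rightarrow> 'a"
  assumes c: "c \<in> S" and c': "c' \<in> S" and y0: "y0 \<in> S" "dist y0 c < 2 * s k"
    and fl0: "flat \<mu> y0 (8 * s k) \<phi>0 m0 (K * \<epsilon>)"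
    and kj: "k \<le> j" and sum: "(\<Sum>i\<in>{k..j}. b i c) \<le> \<epsilon>"
    and dist: "s j / 40 \<le> dist c c'" "dist c c' \<le> 2 * s j"
  shows "dist c c' / 2 \<le> norm (adjoint \<phi>0 (c - c'))"
proof -
  have bi: "b i c \<le> \<epsilon>" if "k \<le> i" "i \<le> j" for i
    using member_le_sum[of i "{k..j}" "\<lambda>i. b i c"] that sum b_nonneg[OF c] by auto
  have "\<forall>i. \<exists>\<phi> m. k \<le> i \<and> i \<le> j \<longrightarrow> flat \<mu> c (8 * s i) (\<phi> :: real^'d \<Rightarrow> 'a) m (K * b i c)"
    using b_flat_s[OF c] bi \<epsilon>_bounds(2) by (meson le_less_trans)
  then obtain \<phi> m where \<phi>: "\<And>i. k \<le> i \<Longrightarrow> i \<le> j \<Longrightarrow> flat \<mu> c (8 * s i) (\<phi> i :: real^'d \<Rightarrow> 'a) (m i) (K * b i c)"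
    by metis
  note iso0 = flat_isometric[OF fl0] and isoj = flat_isometric[OF \<phi>[OF kj order_refl]]
  define v where "v = adjoint (\<phi> j) (c - c')"
  define e where "e = perp (\<phi> j) (c - c')"
  have split: "c - c' = \<phi> j v + e" unfolding e_def v_def by (rule perp_decomposition[OF isoj])
  have "norm e \<le> s j / 160"
    unfolding e_def
  proof (rule flat_perp_le[OF c \<phi>[OF kj order_refl] _ c _ c'])
    show "K * b j c \<le> K * \<epsilon>" using bi[OF kj order_refl] K_ge_1 by simp
    show "dist c' c < 4 * s j" using dist(2) s_pos[of j] by (simp only: dist_commute[of c' c])
  qed (use s_pos[of j] in simp)
  then have e: "norm e \<le> dist c c' / 4" using dist(1) by linarith
  have "norm (perp \<phi>0 (\<phi> j v)) \<le> 1 / 4 * norm v" by (rule flat_chain[OF c y0 fl0 \<phi> kj sum])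
  also have "\<dots> \<le> 1 / 4 * norm (c - c')" unfolding v_def using norm_adjoint_isometric[OF isoj] by (intro mult_left_mono) auto
  finally have "norm (perp \<phi>0 (\<phi> j v)) \<le> dist c c' / 4" by (simp add: dist_norm)
  moreover have "norm (perp \<phi>0 (c - c')) \<le> norm (perp \<phi>0 (\<phi> j v)) + norm (perp \<phi>0 e)"
    unfolding split linear_add[OF linear_perp[OF iso0]] by (rule norm_triangle_ineq)
  ultimately have "norm (perp \<phi>0 (c - c')) \<le> norm (c - c') / 2"
    using e norm_perp[OF iso0, of e] by (simp add: dist_norm)
  from norm_adjoint_isometric_ge[OF iso0 this] show ?thesis by (simp add: dist_norm)
qed

lemma scale_choice:
  assumes "\<sigma> < s k" "0 < t" "t \<le> 2 * s k" "\<sigma> \<le> 20 * t"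
  shows "\<exists>j\<ge>k. \<sigma> < s j \<and> s j / 40 \<le> t \<and> t \<le> 2 * s j"
proof -
  define P where "P j \<longleftrightarrow> k \<le> j \<and> \<sigma> < s j \<and> t \<le> 2 * s j" for j
  obtain N where "(1 / 2) ^ N < t / (2 * r)"
    using real_arch_pow_inv[of "t / (2 * r)" "1 / 2"] assms(2) r_pos by auto
  then have N: "2 * s N < t" using r_pos by (simp add: s_def power_one_over field_simps)
  have bound: "j \<le> N" if "P j" for j
  proof (rule ccontr)
    assume "\<not> j \<le> N"
    then have "s j \<le> s N" by (intro s_antimono) simp
    then show False using that N by (simp add: P_def)
  qed
  have "P k" using assms by (simp add: P_def)
  define j where "j = Greatest P"
  have Pj: "P j" unfolding j_def using \<open>P k\<close> bound by (rule GreatestI_nat)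
  have "\<not> P (Suc j)"
  proof
    assume "P (Suc j)"
    then have "Suc j \<le> j" unfolding j_def using bound by (rule Greatest_le_nat)
    then show False by simp
  qed
  then have "s j / 2 \<le> \<sigma> \<or> s j < t" using Pj by (auto simp: P_def s_Suc)
  then have "s j / 40 \<le> t" using assms(2,4) s_pos[of j] by linarith
  then show ?thesis using Pj by (auto simp: P_def)
qed

lemma centers_flat:
  assumes P: "P \<subseteq> S \<inter> ball x (s k)" and \<sigma>: "\<And>c. c \<in> P \<Longrightarrow> 0 \<le> \<sigma> c"
    and sep: "\<And>c c'. c \<in> P \<Longrightarrow> c' \<in> P \<Longrightarrow> c \<noteq> c' \<Longrightarrow> (\<sigma> c + \<sigma> c') / 20 \<le> dist c c'"
    and bud: "\<And>c j. c \<in> P \<Longrightarrow> k \<le> j \<Longrightarrow> \<sigma> c < s j \<Longrightarrow> (\<Sum>i\<in>{k..j}. b i c) \<le> \<epsilon>"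
    and y0: "y0 \<in> S" "y0 \<in> ball x (s k)" "b k y0 \<le> \<epsilon>"
  shows "\<exists>g :: 'a \<Rightarrow> real^'d. bi_lipschitz_on 4 P g \<and> (\<forall>c\<in>P. norm (g c) \<le> s k / 2)"
proof -
  obtain \<phi>0 m0 where "flat \<mu> y0 (8 * s k) (\<phi>0 :: real^'d \<Rightarrow> 'a) m0 (K * b k y0)"
    using b_flat_s[OF y0(1)] y0(3) \<epsilon>_bounds(2) by fastforce
  moreover have "K * b k y0 \<le> K * \<epsilon>" using y0(3) K_ge_1 by simp
  ultimately have fl0: "flat \<mu> y0 (8 * s k) \<phi>0 m0 (K * \<epsilon>)" using flat_mono s_pos[of k] by fastforce
  note iso0 = flat_isometric[OF fl0]
  note lin = adjoint_linear[OF isometric_linear[OF iso0]]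
  have d0: "dist y0 c < 2 * s k" if "c \<in> P" for c
  proof -
    have "dist x c < s k" "dist x y0 < s k" using that P y0(2) by auto
    then show ?thesis using dist_triangle3[of y0 c x] by linarith
  qed
  have low: "dist c c' / 2 \<le> norm (adjoint \<phi>0 (c - c'))" if c: "c \<in> P" "c' \<in> P" for c c'
  proof (cases "c = c'")
    case False
    have cS: "c \<in> S" "c' \<in> S" using c P by auto
    have dk: "dist c c' \<le> 2 * s k"
    proof -
      have "dist x c < s k" "dist x c' < s k" using c P by auto
      then show ?thesis using dist_triangle3[of c c' x] by linarith
    qed
    have s0: "0 \<le> \<sigma> c" "0 \<le> \<sigma> c'" using \<sigma> c by auto
    have sp: "(\<sigma> c + \<sigma> c') / 20 \<le> dist c c'" by (rule sep[OF c False])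
    have pos: "0 < dist c c'" using False by simp
    show ?thesis
    proof (cases "\<sigma> c < s k")
      case True
      then obtain j where j: "k \<le> j" "\<sigma> c < s j" "s j / 40 \<le> dist c c'" "dist c c' \<le> 2 * s j"
        using scale_choice[of "\<sigma> c" k "dist c c'"] pos dk sp s0 by force
      show ?thesis by (rule center_projection[OF cS y0(1) d0[OF c(1)] fl0 j(1) bud[OF c(1) j(1,2)] j(3,4)])
    next
      case big: False
      show ?thesis
      proof (cases "\<sigma> c' < s k")
        case True
        then obtain j where j: "k \<le> j" "\<sigma> c' < s j" "s j / 40 \<le> dist c' c" "dist c' c \<le> 2 * s j"
          using scale_choice[of "\<sigma> c'" k "dist c' c"] pos dk sp s0 by (force simp: dist_commute)
        have "dist c' c / 2 \<le> norm (adjoint \<phi>0 (c' - c))"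
          by (rule center_projection[OF cS(2,1) y0(1) d0[OF c(2)] fl0 j(1) bud[OF c(2) j(1,2)] j(3,4)])
        moreover have "norm (adjoint \<phi>0 (c' - c)) = norm (adjoint \<phi>0 (c - c'))"
          by (simp add: linear_diff[OF lin] norm_minus_commute)
        ultimately show ?thesis by (simp add: dist_commute)
      next
        case False
        have "s k \<le> \<sigma> c" "s k \<le> \<sigma> c'" using big False by auto
        then have D: "s k / 10 \<le> dist c c'" using sp by simp
        have "norm (perp \<phi>0 (c - c')) \<le> s k / 160"
          using d0[OF c(1)] d0[OF c(2)] s_pos[of k]
          by (intro flat_perp_le[OF y0(1) fl0 order_refl] cS) (auto simp: dist_commute)
        then have "norm (perp \<phi>0 (c - c')) \<le> norm (c - c') / 2" using D s_pos[of k] by (simp add: dist_norm)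
        from norm_adjoint_isometric_ge[OF iso0 this] show ?thesis by (simp add: dist_norm)
      qed
    qed
  qed simp
  define g where "g c = (1 / 2) *\<^sub>R adjoint \<phi>0 (c - x)" for c
  have gd: "dist (g c) (g c') = norm (adjoint \<phi>0 (c - c')) / 2" for c c'
  proof -
    have "g c - g c' = (1 / 2) *\<^sub>R adjoint \<phi>0 (c - c')"
      by (simp add: g_def scaleR_diff_right[symmetric] linear_diff[OF lin, symmetric])
    then show ?thesis by (simp add: dist_norm)
  qed
  have "bi_lipschitz_on 4 P g"
  proof (rule bi_lipschitz_onI)
    fix c c' assume "c \<in> P" "c' \<in> P"
    then show "dist c c' \<le> 4 * dist (g c) (g c')" using low[of c c'] by (simp add: gd)
    show "dist (g c) (g c') \<le> 4 * dist c c'"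
      using norm_adjoint_isometric[OF iso0, of "c - c'"] zero_le_dist[of c c'] unfolding gd dist_norm[of c c'] by linarith
  qed simp
  moreover have "norm (g c) \<le> s k / 2" if "c \<in> P" for c
  proof -
    have "norm (c - x) < s k" using that P by (auto simp: dist_norm norm_minus_commute)
    then show ?thesis using norm_adjoint_isometric[OF iso0, of "c - x"] by (simp add: g_def)
  qed
  ultimately show ?thesis by blast
qed

lemma separated_card_le:
  assumes P: "P \<subseteq> S \<inter> ball x (s k)" and x: "finite P"
    and sep: "\<And>c c'. c \<in> P \<Longrightarrow> c' \<in> P \<Longrightarrow> c \<noteq> c' \<Longrightarrow> s k / 10 \<le> dist c c'"
  shows "real (card P) \<le> C ^ 6"
proof (cases "P = {}")
  case True
  then show ?thesis using C_ge_1 by simp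
next
  case False
  then obtain c0 where c0: "c0 \<in> P" by auto
  have s0: "s k > 0" by (rule s_pos)
  have sub: "ball c (s k / 20) \<subseteq> ball x (2 * s k)" if "c \<in> P" for c
  proof
    fix z assume "z \<in> ball c (s k / 20)"
    moreover have "dist x c < s k" using that P by auto
    ultimately show "z \<in> ball x (2 * s k)" unfolding mem_ball using s0 dist_triangle[of x z c] by linarith
  qed
  have M2: "M x (2 * s k) \<le> C ^ 6 * M c (s k / 20)" if "c \<in> P" for c
  proof (rule M_compare)
    have "dist x c < s k" using that P by auto
    moreover have "2 ^ 6 * (s k / 20) = 16 / 5 * s k" by simp
    ultimately show "dist x c + 2 * s k \<le> 2 ^ 6 * (s k / 20)" using s0 by linarith
  qed (use that P s0 in auto)
  have pos: "M x (2 * s k) > 0" using M_pos[of c0 "s k / 20"] M_mono[OF sub[OF c0]] c0 P s0 by force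
  have "real (card P) * (M x (2 * s k) / C ^ 6) = (\<Sum>c\<in>P. M x (2 * s k) / C ^ 6)" by simp
  also have "\<dots> \<le> (\<Sum>c\<in>P. M c (s k / 20))"
    using M2 C_ge_1 by (intro sum_mono) (simp add: divide_le_eq mult.commute)
  also have "\<dots> = measure \<mu> (\<Union>c\<in>P. ball c (s k / 20))"
  proof (rule measure_UNION'[symmetric, OF x])
    have "disjnt (ball c (s k / 20)) (ball c' (s k / 20))" if c: "c \<in> P" "c' \<in> P" "c \<noteq> c'" for c c'
    proof -
      have "False" if "z \<in> ball c (s k / 20)" "z \<in> ball c' (s k / 20)" for z
      proof -
        have "dist c z < s k / 20" "dist c' z < s k / 20" using that by auto
        then show False using sep[OF c] dist_triangle2[of c c' z] by linarith
      qed
      then show ?thesis by (auto simp: disjnt_iff)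
    qed
    then show "pairwise (\<lambda>c c'. disjnt (ball c (s k / 20)) (ball c' (s k / 20))) P" by (simp add: pairwise_def)
  qed auto
  also have "\<dots> \<le> M x (2 * s k)" using sub by (intro measure_mono_fmeasurable) (auto intro: borel_open)
  finally have "real (card P) * (M x (2 * s k) / C ^ 6) \<le> M x (2 * s k)" .
  then show ?thesis using pos C_ge_1 by (simp add: field_simps)
qed

lemma centers_separated:
  assumes P: "P \<subseteq> S \<inter> ball x (s k)"
    and sep: "\<And>c c'. c \<in> P \<Longrightarrow> c' \<in> P \<Longrightarrow> c \<noteq> c' \<Longrightarrow> s k / 10 \<le> dist c c'"
  shows "\<exists>g :: 'a \<Rightarrow> real^'d. bi_lipschitz_on (center_const C) P g \<and> (\<forall>c\<in>P. norm (g c) \<le> s k / 2)"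
proof -
  define N where "N = nat \<lceil>C ^ 6\<rceil>"
  have C6: "1 \<le> C ^ 6" using C_ge_1 by (rule one_le_power)
  have N: "real N \<ge> C ^ 6" unfolding N_def by (rule real_nat_ceiling_ge)
  have N1: "real N \<ge> 1" using N C6 by linarith
  have s0: "s k > 0" by (rule s_pos)
  have card: "card F \<le> N" if "F \<subseteq> P" "finite F" for F
  proof -
    have "real (card F) \<le> C ^ 6" by (rule separated_card_le[of F x k]) (use that P sep in \<open>auto simp: subset_iff\<close>)
    then show ?thesis using N by linarith
  qed
  have fin: "finite P" using finite_if_finite_subsets_card_bdd[of P N] card by blast
  obtain h where h: "bij_betw h P {0..<card P}" using ex_bij_betw_finite_nat[OF fin] by blast
  obtain w :: "real^'d" where w: "norm w = 1" using vector_choose_size[of 1] by auto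
  define g where "g c = (real (h c) * (s k / (2 * real N))) *\<^sub>R w" for c
  have hN: "real (h c) \<le> real N" if "c \<in> P" for c
    using bij_betwE[OF h] that card[OF order_refl fin] by force
  have gd: "dist (g c) (g c') = \<bar>real (h c) - real (h c')\<bar> * (s k / (2 * real N))" for c c'
    using w s0 by (simp add: g_def dist_norm scaleR_diff_left[symmetric] left_diff_distrib[symmetric] abs_mult diff_divide_distrib[symmetric])
  have "bi_lipschitz_on (center_const C) P g"
  proof (rule bi_lipschitz_onI)
    fix c c' assume c: "c \<in> P" "c' \<in> P"
    have "dist c c' \<le> (4 * real N + 5) * dist (g c) (g c') \<and> dist (g c) (g c') \<le> (4 * real N + 5) * dist c c'"
    proof (cases "c = c'")
      case False
      have "dist x c < s k" "dist x c' < s k" using c P by auto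
      then have up: "dist c c' \<le> 2 * s k" using dist_triangle3[of c c' x] by linarith
      have "h c \<noteq> h c'" using h c False by (auto simp: bij_betw_def inj_on_def)
      then have "1 * (s k / (2 * real N)) \<le> dist (g c) (g c')"
        unfolding gd using s0 N1 by (intro mult_right_mono) auto
      then have "4 * real N * (1 * (s k / (2 * real N))) \<le> 4 * real N * dist (g c) (g c')"
        using N1 by (intro mult_left_mono) auto
      then have "2 * s k \<le> 4 * real N * dist (g c) (g c')" using N1 by simp
      then have 1: "dist c c' \<le> (4 * real N + 5) * dist (g c) (g c')"
        using up zero_le_dist[of "g c" "g c'"] unfolding distrib_right by linarith
      have "\<bar>real (h c) - real (h c')\<bar> \<le> real N"
        using hN[OF c(1)] hN[OF c(2)] of_nat_0_le_iff[of "h c", where 'a=real] of_nat_0_le_iff[of "h c'", where 'a=real]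
        unfolding abs_le_iff by linarith
      then have "dist (g c) (g c') \<le> real N * (s k / (2 * real N))" unfolding gd using s0 by (intro mult_right_mono) auto
      then have "dist (g c) (g c') \<le> s k / 2" using N1 by simp
      also have "\<dots> \<le> 5 * dist c c'" using sep[OF c False] by linarith
      also have "\<dots> \<le> (4 * real N + 5) * dist c c'" by (intro mult_right_mono) auto
      finally show ?thesis using 1 by simp
    qed simp
    then show "dist c c' \<le> center_const C * dist (g c) (g c')" "dist (g c) (g c') \<le> center_const C * dist c c'"
      by (auto simp: center_const_def N_def)
  next
    show "0 < center_const C" using center_const_ge_5[of C] by linarith
  qed
  moreover have "norm (g c) \<le> s k / 2" if "c \<in> P" for c
  proof -
    have "norm (g c) = real (h c) * (s k / (2 * real N))" using s0 w by (simp add: g_def)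
    also have "\<dots> \<le> real N * (s k / (2 * real N))" by (rule mult_right_mono[OF hN[OF that]]) (use s0 in simp)
    finally have "norm (g c) \<le> real N * (s k / (2 * real N))" .
    then show ?thesis using N1 by simp
  qed
  ultimately show ?thesis by blast
qed

lemma centers:
  assumes P: "P \<subseteq> S \<inter> ball x (s k)" and \<sigma>: "\<And>c. c \<in> P \<Longrightarrow> 0 \<le> \<sigma> c"
    and sep: "\<And>c c'. c \<in> P \<Longrightarrow> c' \<in> P \<Longrightarrow> c \<noteq> c' \<Longrightarrow> (\<sigma> c + \<sigma> c') / 20 \<le> dist c c'"
    and bud: "\<And>c j. c \<in> P \<Longrightarrow> k \<le> j \<Longrightarrow> \<sigma> c < s j \<Longrightarrow> (\<Sum>i\<in>{k..j}. b i c) \<le> \<epsilon>"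
    and top: "(\<exists>y0 \<in> S \<inter> ball x (s k). b k y0 \<le> \<epsilon>) \<or> (\<forall>c\<in>P. s k \<le> \<sigma> c)"
  shows "\<exists>g :: 'a \<Rightarrow> real^'d. bi_lipschitz_on (center_const C) P g \<and> (\<forall>c\<in>P. norm (g c) \<le> s k / 2)"
  using top
proof
  assume "\<exists>y0 \<in> S \<inter> ball x (s k). b k y0 \<le> \<epsilon>"
  then obtain y0 where "y0 \<in> S" "y0 \<in> ball x (s k)" "b k y0 \<le> \<epsilon>" by auto
  from centers_flat[OF P \<sigma> sep bud this]
  obtain g :: "'a \<Rightarrow> real^'d" where "bi_lipschitz_on 4 P g" "\<forall>c\<in>P. norm (g c) \<le> s k / 2" by auto
  moreover have "4 \<le> center_const C" using center_const_ge_5[of C] by linarith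
  ultimately show ?thesis using bi_lipschitz_on_mono[of 4 P g "center_const C"] by auto
next
  assume big: "\<forall>c\<in>P. s k \<le> \<sigma> c"
  show ?thesis
  proof (rule centers_separated[OF P])
    fix c c' assume c: "c \<in> P" "c' \<in> P" "c \<noteq> c'"
    then have "s k \<le> \<sigma> c" "s k \<le> \<sigma> c'" using big by auto
    then show "s k / 10 \<le> dist c c'" using sep[OF c] by simp
  qed
qed

end

context doubling_radon begin

lemma thin_shell:
  assumes s: "s > 0" and m: "m > (0::nat)"
  shows "\<exists>\<rho>. s / 4 \<le> \<rho> \<and> \<rho> \<le> s / 2 \<and> measure \<mu> {z. \<bar>dist z c - \<rho>\<bar> < s / (8 * real m)} \<le> M c s / real m"
proof -
  define t where "t = s / (8 * real m)"
  have t: "t > 0" and s_eq: "s = 8 * real m * t" using s m by (auto simp: t_def)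
  define \<rho> where "\<rho> i = s / 4 + (2 * real i + 1) * t" for i :: nat
  define T where "T i = {z. \<bar>dist z c - \<rho> i\<bar> < t}" for i
  have \<rho>: "s / 4 \<le> \<rho> i" "\<rho> i + t \<le> s / 2" if "i < m" for i
  proof -
    show "s / 4 \<le> \<rho> i" using t by (simp add: \<rho>_def)
    have "real i + 1 \<le> real m" using that by linarith
    then have "(real i + 1) * t \<le> real m * t" using t by (intro mult_right_mono) auto
    then show "\<rho> i + t \<le> s / 2" by (simp add: \<rho>_def s_eq algebra_simps)
  qed
  have op: "open (T i)" for i
    unfolding T_def by (intro open_Collect_less continuous_intros)
  have sub: "T i \<subseteq> ball c s" if "i < m" for i
    using \<rho>(2)[OF that] s by (auto simp: T_def dist_commute)
  have fm: "T i \<in> fmeasurable \<mu>" if "i < m" for i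
    using sub[OF that] op by (intro fmeasurableI2[OF ball_fmeasurable, of _ c s]) auto
  have disj: "disjnt (T i) (T j)" if "i < j" for i j
  proof -
    have "\<rho> i + 2 * t \<le> \<rho> j"
    proof -
      have "real i + 1 \<le> real j" using that by linarith
      then have "(real i + 1) * t \<le> real j * t" using t by (intro mult_right_mono) auto
      then show ?thesis by (simp add: \<rho>_def algebra_simps)
    qed
    then show ?thesis by (auto simp: disjnt_iff T_def)
  qed
  have "(\<Sum>i<m. measure \<mu> (T i)) = measure \<mu> (\<Union>i<m. T i)"
  proof (rule measure_UNION'[symmetric])
    show "pairwise (\<lambda>i j. disjnt (T i) (T j)) {..<m}"
      using disj by (auto simp: pairwise_def) (metis disjnt_sym linorder_neqE_nat)
  qed (use fm in auto)
  also have "\<dots> \<le> M c s" using sub op by (intro measure_mono_fmeasurable) auto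
  finally have sum: "(\<Sum>i<m. measure \<mu> (T i)) \<le> M c s" .
  have "\<exists>i<m. measure \<mu> (T i) \<le> M c s / real m"
  proof (rule ccontr)
    assume "\<not> ?thesis"
    then have "(\<Sum>i<m. M c s / real m) < (\<Sum>i<m. measure \<mu> (T i))"
      using m by (intro sum_strict_mono) auto
    then show False using sum m by simp
  qed
  then obtain i where i: "i < m" "measure \<mu> (T i) \<le> M c s / real m" by blast
  have "\<rho> i \<le> s / 2" using \<rho>(2)[OF i(1)] t by linarith
  then show ?thesis using i \<rho>(1)[OF i(1)] unfolding T_def t_def by blast
qed

lemma disjoint_family_measure_bound:
  assumes I: "countable I" and T: "\<And>c. c \<in> I \<Longrightarrow> T c \<in> fmeasurable \<mu>" and B: "\<And>c. c \<in> I \<Longrightarrow> B c \<in> fmeasurable \<mu>"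
    and disj: "pairwise (\<lambda>c c'. disjnt (B c) (B c')) I"
    and sub: "\<And>c. c \<in> I \<Longrightarrow> B c \<subseteq> U" and U: "U \<in> fmeasurable \<mu>"
    and \<kappa>: "0 \<le> \<kappa>" and le: "\<And>c. c \<in> I \<Longrightarrow> measure \<mu> (T c) \<le> \<kappa> * measure \<mu> (B c)"
  shows "(\<Union>c\<in>I. T c) \<in> fmeasurable \<mu>" "measure \<mu> (\<Union>c\<in>I. T c) \<le> \<kappa> * measure \<mu> U"
proof -
  have fin: "measure \<mu> (\<Union>c\<in>J. T c) \<le> \<kappa> * measure \<mu> U" if J: "finite J" "J \<subseteq> I" for J
  proof -
    have "measure \<mu> (\<Union>c\<in>J. T c) \<le> (\<Sum>c\<in>J. measure \<mu> (T c))"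
      using J T fmeasurableD by (intro measure_UNION_le) blast+
    also have "\<dots> \<le> (\<Sum>c\<in>J. \<kappa> * measure \<mu> (B c))" using J le by (intro sum_mono) auto
    also have "\<dots> = \<kappa> * measure \<mu> (\<Union>c\<in>J. B c)"
      using J B disj by (subst measure_UNION') (auto simp: sum_distrib_left pairwise_def)
    also have "\<dots> \<le> \<kappa> * measure \<mu> U"
      using J B sub U \<kappa> fmeasurableD by (intro mult_left_mono measure_mono_fmeasurable sets.finite_UN) blast+
    finally show ?thesis .
  qed
  show "(\<Union>c\<in>I. T c) \<in> fmeasurable \<mu>"
    by (rule fmeasurable_UN_bound[OF I T]) (use fin in auto)
  show "measure \<mu> (\<Union>c\<in>I. T c) \<le> \<kappa> * measure \<mu> U"
    by (rule measure_UN_bound[OF I T]) (use fin in auto)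
qed

end

lemma disjnt_cball_dist:
  fixes c c' :: "'a::euclidean_space"
  assumes "disjnt (cball c t) (cball c' t')" "0 \<le> t" "0 \<le> t'"
  shows "t + t' < dist c c'"
proof (rule ccontr)
  assume "\<not> t + t' < dist c c'"
  then have le: "dist c c' \<le> t + t'" by simp
  define D where "D = dist c c'"
  define l where "l = min t D"
  define z where "z = c + (l / D) *\<^sub>R (c' - c)"
  have "z \<in> cball c t \<inter> cball c' t'"
  proof (cases "D = 0")
    case True
    then show ?thesis using assms by (simp add: z_def D_def)
  next
    case False
    then have D: "D > 0" by (simp add: D_def)
    have l: "0 \<le> l" "l \<le> t" "l \<le> D" "D - l \<le> t'" using assms D le by (auto simp: l_def D_def)
    have nD: "norm (c' - c) = D" by (simp add: D_def dist_norm norm_minus_commute)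
    have "dist c z = l" using l D by (simp add: z_def dist_norm nD)
    have "c' - z = (1 - l / D) *\<^sub>R (c' - c)" by (simp add: z_def algebra_simps)
    then have "dist c' z = \<bar>1 - l / D\<bar> * D" using nD by (simp add: dist_norm)
    moreover have "0 \<le> 1 - l / D" "(1 - l / D) * D = D - l" using l D by (auto simp: left_diff_distrib)
    ultimately have "dist c' z = D - l" by simp
    with \<open>dist c z = l\<close> show ?thesis using l by simp
  qed
  then show False using assms(1) by (auto simp: disjnt_iff)
qed

definition shell_count :: "real \<Rightarrow> real \<Rightarrow> nat" where
  "shell_count C \<tau> = nat \<lceil>2 * C ^ 6 / \<tau>\<rceil>"

fun lip_const :: "real \<Rightarrow> nat \<Rightarrow> real \<Rightarrow> real" where
  "lip_const C 0 \<tau> = 1"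
| "lip_const C (Suc N) \<tau> =
     glue_const (center_const C) (lip_const C N (\<tau> / (2 * C ^ 6))) (1 / (8 * real (shell_count C \<tau>)))"

lemma glue_const_ge_1: "1 \<le> l \<Longrightarrow> 1 \<le> L \<Longrightarrow> 0 \<le> \<eta> \<Longrightarrow> 1 \<le> glue_const l L \<eta>"
proof -
  assume l: "1 \<le> l" "1 \<le> L" "0 \<le> \<eta>"
  then have "0 \<le> 40 * l * L" "0 \<le> 2 * l * (1 + 2 / \<eta>)" by auto
  then show ?thesis unfolding glue_const_def using l(1) by linarith
qed

lemma lip_const_ge_1: "1 \<le> lip_const C N \<tau>"
proof (induction N arbitrary: \<tau>)
  case (Suc N)
  have "1 \<le> center_const C" using center_const_ge_5[of C] by linarith
  then show ?case using Suc by (auto intro!: glue_const_ge_1)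
qed simp

lemma (in doubling_radon) thin_shell_family:
  assumes \<tau>: "0 < \<tau>" and st: "\<And>c. c \<in> I \<Longrightarrow> 0 < \<sigma> c"
  shows "\<exists>\<rho>. \<forall>c\<in>I. \<sigma> c / 4 \<le> \<rho> c \<and> \<rho> c \<le> \<sigma> c / 2 \<and>
    measure \<mu> {z. \<bar>dist z c - \<rho> c\<bar> < 1 / (8 * real (shell_count C \<tau>)) * \<sigma> c} \<le> M c (\<sigma> c) * (\<tau> / (2 * C ^ 6))"
proof -
  let ?m = "shell_count C \<tau>"
  have m: "2 * C ^ 6 / \<tau> \<le> real ?m" unfolding shell_count_def by (rule real_nat_ceiling_ge)
  have pos: "0 < 2 * C ^ 6 / \<tau>" using C_ge_1 \<tau> by simp
  then have m0: "0 < ?m" using m by linarith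
  have "1 / real ?m \<le> 1 / (2 * C ^ 6 / \<tau>)" using m pos by (intro divide_left_mono mult_pos_pos) linarith+
  then have inv: "1 / real ?m \<le> \<tau> / (2 * C ^ 6)" by simp
  have "\<exists>\<rho>. c \<in> I \<longrightarrow> \<sigma> c / 4 \<le> \<rho> \<and> \<rho> \<le> \<sigma> c / 2 \<and>
    measure \<mu> {z. \<bar>dist z c - \<rho>\<bar> < 1 / (8 * real ?m) * \<sigma> c} \<le> M c (\<sigma> c) * (\<tau> / (2 * C ^ 6))" for c
  proof (cases "c \<in> I")
    case True
    obtain \<rho> where \<rho>: "\<sigma> c / 4 \<le> \<rho>" "\<rho> \<le> \<sigma> c / 2"
      "measure \<mu> {z. \<bar>dist z c - \<rho>\<bar> < \<sigma> c / (8 * real ?m)} \<le> M c (\<sigma> c) / real ?m"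
      using thin_shell[OF st[OF True] m0] by blast
    have "M c (\<sigma> c) / real ?m = M c (\<sigma> c) * (1 / real ?m)" by simp
    also have "\<dots> \<le> M c (\<sigma> c) * (\<tau> / (2 * C ^ 6))" by (rule mult_left_mono[OF inv]) simp
    finally show ?thesis using \<rho> by auto
  qed auto
  then have "\<forall>c. \<exists>\<rho>. c \<in> I \<longrightarrow> \<sigma> c / 4 \<le> \<rho> \<and> \<rho> \<le> \<sigma> c / 2 \<and>
    measure \<mu> {z. \<bar>dist z c - \<rho>\<bar> < 1 / (8 * real ?m) * \<sigma> c} \<le> M c (\<sigma> c) * (\<tau> / (2 * C ^ 6))" by blast
  from choice[OF this] show ?thesis by blast
qed

context flat_scales begin

lemma small_ball_measure:
  assumes c: "c \<in> S" "dist x c < s k" "k \<le> j"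
  shows "ball c (s j / 20) \<subseteq> ball x (2 * s k)" "M c (s j) \<le> C ^ 5 * M c (s j / 20)"
    "M c (s (Suc j)) \<le> C ^ 5 * M c (s j / 20)"
proof -
  have sj: "0 < s j" "s j \<le> s k" using s_pos s_antimono c by auto
  show "ball c (s j / 20) \<subseteq> ball x (2 * s k)"
  proof
    fix z assume z: "z \<in> ball c (s j / 20)"
    then have "dist c z < s j / 20" by simp
    then show "z \<in> ball x (2 * s k)" unfolding mem_ball using sj c dist_triangle[of x z c] by linarith
  qed
  have e: "2 ^ 5 * (s j / 20) = 8 / 5 * s j" by simp
  show "M c (s j) \<le> C ^ 5 * M c (s j / 20)"
    by (rule M_compare[OF c(1)]) (use sj in \<open>simp_all add: e\<close>)
  show "M c (s (Suc j)) \<le> C ^ 5 * M c (s j / 20)"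
    by (rule M_compare[OF c(1)]) (use sj in \<open>simp_all add: e s_Suc\<close>)
qed

lemma recursion_step:
  assumes x: "x \<in> S" and E: "E \<in> sets borel" "E \<subseteq> S \<inter> ball x (s k)" and \<tau>: "0 < \<tau>"
    and bud: "\<And>y n. y \<in> E \<Longrightarrow> (\<Sum>i\<in>{k..<n}. a i y) \<le> real (Suc N) * \<epsilon>"
    and IH: "\<And>c E' j. c \<in> S \<Longrightarrow> E' \<in> sets borel \<Longrightarrow> E' \<subseteq> S \<inter> ball c (s j) \<Longrightarrow>
        (\<And>y n. y \<in> E' \<Longrightarrow> (\<Sum>i\<in>{j..<n}. a i y) \<le> real N * \<epsilon>) \<Longrightarrow>
        \<exists>A\<in>sets borel. A \<subseteq> E' \<and> measure \<mu> (E' - A) \<le> \<tau> / (2 * C ^ 6) * M c (s j) \<and>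
          (\<exists>f :: 'a \<Rightarrow> real^'d. bi_lipschitz_on L A f \<and> (\<forall>u\<in>A. norm (f u) \<le> s j))"
    and L: "1 \<le> L"
  shows "\<exists>A\<in>sets borel. A \<subseteq> E \<and> measure \<mu> (E - A) \<le> \<tau> * M x (s k) \<and>
     (\<exists>f :: 'a \<Rightarrow> real^'d. bi_lipschitz_on (glue_const (center_const C) L (1 / (8 * real (shell_count C \<tau>)))) A f \<and>
        (\<forall>u\<in>A. norm (f u) \<le> s k))"
proof -
  define \<eta> where "\<eta> = 1 / (8 * real (shell_count C \<tau>))"
  have "2 * C ^ 6 / \<tau> \<le> real (shell_count C \<tau>)" unfolding shell_count_def by (rule real_nat_ceiling_ge)
  moreover have "0 < 2 * C ^ 6 / \<tau>" using C_ge_1 \<tau> by simp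
  ultimately have "0 < real (shell_count C \<tau>)" by linarith
  then have \<eta>: "\<eta> > 0" by (simp add: \<eta>_def)
  have C6: "C ^ 6 > 0" using C_ge_1 by simp
  define stop where "stop y n \<longleftrightarrow> k \<le> n \<and> \<epsilon> < (\<Sum>i\<in>{k..n}. b i y)" for y n
  define kk where "kk y = (LEAST n. stop y n)" for y
  define St where "St = {y \<in> E. \<exists>n. stop y n}"
  define \<sigma>' where "\<sigma>' y = s (kk y)" for y
  have kk: "stop y (kk y)" if "y \<in> St" for y
    using that LeastI_ex[of "stop y"] by (auto simp: St_def kk_def)
  have kk_less: "(\<Sum>i\<in>{k..j}. b i y) \<le> \<epsilon>" if "k \<le> j" "j < kk y" for y j
    using not_less_Least[of j "stop y"] that by (auto simp: kk_def stop_def)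
  have St_k: "k \<le> kk y" if "y \<in> St" for y using kk[OF that] by (simp add: stop_def)
  have St_S: "y \<in> S" "dist x y < s k" "y \<in> E" if "y \<in> St" for y using that E(2) by (auto simp: St_def)
  have \<sigma>'_pos: "0 < \<sigma>' y" for y by (simp add: \<sigma>'_def s_pos)
  have \<sigma>'_le: "\<sigma>' y \<le> s k" if "y \<in> St" for y unfolding \<sigma>'_def by (rule s_antimono[OF St_k[OF that]])
  obtain I where I: "countable I" "I \<subseteq> St"
    and disj: "pairwise (\<lambda>i j. disjnt (cball i (\<sigma>' i / 20)) (cball j (\<sigma>' j / 20))) I"
    and cov: "St \<subseteq> (\<Union>i\<in>I. cball i (5 * (\<sigma>' i / 20)))"
  proof (rule Vitali_covering_lemma_cballs[where S=St and K=St and a="\<lambda>y. y" and r="\<lambda>y. \<sigma>' y / 20" and B="s k"])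
    show "St \<subseteq> (\<Union>i\<in>St. cball i (\<sigma>' i / 20))"
    proof
      fix y assume "y \<in> St"
      then show "y \<in> (\<Union>i\<in>St. cball i (\<sigma>' i / 20))" using \<sigma>'_pos[of y] by (intro UN_I[of y]) auto
    qed
    show "0 < \<sigma>' i / 20 \<and> \<sigma>' i / 20 \<le> s k" if "i \<in> St" for i
      using \<sigma>'_pos[of i] \<sigma>'_le[OF that] by simp
  qed (rule that)
  obtain \<rho> where \<rho>: "\<And>c. c \<in> I \<Longrightarrow> \<sigma>' c / 4 \<le> \<rho> c" "\<And>c. c \<in> I \<Longrightarrow> \<rho> c \<le> \<sigma>' c / 2"
     and \<rho>_shell: "\<And>c. c \<in> I \<Longrightarrow> measure \<mu> {z. \<bar>dist z c - \<rho> c\<bar> < \<eta> * \<sigma>' c} \<le> M c (\<sigma>' c) * (\<tau> / (2 * C ^ 6))"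
    using thin_shell_family[OF \<tau>, of I \<sigma>'] \<sigma>'_pos unfolding \<eta>_def by blast
  define T where "T c = {z. \<bar>dist z c - \<rho> c\<bar> < \<eta> * \<sigma>' c}" for c
  define TT where "TT = (\<Union>c\<in>I. T c)"
  have T_open: "open (T c)" for c unfolding T_def by (intro open_Collect_less continuous_intros)
  define e where "e = to_nat_on I"
  have e_inj: "inj_on e I" unfolding e_def by (rule inj_on_to_nat_on[OF I(1)])
  define before where "before c' c \<longleftrightarrow> kk c' < kk c \<or> kk c' = kk c \<and> e c' < e c" for c' c
  have before_total: "c = c' \<or> before c c' \<or> before c' c" if "c \<in> I" "c' \<in> I" for c c'
    using that e_inj by (auto simp: before_def inj_on_def) (metis nat_neq_iff)
  define Ec where "Ec c = E \<inter> cball c (\<rho> c) - (\<Union>c'\<in>{c'\<in>I. before c' c}. cball c' (\<rho> c')) - TT" for c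
  have TT_meas: "TT \<in> sets borel" unfolding TT_def using T_open by (intro borel_open) auto
  have Ec_meas: "Ec c \<in> sets borel" for c
    unfolding Ec_def using E(1) TT_meas I(1) by (intro sets.Diff sets.Int sets.countable_UN') (auto intro: countable_subset)
  have Ec_sub: "Ec c \<subseteq> S \<inter> ball c (s (Suc (kk c)))" if "c \<in> I" for c
  proof
    fix u assume u: "u \<in> Ec c"
    then have "dist u c \<le> \<rho> c" "u \<notin> T c" "u \<in> E" using that by (auto simp: Ec_def TT_def dist_commute)
    moreover have "0 < \<eta> * \<sigma>' c" using \<eta> \<sigma>'_pos by simp
    ultimately have "dist u c < \<rho> c" by (auto simp: T_def)
    then show "u \<in> S \<inter> ball c (s (Suc (kk c)))"
      using \<rho>(2)[OF that] \<open>u \<in> E\<close> E(2) by (auto simp: s_Suc \<sigma>'_def dist_commute)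
  qed
  have Ec_bud: "(\<Sum>i\<in>{Suc (kk c)..<n}. a i y) \<le> real N * \<epsilon>" if c: "c \<in> I" and y: "y \<in> Ec c" for c y n
  proof (cases "Suc (kk c) \<le> n")
    case True
    have cSt: "c \<in> St" using c I(2) by auto
    have yE: "y \<in> E" "y \<in> S" using y E(2) by (auto simp: Ec_def)
    have "dist c y \<le> s (kk c)" using Ec_sub[OF c] y s_pos[of "kk c"] by (auto simp: s_Suc)
    then have "b i c \<le> a i y" if "i \<le> kk c" for i
      using s_antimono[OF that] by (intro b_le_a_s St_S(1)[OF cSt] yE(2)) linarith
    then have "(\<Sum>i\<in>{k..kk c}. b i c) \<le> (\<Sum>i\<in>{k..kk c}. a i y)" by (intro sum_mono) auto
    then have "\<epsilon> < (\<Sum>i\<in>{k..kk c}. a i y)" using kk[OF cSt] by (simp add: stop_def)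
    moreover have "(\<Sum>i\<in>{k..<n}. a i y) = (\<Sum>i\<in>{k..<Suc (kk c)}. a i y) + (\<Sum>i\<in>{Suc (kk c)..<n}. a i y)"
      using True St_k[OF cSt] by (intro sum.atLeastLessThan_concat[symmetric]) auto
    moreover have "(\<Sum>i\<in>{k..<n}. a i y) \<le> real (Suc N) * \<epsilon>" by (rule bud[OF yE(1)])
    moreover have "{k..<Suc (kk c)} = {k..kk c}" by auto
    ultimately show ?thesis by (simp add: distrib_right)
  next
    case False
    then show ?thesis using \<epsilon>_bounds(1) by simp
  qed
  have "\<forall>c\<in>I. \<exists>A f. A \<in> sets borel \<and> A \<subseteq> Ec c \<and> measure \<mu> (Ec c - A) \<le> \<tau> / (2 * C ^ 6) * M c (s (Suc (kk c))) \<and>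
     bi_lipschitz_on L A (f :: 'a \<Rightarrow> real^'d) \<and> (\<forall>u\<in>A. norm (f u) \<le> s (Suc (kk c)))"
  proof
    fix c assume c: "c \<in> I"
    then have cS: "c \<in> S" using I(2) St_S by auto
    show "\<exists>A f. A \<in> sets borel \<and> A \<subseteq> Ec c \<and> measure \<mu> (Ec c - A) \<le> \<tau> / (2 * C ^ 6) * M c (s (Suc (kk c))) \<and>
     bi_lipschitz_on L A (f :: 'a \<Rightarrow> real^'d) \<and> (\<forall>u\<in>A. norm (f u) \<le> s (Suc (kk c)))"
      using IH[OF cS Ec_meas Ec_sub[OF c] Ec_bud[OF c]] by blast
  qed
  then obtain Ac f where Ac: "\<And>c. c \<in> I \<Longrightarrow> Ac c \<in> sets borel" "\<And>c. c \<in> I \<Longrightarrow> Ac c \<subseteq> Ec c"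
     and Ac_loss: "\<And>c. c \<in> I \<Longrightarrow> measure \<mu> (Ec c - Ac c) \<le> \<tau> / (2 * C ^ 6) * M c (s (Suc (kk c)))"
     and f: "\<And>c. c \<in> I \<Longrightarrow> bi_lipschitz_on L (Ac c) (f c :: 'a \<Rightarrow> real^'d)"
     and f_norm: "\<And>c u. c \<in> I \<Longrightarrow> u \<in> Ac c \<Longrightarrow> norm (f c u) \<le> s (Suc (kk c))"
    by metis
  define G where "G = E - (\<Union>c\<in>I. cball c (\<rho> c)) - TT"
  define A where "A = G \<union> (\<Union>c\<in>I. Ac c)"
  have G_meas: "G \<in> sets borel"
    unfolding G_def using E(1) TT_meas I(1) by (intro sets.Diff sets.countable_UN') auto
  have A_meas: "A \<in> sets borel"
    unfolding A_def using G_meas Ac(1) I(1) by (intro sets.Un sets.countable_UN') auto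
  have A_sub: "A \<subseteq> E" using Ac(2) by (auto simp: A_def G_def Ec_def)
  have I_ball: "c \<in> cball c (\<rho> c)" if "c \<in> I" for c using \<rho>(1)[OF that] \<sigma>'_pos[of c] by simp
  have IG: "c \<notin> G" if "c \<in> I" for c using I_ball[OF that] that unfolding G_def by blast
  have Ec_disj: "c = c'" if "c \<in> I" "c' \<in> I" "u \<in> Ec c" "u \<in> Ec c'" for c c' u
    using before_total[OF that(1,2)] that by (auto simp: Ec_def)
  have EcG: "u \<notin> G" if "c \<in> I" "u \<in> Ec c" for c u using that by (auto simp: G_def Ec_def)
  define p where "p u = (if u \<in> G then u else (THE c. c \<in> I \<and> u \<in> Ac c))" for u
  have pI: "p u = c" if "c \<in> I" "u \<in> Ac c" for u c
  proof -
    have "u \<notin> G" using EcG that Ac(2) by blast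
    moreover have "(THE c. c \<in> I \<and> u \<in> Ac c) = c" using that Ac(2) Ec_disj by (intro the_equality) blast+
    ultimately show ?thesis by (simp add: p_def)
  qed
  have pG: "p u = u" if "u \<in> G" for u using that by (simp add: p_def)
  define \<sigma> where "\<sigma> c = (if c \<in> I then \<sigma>' c else 0)" for c
  define h where "h c u = (if c \<in> I then f c u else 0)" for c u
  have A_cases: "(u \<in> G \<and> p u = u \<and> \<sigma> (p u) = 0 \<and> p u \<notin> I) \<or> (p u \<in> I \<and> u \<in> Ac (p u) \<and> \<sigma> (p u) = \<sigma>' (p u))" if "u \<in> A" for u
    using that pI pG IG by (auto simp: A_def \<sigma>_def)
  have P_cases: "c \<in> G \<and> \<sigma> c = 0 \<or> c \<in> I \<and> \<sigma> c = \<sigma>' c" if "c \<in> p ` A" for c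
    using that A_cases by (force simp: \<sigma>_def)
  have P_E: "p ` A \<subseteq> S \<inter> ball x (s k)"
  proof
    fix c assume "c \<in> p ` A"
    then have "c \<in> E" using P_cases[of c] I(2) St_S(3) by (auto simp: G_def)
    then show "c \<in> S \<inter> ball x (s k)" using E(2) by auto
  qed
  have G_unstopped: "(\<Sum>i\<in>{k..j}. b i c) \<le> \<epsilon>" if "c \<in> G" "k \<le> j" for c j
  proof (rule ccontr)
    assume "\<not> ?thesis"
    then have "c \<in> St" using that by (auto simp: St_def stop_def G_def)
    then obtain i where i: "i \<in> I" "c \<in> cball i (5 * (\<sigma>' i / 20))" using cov by auto
    then have "c \<in> cball i (\<rho> i)" using \<rho>(1)[OF i(1)] by auto
    then show False using that i by (auto simp: G_def)
  qed
  have sep: "(\<sigma> c + \<sigma> c') / 20 \<le> dist c c'" if "c \<in> p ` A" "c' \<in> p ` A" "c \<noteq> c'" for c c'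
  proof -
    have far: "\<sigma>' c / 20 \<le> dist c c'" if "c \<in> I" "c' \<in> G" for c c'
    proof -
      have "\<rho> c < dist c c'" using that by (auto simp: G_def not_le)
      then show ?thesis using \<rho>(1)[OF \<open>c \<in> I\<close>] \<sigma>'_pos[of c] by linarith
    qed
    have "\<sigma>' c / 20 + \<sigma>' c' / 20 < dist c c'" if "c \<in> I" "c' \<in> I"
      using disj that \<open>c \<noteq> c'\<close> \<sigma>'_pos[of c] \<sigma>'_pos[of c']
      by (intro disjnt_cball_dist) (auto simp: pairwise_def)
    then show ?thesis
      using P_cases[OF that(1)] P_cases[OF that(2)] far[of c c'] far[of c' c]
      by (auto simp: dist_commute add_divide_distrib)
  qed
  have bud': "(\<Sum>i\<in>{k..j}. b i c) \<le> \<epsilon>" if "c \<in> p ` A" "k \<le> j" "\<sigma> c < s j" for c j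
    using P_cases[OF that(1)]
  proof
    assume "c \<in> I \<and> \<sigma> c = \<sigma>' c"
    then have "s (kk c) < s j" using that by (simp add: \<sigma>'_def)
    then have "j < kk c" using s_antimono[of "kk c" j] by (meson leD leI)
    then show ?thesis using kk_less that by simp
  qed (use G_unstopped that in simp)
  have top: "(\<exists>y0 \<in> S \<inter> ball x (s k). b k y0 \<le> \<epsilon>) \<or> (\<forall>c\<in>p ` A. s k \<le> \<sigma> c)"
  proof (cases "\<exists>y0 \<in> S \<inter> ball x (s k). b k y0 \<le> \<epsilon>")
    case False
    have "s k \<le> \<sigma> c" if "c \<in> p ` A" for c
    proof -
      have ck: "\<epsilon> < b k c" using False P_E that by force
      then have "c \<notin> G" using G_unstopped[of c k] by auto
      then have c: "c \<in> I" "\<sigma> c = \<sigma>' c" using P_cases[OF that] by auto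
      have "stop c k" using ck by (simp add: stop_def)
      then have "kk c \<le> k" unfolding kk_def by (rule Least_le)
      then show ?thesis using c by (simp add: \<sigma>'_def s_antimono)
    qed
    then show ?thesis by blast
  qed blast
  have \<sigma>_nn: "0 \<le> \<sigma> c" for c using \<sigma>'_pos[of c] by (simp add: \<sigma>_def)
  obtain g :: "'a \<Rightarrow> real^'d" where g: "bi_lipschitz_on (center_const C) (p ` A) g" "\<And>c. c \<in> p ` A \<Longrightarrow> norm (g c) \<le> s k / 2"
    using centers[OF P_E \<sigma>_nn sep bud' top] by blast
  let ?l = "center_const C"
  have l: "1 \<le> ?l" using center_const_ge_5[of C] by linarith
  define F where "F u = g (p u) + (1 / (40 * ?l)) *\<^sub>R h (p u) u" for u
  have hu: "norm (h (p u) u) \<le> \<sigma> (p u)" if "u \<in> A" for u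
    using A_cases[OF that] f_norm[of "p u" u] \<sigma>'_pos[of "p u"] by (auto simp: h_def s_Suc \<sigma>'_def)
  have F: "bi_lipschitz_on (glue_const ?l L \<eta>) A F"
    unfolding F_def
  proof (rule bi_lipschitz_glue[where A=A and p=p and \<sigma>=\<sigma> and h=h and g=g, OF l L \<eta> _ _ _ _ _ g(1)])
    show "norm (h (p u) u) \<le> \<sigma> (p u)" if "u \<in> A" for u by (rule hu[OF that])
    show "(\<sigma> c + \<sigma> c') / 20 \<le> dist c c'" if "c \<in> p ` A" "c' \<in> p ` A" "c \<noteq> c'" for c c' by (rule sep[OF that])
  next
    fix u assume u: "u \<in> A"
    show "dist u (p u) \<le> \<sigma> (p u)"
      using A_cases[OF u]
    proof
      assume pu: "p u \<in> I \<and> u \<in> Ac (p u) \<and> \<sigma> (p u) = \<sigma>' (p u)"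
      then have "u \<in> Ec (p u)" using Ac(2) by blast
      then have "dist u (p u) \<le> \<rho> (p u)" by (auto simp: Ec_def dist_commute)
      then show ?thesis using \<rho>(2)[of "p u"] pu \<sigma>'_pos[of "p u"] by linarith
    qed (simp add: \<sigma>_nn)
  next
    fix c assume "c \<in> p ` A"
    show "bi_lipschitz_on L {u \<in> A. p u = c} (h c)"
    proof (cases "c \<in> I")
      case True
      have "{u \<in> A. p u = c} \<subseteq> Ac c" using A_cases True by fastforce
      then show ?thesis using f[OF True] True by (auto simp: bi_lipschitz_on_def h_def)
    next
      case False
      then have sub: "{u \<in> A. p u = c} \<subseteq> {c}" using A_cases by fastforce
      show ?thesis
        unfolding bi_lipschitz_on_def
      proof (intro ballI)
        fix u v assume "u \<in> {u \<in> A. p u = c}" "v \<in> {u \<in> A. p u = c}"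
        then have "u = c" "v = c" using sub by blast+
        then show "inverse L * dist u v \<le> dist (h c u) (h c v) \<and> dist (h c u) (h c v) \<le> L * dist u v" by simp
      qed
    qed
  next
    fix u v assume uv: "u \<in> A" "v \<in> A" "p u \<noteq> p v"
    have key: "\<eta> * max (\<sigma> (p u)) (\<sigma> (p v)) \<le> dist u v"
      if uv: "u \<in> A" "v \<in> A" "p u \<noteq> p v" "p u \<in> I" "p v \<in> I \<longrightarrow> before (p u) (p v)" for u v
    proof -
      let ?c = "p u"
      have u: "u \<in> Ec ?c" "\<sigma> ?c = \<sigma>' ?c" using A_cases[OF uv(1)] uv(4) Ac(2) by auto
      then have u1: "dist u ?c \<le> \<rho> ?c" "u \<notin> T ?c" using uv(4) by (auto simp: Ec_def TT_def dist_commute)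
      have v1: "\<rho> ?c < dist v ?c \<and> v \<notin> T ?c \<and> \<sigma> (p v) \<le> \<sigma>' ?c"
        using A_cases[OF uv(2)]
      proof
        assume "v \<in> G \<and> p v = v \<and> \<sigma> (p v) = 0 \<and> p v \<notin> I"
        then show ?thesis using uv(4) \<sigma>'_pos[of ?c] by (auto simp: G_def TT_def dist_commute not_le)
      next
        assume pv: "p v \<in> I \<and> v \<in> Ac (p v) \<and> \<sigma> (p v) = \<sigma>' (p v)"
        then have "v \<in> Ec (p v)" using Ac(2) by blast
        moreover have bf: "before ?c (p v)" using uv(5) pv by blast
        moreover have "\<sigma>' (p v) \<le> \<sigma>' ?c" using bf by (auto simp: before_def \<sigma>'_def intro!: s_antimono)
        ultimately show ?thesis using pv uv(4) by (auto simp: Ec_def TT_def dist_commute not_le)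
      qed
      have "\<eta> * \<sigma>' ?c \<le> \<bar>dist u ?c - \<rho> ?c\<bar>" "\<eta> * \<sigma>' ?c \<le> \<bar>dist v ?c - \<rho> ?c\<bar>" using u1(2) v1 by (auto simp: T_def)
      then have "\<eta> * \<sigma>' ?c \<le> dist v ?c - dist u ?c" using u1(1) v1 \<eta> \<sigma>'_pos[of ?c] by linarith
      also have "\<dots> \<le> dist u v" using dist_triangle[of v ?c u] by (simp add: dist_commute)
      finally show ?thesis using u v1 by (simp add: max_absorb1)
    qed
    show "\<eta> * max (\<sigma> (p u)) (\<sigma> (p v)) \<le> dist u v"
    proof (cases "p u \<in> I")
      case True
      show ?thesis
      proof (cases "p v \<in> I \<longrightarrow> before (p u) (p v)")
        case True
        then show ?thesis using key[OF uv \<open>p u \<in> I\<close>] by blast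
      next
        case False
        then have "p v \<in> I" "before (p v) (p u)" using before_total[OF \<open>p u \<in> I\<close>, of "p v"] uv(3) by auto
        then show ?thesis using key[of v u] uv by (simp add: dist_commute max.commute)
      qed
    next
      case False
      show ?thesis
      proof (cases "p v \<in> I")
        case True
        then show ?thesis using key[of v u] uv False by (simp add: dist_commute max.commute)
      next
        case False
        then show ?thesis using A_cases[OF uv(1)] A_cases[OF uv(2)] \<open>p u \<notin> I\<close> by auto
      qed
    qed
  qed
  have F_norm: "norm (F u) \<le> s k" if "u \<in> A" for u
  proof -
    have "\<sigma> (p u) \<le> s k" using P_cases[of "p u"] that \<sigma>'_le I(2) s_pos[of k] by (auto simp: less_imp_le)
    then have hk: "norm (h (p u) u) \<le> s k" using hu[OF that] by linarith
    have "norm ((1 / (40 * ?l)) *\<^sub>R h (p u) u) \<le> (1 / 2) * s k"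
      unfolding norm_scaleR using hk l s_pos[of k] by (intro mult_mono) (auto simp: divide_le_eq)
    then show ?thesis
      using g(2)[of "p u"] that norm_triangle_ineq[of "g (p u)" "(1 / (40 * ?l)) *\<^sub>R h (p u) u"] by (simp add: F_def)
  qed
  have loss: "E - A \<subseteq> (\<Union>c\<in>I. T c) \<union> (\<Union>c\<in>I. Ec c - Ac c)"
  proof
    fix u assume u: "u \<in> E - A"
    show "u \<in> (\<Union>c\<in>I. T c) \<union> (\<Union>c\<in>I. Ec c - Ac c)"
    proof (cases "u \<in> TT")
      case False
      then obtain c0 where c0: "c0 \<in> {c \<in> I. u \<in> cball c (\<rho> c)}" using u by (auto simp: A_def G_def)
      have wf: "wf (inv_image (less_than <*lex*> less_than) (\<lambda>c. (kk c, e c)))" by (intro wf_inv_image wf_lex_prod wf_less_than)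
      obtain c where c: "c \<in> {c \<in> I. u \<in> cball c (\<rho> c)}"
        and min: "\<And>c'. (c', c) \<in> inv_image (less_than <*lex*> less_than) (\<lambda>c. (kk c, e c)) \<Longrightarrow> c' \<notin> {c \<in> I. u \<in> cball c (\<rho> c)}"
        using wf c0 by (rule wfE_min) (rule that)
      have "c' \<notin> {c \<in> I. u \<in> cball c (\<rho> c)}" if "before c' c" for c'
        using min[of c'] that by (simp add: before_def)
      then have "u \<in> Ec c" using c u False by (auto simp: Ec_def)
      moreover have "u \<notin> Ac c" using u c by (auto simp: A_def)
      ultimately show ?thesis using c by auto
    qed (simp add: TT_def)
  qed
  define \<kappa> where "\<kappa> = \<tau> / (2 * C ^ 6) * C ^ 5"
  have \<kappa>: "0 \<le> \<kappa>" using \<tau> C_ge_1 by (simp add: \<kappa>_def)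
  have disj': "pairwise (\<lambda>c c'. disjnt (ball c (\<sigma>' c / 20)) (ball c' (\<sigma>' c' / 20))) I"
    using disj ball_subset_cball unfolding pairwise_def by (meson disjnt_subset1 disjnt_subset2)
  have sub: "ball c (\<sigma>' c / 20) \<subseteq> ball x (2 * s k)" if "c \<in> I" for c
    unfolding \<sigma>'_def using small_ball_measure(1)[of c x k "kk c"] St_S St_k that I(2) by blast
  have Tf: "T c \<in> fmeasurable \<mu>" if "c \<in> I" for c
  proof (rule fmeasurableI2[OF ball_fmeasurable])
    show "T c \<subseteq> ball c (\<rho> c + \<eta> * \<sigma>' c)" by (auto simp: T_def dist_commute)
  qed (use T_open in auto)
  have Tm: "measure \<mu> (T c) \<le> \<kappa> * M c (\<sigma>' c / 20)" if "c \<in> I" for c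
  proof -
    have "measure \<mu> (T c) \<le> \<tau> / (2 * C ^ 6) * M c (\<sigma>' c)" using \<rho>_shell[OF that] by (simp add: T_def mult.commute)
    also have "\<dots> \<le> \<tau> / (2 * C ^ 6) * (C ^ 5 * M c (\<sigma>' c / 20))"
      unfolding \<sigma>'_def using small_ball_measure(2)[of c x k "kk c"] St_S St_k that I(2) \<tau> C6
      by (intro mult_left_mono) auto
    finally show ?thesis by (simp add: \<kappa>_def mult.assoc)
  qed
  have Af: "Ec c - Ac c \<in> fmeasurable \<mu>" if "c \<in> I" for c
    using Ec_sub[OF that] Ec_meas Ac(1)[OF that] by (intro fmeasurableI2[OF ball_fmeasurable[of c "s (Suc (kk c))"]]) auto
  have Am: "measure \<mu> (Ec c - Ac c) \<le> \<kappa> * M c (\<sigma>' c / 20)" if "c \<in> I" for c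
  proof -
    have "measure \<mu> (Ec c - Ac c) \<le> \<tau> / (2 * C ^ 6) * M c (s (Suc (kk c)))" by (rule Ac_loss[OF that])
    also have "\<dots> \<le> \<tau> / (2 * C ^ 6) * (C ^ 5 * M c (\<sigma>' c / 20))"
      unfolding \<sigma>'_def using small_ball_measure(3)[of c x k "kk c"] St_S St_k that I(2) \<tau> C6
      by (intro mult_left_mono) auto
    finally show ?thesis by (simp add: \<kappa>_def mult.assoc)
  qed
  note T_tot = disjoint_family_measure_bound[OF I(1) Tf ball_fmeasurable disj' sub ball_fmeasurable \<kappa> Tm]
  note A_tot = disjoint_family_measure_bound[OF I(1) Af ball_fmeasurable disj' sub ball_fmeasurable \<kappa> Am]
  have "measure \<mu> (E - A) \<le> measure \<mu> ((\<Union>c\<in>I. T c) \<union> (\<Union>c\<in>I. Ec c - Ac c))"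
    using loss E(1) A_meas T_tot(1) A_tot(1) by (intro measure_mono_fmeasurable) auto
  also have "\<dots> \<le> measure \<mu> (\<Union>c\<in>I. T c) + measure \<mu> (\<Union>c\<in>I. Ec c - Ac c)"
    using T_tot(1) A_tot(1) by (intro measure_Un_le) auto
  also have "\<dots> \<le> 2 * (\<kappa> * M x (2 * s k))" using T_tot(2) A_tot(2) by linarith
  also have "\<dots> \<le> 2 * (\<kappa> * (C * M x (s k)))"
    using M_double[OF x s_pos[of k]] \<kappa> by (intro mult_left_mono) auto
  also have "\<dots> = \<tau> * M x (s k)" using C6 C_ge_1 by (simp add: \<kappa>_def field_simps flip: power_Suc2 power_Suc)
  finally have "measure \<mu> (E - A) \<le> \<tau> * M x (s k)" .
  then show ?thesis using A_meas A_sub F F_norm unfolding \<eta>_def by blast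
qed

lemma big_piece:
  assumes "x \<in> S" "E \<in> sets borel" "E \<subseteq> S \<inter> ball x (s k)" "0 < \<tau>"
    and "\<And>y n. y \<in> E \<Longrightarrow> (\<Sum>i\<in>{k..<n}. a i y) \<le> real N * \<epsilon>"
  shows "\<exists>A\<in>sets borel. A \<subseteq> E \<and> measure \<mu> (E - A) \<le> \<tau> * M x (s k) \<and>
     (\<exists>f :: 'a \<Rightarrow> real^'d. bi_lipschitz_on (lip_const C N \<tau>) A f \<and> (\<forall>u\<in>A. norm (f u) \<le> s k))"
  using assms
proof (induction N arbitrary: x E k \<tau>)
  case 0
  have "E = {}"
  proof (rule ccontr)
    assume "E \<noteq> {}"
    then obtain y where y: "y \<in> E" by auto
    then have "0 < a k y" using 0(3) by (intro a_pos) auto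
    then show False using 0(5)[OF y, of "Suc k"] by simp
  qed
  then show ?case using 0 by (auto simp: bi_lipschitz_on_def intro!: bexI[of _ "{}"])
next
  case (Suc N)
  show ?case unfolding lip_const.simps
  proof (rule recursion_step[OF Suc.prems(1-4) Suc.prems(5) _ lip_const_ge_1])
    fix c E' j assume "c \<in> S" "E' \<in> sets borel" "E' \<subseteq> S \<inter> ball c (s j)"
      "\<And>y n. y \<in> E' \<Longrightarrow> (\<Sum>i\<in>{j..<n}. a i y) \<le> real N * \<epsilon>"
    then show "\<exists>A\<in>sets borel. A \<subseteq> E' \<and> measure \<mu> (E' - A) \<le> \<tau> / (2 * C ^ 6) * M c (s j) \<and>
          (\<exists>f :: 'a \<Rightarrow> real^'d. bi_lipschitz_on (lip_const C N (\<tau> / (2 * C ^ 6))) A f \<and> (\<forall>u\<in>A. norm (f u) \<le> s j))"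
      using Suc.prems(4) C_ge_1 by (intro Suc.IH) auto
  qed
qed

end

section \<open>Density and Hausdorff measure\<close>

context flat_scales begin

definition ratio_const :: real where
  "ratio_const = 32 * C ^ 4 * 8 ^ d * 4 ^ (d + 1)"

definition growth_const :: real where
  "growth_const = 2 * C * K * mass_const d + ln (ratio_const ^ 2 * 2 ^ d * C) / \<epsilon>"

definition density_const :: "real \<Rightarrow> real" where
  "density_const R = ratio_const ^ 2 * exp (2 * growth_const * R)"

lemma ratio_const_ge:
  "32 * C ^ 4 * 8 ^ d \<le> ratio_const" "4 ^ (d + 1) * C ^ 3 \<le> ratio_const" "1 \<le> ratio_const"
proof -
  have C: "1 \<le> C ^ 4" "C ^ 3 \<le> C ^ 4" "C \<le> C ^ 4"
    using C_ge_1 one_le_power[of C 4] power_increasing[of 3 4 C] power_increasing[of 1 4 C] by auto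
  have p: "1 \<le> (8::real) ^ d" "1 \<le> (4::real) ^ (d + 1)" by (rule one_le_power; simp)+
  have "32 * C ^ 4 * 8 ^ d * 1 \<le> 32 * C ^ 4 * 8 ^ d * 4 ^ (d + 1)"
    using p C by (intro mult_left_mono) auto
  then show 1: "32 * C ^ 4 * 8 ^ d \<le> ratio_const" by (simp add: ratio_const_def)
  have "1 * C ^ 3 * 1 * 4 ^ (d + 1) \<le> 32 * C ^ 4 * 8 ^ d * 4 ^ (d + 1)"
    using p C C_ge_1 by (intro mult_mono mult_nonneg_nonneg) auto
  then show "4 ^ (d + 1) * C ^ 3 \<le> ratio_const" by (simp add: ratio_const_def mult.commute)
  have "1 * C ^ 4 * 1 \<le> 32 * C ^ 4 * 8 ^ d" using p C by (intro mult_mono) auto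
  then show "1 \<le> ratio_const" using 1 C by linarith
qed

lemma growth_arg_ge: "1 \<le> ratio_const ^ 2 * 2 ^ d * C"
  "ratio_const ^ 2 * 2 ^ d \<le> ratio_const ^ 2 * 2 ^ d * C" "ratio_const ^ 2 * C \<le> ratio_const ^ 2 * 2 ^ d * C"
proof -
  have r: "1 \<le> ratio_const ^ 2" using ratio_const_ge(3) by (rule one_le_power)
  have t: "1 \<le> (2::real) ^ d" by simp
  have "ratio_const ^ 2 * 1 * 1 \<le> ratio_const ^ 2 * 2 ^ d * C" using r t C_ge_1 by (intro mult_mono) auto
  then show "1 \<le> ratio_const ^ 2 * 2 ^ d * C" using r by auto
  have "ratio_const ^ 2 * 2 ^ d * 1 \<le> ratio_const ^ 2 * 2 ^ d * C" using r t C_ge_1 by (intro mult_left_mono) auto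
  then show "ratio_const ^ 2 * 2 ^ d \<le> ratio_const ^ 2 * 2 ^ d * C" by simp
  have "ratio_const ^ 2 * 1 * C \<le> ratio_const ^ 2 * 2 ^ d * C" using r t C_ge_1 by (intro mult_mono) auto
  then show "ratio_const ^ 2 * C \<le> ratio_const ^ 2 * 2 ^ d * C" by simp
qed

lemma growth_const_nonneg: "0 \<le> growth_const"
  using growth_arg_ge(1) \<epsilon>_bounds(1) C_ge_1 K_ge_1 mass_const_ge_1[of d]
  unfolding growth_const_def by (intro add_nonneg_nonneg mult_nonneg_nonneg divide_nonneg_pos ln_ge_zero) auto

lemma flat_density:
  fixes \<phi> :: "real^'d \<Rightarrow> 'a"
  assumes y: "y \<in> S" and fl: "flat \<mu> y (8 * s k) \<phi> m \<delta>" and \<delta>: "\<delta> < 1 / (32 * C ^ 4)"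
  shows "M y (s k) / s k ^ d \<le> ratio_const * m" "m \<le> ratio_const * (M y (s k) / s k ^ d)" "0 < m"
proof -
  have s0: "0 < s k" by (rule s_pos)
  obtain p where m: "m > 0" and 1: "M y (8 * s k) \<le> 32 * C ^ 4 * (m * (8 * s k) ^ d)"
    and 2: "m * (8 * s k) ^ d \<le> 4 ^ (d + 1) * M y (8 * s k)"
    using flat_center[OF y _ fl \<delta>] s0 unfolding d_eq by auto
  have "M y (s k) \<le> M y (8 * s k)" using s0 by (intro M_mono subset_ball) auto
  then have "M y (s k) / s k ^ d \<le> 32 * C ^ 4 * 8 ^ d * m"
    using 1 s0 by (simp add: divide_le_eq power_mult_distrib ac_simps)
  also have "\<dots> \<le> ratio_const * m" using ratio_const_ge(1) m by (intro mult_right_mono) auto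
  finally show "M y (s k) / s k ^ d \<le> ratio_const * m" .
  have "M y (8 * s k) \<le> C ^ 3 * M y (s k)" using M_double_pow[OF y s0, of 3] by simp
  then have "4 ^ (d + 1) * M y (8 * s k) \<le> 4 ^ (d + 1) * (C ^ 3 * M y (s k))" by (intro mult_left_mono) auto
  moreover have "m * s k ^ d \<le> m * (8 * s k) ^ d" using m s0 by (intro mult_left_mono power_mono) auto
  ultimately have "m * s k ^ d \<le> 4 ^ (d + 1) * C ^ 3 * M y (s k)" using 2 unfolding mult.assoc by linarith
  also have "\<dots> \<le> ratio_const * M y (s k)" using ratio_const_ge(2) by (intro mult_right_mono) auto
  finally show "m \<le> ratio_const * (M y (s k) / s k ^ d)" using s0 by (simp add: le_divide_eq)
  show "0 < m" by (rule m)
qed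

lemma exp_growth:
  fixes x m m' :: real
  assumes "0 \<le> x" "\<bar>m - m'\<bar> \<le> x * m" "0 < m"
  shows "m' \<le> exp x * m"
proof -
  have "m' \<le> (1 + x) * m" using abs_le_D2[OF assms(2)] unfolding distrib_right by linarith
  also have "\<dots> \<le> exp x * m" using assms(3) exp_ge_add_one_self[of x] by (intro mult_right_mono) auto
  finally show ?thesis .
qed

lemma density_bound:
  assumes y: "y \<in> S" and bud: "\<And>n. (\<Sum>i<n. a i y) \<le> R"
  shows "M y (s n) / s n ^ d \<le> density_const R * (M y (s 0) / s 0 ^ d)"
    and "M y (s 0) / s 0 ^ d \<le> density_const R * (M y (s n) / s n ^ d)"
proof -
  define \<Theta> where "\<Theta> k = M y (s k) / s k ^ d" for k
  define good where "good k \<longleftrightarrow> b k y \<le> \<epsilon>" for k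
  have D: "D \<ge> 192" by (rule flat_const_ge)
  have C0: "C > 0" using C_ge_1 by simp
  have bn: "0 \<le> b k y" for k by (rule b_nonneg[OF y])
  have \<Theta>_pos: "0 < \<Theta> k" for k using M_pos[OF y s_pos] s_pos by (simp add: \<Theta>_def)
  have "\<forall>k. \<exists>\<phi> m. good k \<longrightarrow> flat \<mu> y (8 * s k) (\<phi> :: real^'d \<Rightarrow> 'a) m (K * b k y)"
    using b_flat_s[OF y] \<epsilon>_bounds(2) unfolding good_def by (meson le_less_trans)
  then obtain \<phi> m where fl: "\<And>k. good k \<Longrightarrow> flat \<mu> y (8 * s k) (\<phi> k :: real^'d \<Rightarrow> 'a) (m k) (K * b k y)" by metis
  have Kb: "K * b k y \<le> K * \<epsilon>" if "good k" for k using that K_ge_1 by (simp add: good_def)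
  have Kb_small: "K * b k y \<le> 1 / (8 * D)" if "good k" for k using Kb[OF that] \<epsilon>_bounds(4) by linarith
  have Kb_small': "2 * C * (K * b k y) \<le> 1 / (8 * D)" if "good k" for k
    using mult_left_mono[OF Kb[OF that], of "2 * C"] \<epsilon>_bounds(5) C0 by linarith
  note gd = flat_density[OF y fl flat_const_small[OF Kb_small], folded \<Theta>_def]
  txt \<open>At good scales the masses \<open>m\<close> of the planes, unlike the densities \<open>\<Theta>\<close>, have consecutive ratios
    that tend to 1 with the flatness.\<close>
  define \<Phi> where "\<Phi> k = (if good k then m k else \<Theta> k)" for k
  have \<Phi>: "\<Theta> k \<le> ratio_const * \<Phi> k" "\<Phi> k \<le> ratio_const * \<Theta> k" "0 < \<Phi> k" for k
    using gd[of k] \<Theta>_pos[of k] ratio_const_ge(3) mult_right_mono[OF ratio_const_ge(3), of "\<Theta> k"]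
    by (auto simp: \<Phi>_def)
  have \<Theta>_step: "\<Theta> (Suc k) \<le> 2 ^ d * \<Theta> k" "\<Theta> k \<le> C * \<Theta> (Suc k)" for k
  proof -
    have s0: "0 < s k" by (rule s_pos)
    have "M y (s (Suc k)) \<le> M y (s k)" using s0 by (intro M_mono subset_ball) (simp add: s_Suc)
    then show "\<Theta> (Suc k) \<le> 2 ^ d * \<Theta> k" using s0 by (simp add: \<Theta>_def s_Suc power_divide field_simps)
    have "M y (s k) \<le> C * M y (s (Suc k))" using M_double[OF y, of "s (Suc k)"] s_pos[of "Suc k"] by (simp add: s_Suc)
    then have "\<Theta> k \<le> C * M y (s (Suc k)) / s k ^ d" unfolding \<Theta>_def using s0 by (intro divide_right_mono) auto
    also have "\<dots> \<le> C * M y (s (Suc k)) / s (Suc k) ^ d"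
      using s0 C0 by (intro divide_left_mono power_mono mult_pos_pos) (auto simp: s_Suc)
    finally show "\<Theta> k \<le> C * \<Theta> (Suc k)" by (simp add: \<Theta>_def)
  qed
  have step: "\<Phi> (Suc k) \<le> exp (growth_const * (b k y + b (Suc k) y)) * \<Phi> k \<and>
      \<Phi> k \<le> exp (growth_const * (b k y + b (Suc k) y)) * \<Phi> (Suc k)" for k
  proof (cases "good k \<and> good (Suc k)")
    case True
    define x where "x = mass_const d * (2 * C * (K * b k y) + K * b (Suc k) y)"
    have fl1: "flat \<mu> y (8 * s (Suc k)) (\<phi> k) (m k) (2 * C * (K * b k y))"
      using True bn K_ge_1 by (intro flat_halve[OF y fl]) auto
    have fl2: "flat \<mu> y (8 * s (Suc k)) (\<phi> (Suc k)) (m (Suc k)) (K * b (Suc k) y)" using True by (intro fl) auto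
    have s8: "0 < 8 * s (Suc k)" using s_pos[of "Suc k"] by simp
    have 1: "\<bar>m k - m (Suc k)\<bar> \<le> x * m k"
      using flat_cmp(2)[OF y s8 fl1 fl2 Kb_small' Kb_small] True by (simp add: x_def)
    have 2: "\<bar>m (Suc k) - m k\<bar> \<le> x * m (Suc k)"
      using flat_cmp(2)[OF y s8 fl2 fl1 Kb_small Kb_small'] True by (simp add: x_def add.commute)
    have x0: "0 \<le> x" using bn K_ge_1 C0 mass_const_ge_1[of d] by (auto simp: x_def)
    have "x \<le> growth_const * (b k y + b (Suc k) y)"
    proof -
      have "1 * (K * b (Suc k) y) \<le> 2 * C * (K * b (Suc k) y)"
        using bn K_ge_1 C_ge_1 by (intro mult_right_mono) auto
      then have "x \<le> mass_const d * (2 * C * (K * b k y) + 2 * C * (K * b (Suc k) y))"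
        unfolding x_def using mass_const_ge_1[of d] by (intro mult_left_mono) auto
      also have "\<dots> = 2 * C * K * mass_const d * (b k y + b (Suc k) y)" by (simp add: algebra_simps)
      also have "\<dots> \<le> growth_const * (b k y + b (Suc k) y)"
        using bn growth_arg_ge(1) \<epsilon>_bounds(1) unfolding growth_const_def by (intro mult_right_mono) auto
      finally show ?thesis .
    qed
    then have ex: "exp x \<le> exp (growth_const * (b k y + b (Suc k) y))" by simp
    have mp: "0 < m k" "0 < m (Suc k)" using \<Phi>(3)[of k] \<Phi>(3)[of "Suc k"] True by (auto simp: \<Phi>_def)
    have "m (Suc k) \<le> exp (growth_const * (b k y + b (Suc k) y)) * m k"
      by (rule order_trans[OF exp_growth[OF x0 1 mp(1)] mult_right_mono[OF ex]]) (use mp in simp)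
    moreover have "m k \<le> exp (growth_const * (b k y + b (Suc k) y)) * m (Suc k)"
      by (rule order_trans[OF exp_growth[OF x0 2 mp(2)] mult_right_mono[OF ex]]) (use mp in simp)
    ultimately show ?thesis using True by (simp add: \<Phi>_def)
  next
    case False
    then have "\<epsilon> \<le> b k y + b (Suc k) y" using bn[of k] bn[of "Suc k"] by (auto simp: good_def)
    let ?R = "ratio_const ^ 2 * 2 ^ d * C"
    have "ln ?R \<le> growth_const * (b k y + b (Suc k) y)"
    proof -
      have "ln ?R = ln ?R / \<epsilon> * \<epsilon>" using \<epsilon>_bounds(1) by simp
      also have "\<dots> \<le> growth_const * \<epsilon>"
        unfolding growth_const_def using \<epsilon>_bounds(1) C0 K_ge_1 mass_const_ge_1[of d] by (intro mult_right_mono) auto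
      also have "\<dots> \<le> growth_const * (b k y + b (Suc k) y)"
        using \<open>\<epsilon> \<le> _\<close> growth_const_nonneg by (intro mult_left_mono)
      finally show ?thesis .
    qed
    then have "exp (ln ?R) \<le> exp (growth_const * (b k y + b (Suc k) y))" by simp
    moreover have "0 < ?R" using growth_arg_ge(1) by linarith
    ultimately have R: "?R \<le> exp (growth_const * (b k y + b (Suc k) y))" by (simp only: exp_ln)
    have q: "0 < ratio_const" using ratio_const_ge(3) by linarith
    have "\<Theta> (Suc k) \<le> 2 ^ d * (ratio_const * \<Phi> k)"
      by (rule order_trans[OF \<Theta>_step(1) mult_left_mono[OF \<Phi>(1)]]) simp
    then have "\<Phi> (Suc k) \<le> ratio_const * (2 ^ d * (ratio_const * \<Phi> k))"
      by (intro order_trans[OF \<Phi>(2) mult_left_mono]) (use q in simp_all)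
    also have "\<dots> = (ratio_const ^ 2 * 2 ^ d) * \<Phi> k" by (simp add: power2_eq_square)
    also have "\<dots> \<le> exp (growth_const * (b k y + b (Suc k) y)) * \<Phi> k"
      using growth_arg_ge(2) R \<Phi>(3)[of k] by (intro mult_right_mono) auto
    finally have 1: "\<Phi> (Suc k) \<le> exp (growth_const * (b k y + b (Suc k) y)) * \<Phi> k" .
    have "\<Theta> k \<le> C * (ratio_const * \<Phi> (Suc k))"
      by (rule order_trans[OF \<Theta>_step(2) mult_left_mono[OF \<Phi>(1)]]) (use C0 in simp)
    then have "\<Phi> k \<le> ratio_const * (C * (ratio_const * \<Phi> (Suc k)))"
      by (intro order_trans[OF \<Phi>(2) mult_left_mono]) (use q in simp_all)
    also have "\<dots> = (ratio_const ^ 2 * C) * \<Phi> (Suc k)" by (simp add: power2_eq_square)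
    also have "\<dots> \<le> exp (growth_const * (b k y + b (Suc k) y)) * \<Phi> (Suc k)"
      using growth_arg_ge(3) R \<Phi>(3)[of "Suc k"] by (intro mult_right_mono) auto
    finally show ?thesis using 1 by simp
  qed
  have b_le: "b k y \<le> a k y" for k using s_pos[of k] by (intro b_le_a_s y) auto
  define B where "B n = growth_const * ((\<Sum>i<n. b i y) + (\<Sum>i<n. b (Suc i) y))" for n
  have tel: "\<Phi> n \<le> exp (B n) * \<Phi> 0 \<and> \<Phi> 0 \<le> exp (B n) * \<Phi> n" for n
  proof (induction n)
    case (Suc n)
    let ?g = "growth_const * (b n y + b (Suc n) y)"
    have e: "exp (B (Suc n)) = exp ?g * exp (B n)" by (simp add: B_def exp_add[symmetric] algebra_simps)
    have "\<Phi> (Suc n) \<le> exp ?g * (exp (B n) * \<Phi> 0)"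
      by (rule order_trans[OF conjunct1[OF step]]) (use Suc in \<open>intro mult_left_mono, auto\<close>)
    moreover have "\<Phi> 0 \<le> exp (B n) * (exp ?g * \<Phi> (Suc n))"
      by (rule order_trans[OF conjunct2[OF Suc]]) (use step[of n] in \<open>intro mult_left_mono, auto\<close>)
    ultimately show ?case unfolding e by (simp add: ac_simps)
  qed (simp add: B_def)
  have "(\<Sum>i<n. b i y) \<le> R"
    by (rule order_trans[OF sum_mono bud[of n]]) (rule b_le)
  moreover have "(\<Sum>i<n. b (Suc i) y) \<le> R"
  proof -
    have "(\<Sum>i<n. b (Suc i) y) \<le> (\<Sum>i<Suc n. b i y)"
      by (subst sum.lessThan_Suc_shift) (use bn in simp)
    also have "\<dots> \<le> R" by (rule order_trans[OF sum_mono bud[of "Suc n"]]) (rule b_le)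
    finally show ?thesis .
  qed
  ultimately have "B n \<le> growth_const * (R + R)"
    unfolding B_def using growth_const_nonneg by (intro mult_left_mono add_mono)
  then have eB: "exp (B n) \<le> exp (2 * growth_const * R)" by (simp add: algebra_simps)
  have q: "0 < ratio_const" using ratio_const_ge(3) by linarith
  have *: "\<Theta> i \<le> density_const R * \<Theta> j" if "\<Phi> i \<le> exp (B n) * \<Phi> j" for i j
  proof -
    have "\<Theta> i \<le> ratio_const * (exp (B n) * (ratio_const * \<Theta> j))"
      by (rule order_trans[OF \<Phi>(1)]) (use q that \<Phi>(2)[of j] in \<open>intro mult_left_mono order_trans[OF that], auto\<close>)
    also have "\<dots> = ratio_const ^ 2 * exp (B n) * \<Theta> j" by (simp add: power2_eq_square)
    also have "\<dots> \<le> density_const R * \<Theta> j"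
      unfolding density_const_def using eB \<Theta>_pos[of j] by (intro mult_right_mono mult_left_mono) auto
    finally show ?thesis .
  qed
  show "M y (s n) / s n ^ d \<le> density_const R * (M y (s 0) / s 0 ^ d)"
    "M y (s 0) / s 0 ^ d \<le> density_const R * (M y (s n) / s n ^ d)"
    using *[OF conjunct1[OF tel[of n]]] *[OF conjunct2[OF tel[of n]]] by (simp_all add: \<Theta>_def)
qed

end

context doubling_radon begin

lemma emeasure_le_hausdorff_outer:
  assumes r: "r > 0" and d: "d > 0" and W: "W > 0" and Z: "Z \<in> sets borel"
    and dens: "\<And>y k. y \<in> Z \<Longrightarrow> M y (r / 2 ^ k) \<le> W * (r / 2 ^ k) ^ d"
  shows "emeasure \<mu> Z \<le> ennreal (W * 2 ^ d) * hausdorff_outer d Z"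
proof -
  have single: "emeasure \<mu> {y} = 0" if y: "y \<in> Z" for y
  proof -
    have "emeasure \<mu> {y} \<le> ennreal (W * (r / 2 ^ k) ^ d)" for k
    proof -
      have "emeasure \<mu> {y} \<le> emeasure \<mu> (ball y (r / 2 ^ k))" using r by (intro emeasure_mono) auto
      then show ?thesis using dens[OF y, of k] by (simp add: emeasure_ball_eq order_trans[OF _ ennreal_leI])
    qed
    moreover have "(\<lambda>k. ennreal (W * (r / 2 ^ k) ^ d)) \<longlonglongrightarrow> ennreal (W * 0 ^ d)"
    proof (intro tendsto_ennrealI tendsto_mult tendsto_power tendsto_const)
      show "(\<lambda>k. r / 2 ^ k) \<longlonglongrightarrow> 0" using LIMSEQ_divide_realpow_zero[of 2 r] by simp
    qed
    ultimately have "emeasure \<mu> {y} \<le> ennreal (W * 0 ^ d)" by (intro LIMSEQ_le_const) auto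
    then show ?thesis using d by (simp add: power_0_left)
  qed
  have "emeasure \<mu> Z \<le> ennreal (W * 2 ^ d) * hausdorff_content d (r / 2) Z"
  proof -
    have "emeasure \<mu> Z \<le> ennreal (W * 2 ^ d) * (\<Sum>i. ennreal (diameter (U i) ^ d))"
      if U: "Z \<subseteq> (\<Union>i. U i)" "\<And>i. bounded (U i)" "\<And>i. diameter (U i) \<le> r / 2" for U :: "nat \<Rightarrow> 'a set"
    proof -
      have "\<exists>V. V \<in> sets borel \<and> Z \<inter> U i \<subseteq> V \<and> emeasure \<mu> V \<le> ennreal (W * 2 ^ d) * ennreal (diameter (U i) ^ d)" for i
      proof (cases "Z \<inter> U i = {}")
        case False
        then obtain y where y: "y \<in> Z" "y \<in> U i" by auto
        let ?\<delta> = "diameter (U i)"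
        have sub: "dist y z \<le> ?\<delta>" if "z \<in> U i" for z using diameter_bounded_bound[OF U(2) y(2) that] .
        have \<delta>0: "0 \<le> ?\<delta>" by (rule diameter_ge_0[OF U(2)])
        show ?thesis
        proof (cases "?\<delta> = 0")
          case True
          have "Z \<inter> U i \<subseteq> {y}" using sub True by force
          then show ?thesis using single[OF y(1)] by (intro exI[of _ "{y}"]) auto
        next
          case False
          with \<delta>0 have \<delta>: "0 < ?\<delta>" by simp
          define k where "k = (LEAST k. r / 2 ^ k \<le> ?\<delta>)"
          obtain n where "(1 / 2) ^ n < ?\<delta> / r" using real_arch_pow_inv[of "?\<delta> / r" "1 / 2"] \<delta> r by auto
          then have "r / 2 ^ n \<le> ?\<delta>" using r by (simp add: power_one_over field_simps)
          then have k: "r / 2 ^ k \<le> ?\<delta>" unfolding k_def by (rule LeastI)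
          have "k \<noteq> 0" using k U(3)[of i] r by (intro notI) simp
          then obtain j where j: "k = Suc j" by (cases k) auto
          have lj: "?\<delta> < r / 2 ^ j" using not_less_Least[of j "\<lambda>k. r / 2 ^ k \<le> ?\<delta>"] j by (simp add: k_def not_le)
          have "r / 2 ^ j \<le> 2 * ?\<delta>" using k j by simp
          then have "M y (r / 2 ^ j) \<le> W * (2 * ?\<delta>) ^ d"
            using r W by (intro order_trans[OF dens[OF y(1)]] mult_left_mono power_mono) auto
          then have "emeasure \<mu> (ball y (r / 2 ^ j)) \<le> ennreal (W * 2 ^ d) * ennreal (?\<delta> ^ d)"
            using W \<delta>0 by (simp add: emeasure_ball_eq ennreal_mult[symmetric] power_mult_distrib ac_simps ennreal_leI)
          moreover have "Z \<inter> U i \<subseteq> ball y (r / 2 ^ j)" using sub lj by (force intro: le_less_trans)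
          ultimately show ?thesis by (intro exI[of _ "ball y (r / 2 ^ j)"]) auto
        qed
      qed (auto intro!: exI[of _ "{}"])
      then obtain V where V: "\<And>i. V i \<in> sets borel" "\<And>i. Z \<inter> U i \<subseteq> V i"
        "\<And>i. emeasure \<mu> (V i) \<le> ennreal (W * 2 ^ d) * ennreal (diameter (U i) ^ d)" by metis
      have "emeasure \<mu> Z \<le> emeasure \<mu> (\<Union>i. V i)"
      proof (rule emeasure_mono)
        show "Z \<subseteq> (\<Union>i. V i)" using U(1) V(2) by blast
      qed (use V(1) in auto)
      also have "\<dots> \<le> (\<Sum>i. emeasure \<mu> (V i))" using V(1) by (intro emeasure_subadditive_countably) auto
      also have "\<dots> \<le> (\<Sum>i. ennreal (W * 2 ^ d) * ennreal (diameter (U i) ^ d))" using V(3) by (intro suminf_le) auto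
      finally show ?thesis by simp
    qed
    then have key: "emeasure \<mu> Z \<le> ennreal (W * 2 ^ d) * (\<Sum>i. ennreal (diameter (U i) ^ d))"
      if "U \<in> {U. Z \<subseteq> (\<Union>i. U i) \<and> (\<forall>i. bounded (U i) \<and> diameter (U i) \<le> r / 2)}" for U :: "nat \<Rightarrow> 'a set"
      using that by blast
    show ?thesis
    proof (rule ennreal_le_mult_iff_inverse)
      show "ennreal (1 / (W * 2 ^ d)) * emeasure \<mu> Z \<le> hausdorff_content d (r / 2) Z"
        unfolding hausdorff_content_def
      proof (rule INF_greatest)
        fix U :: "nat \<Rightarrow> 'a set"
        assume "U \<in> {U. Z \<subseteq> (\<Union>i. U i) \<and> (\<forall>i. bounded (U i) \<and> diameter (U i) \<le> r / 2)}"
        from mult_left_mono[OF key[OF this], of "ennreal (1 / (W * 2 ^ d))"]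
        show "ennreal (1 / (W * 2 ^ d)) * emeasure \<mu> Z \<le> (\<Sum>i. ennreal (diameter (U i) ^ d))"
          using W by (simp add: mult.assoc[symmetric] ennreal_mult[symmetric])
      qed
    qed (use W in simp)
  qed
  also have "\<dots> \<le> ennreal (W * 2 ^ d) * hausdorff_outer d Z"
    using r by (intro mult_left_mono hausdorff_content_le_outer) auto
  finally show ?thesis .
qed

lemma open_superset_measure:
  assumes Z: "Z \<in> sets borel" "Z \<subseteq> ball x R" and e: "e > 0"
  shows "\<exists>U. open U \<and> Z \<subseteq> U \<and> U \<subseteq> ball x R \<and> emeasure \<mu> U \<le> emeasure \<mu> Z + ennreal e"
proof -
  define \<nu> where "\<nu> = density \<mu> (indicator (ball x R))"
  have em: "emeasure \<nu> A = emeasure \<mu> (A \<inter> ball x R)" if "A \<in> sets borel" for A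
  proof -
    have "emeasure \<nu> A = (\<integral>\<^sup>+y. indicator (ball x R) y * indicator A y \<partial>\<mu>)"
      unfolding \<nu>_def using that by (intro emeasure_density borel_measurable_indicator) auto
    also have "\<dots> = (\<integral>\<^sup>+y. indicator (A \<inter> ball x R) y \<partial>\<mu>)"
      by (rule nn_integral_cong) (auto split: split_indicator)
    finally show ?thesis using that by (subst (asm) nn_integral_indicator) auto
  qed
  have "emeasure \<nu> Z = (INF U \<in> {U. Z \<subseteq> U \<and> open U}. emeasure \<nu> U)"
  proof (rule outer_regular)
    show "emeasure \<nu> (space \<nu>) \<noteq> \<infinity>" using em[of UNIV] finite_ball[of x R] by (simp add: \<nu>_def)
  qed (use Z in \<open>auto simp: \<nu>_def\<close>)
  moreover have "emeasure \<nu> Z < emeasure \<nu> Z + ennreal e"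
  proof -
    have "emeasure \<nu> Z < top"
      using em[OF Z(1)] finite_ball[of x R] emeasure_mono[of "Z \<inter> ball x R" "ball x R" \<mu>]
      by (simp add: le_less_trans)
    then show ?thesis using e by (simp add: ennreal_add_left_cancel_less)
  qed
  ultimately have "(INF U \<in> {U. Z \<subseteq> U \<and> open U}. emeasure \<nu> U) < emeasure \<nu> Z + ennreal e" by simp
  then obtain U where U: "Z \<subseteq> U" "open U" "emeasure \<nu> U < emeasure \<nu> Z + ennreal e"
    unfolding INF_less_iff by auto
  have "emeasure \<mu> (U \<inter> ball x R) \<le> emeasure \<mu> Z + ennreal e"
    using U em[of U] em[OF Z(1)] Z(2) by (simp add: Int_absorb2 less_imp_le)
  then show ?thesis using U Z(2) by (intro exI[of _ "U \<inter> ball x R"]) auto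
qed

lemma hausdorff_outer_le_emeasure:
  assumes r: "r > 0" and d: "d > 0" and w: "w > 0" and Z: "Z \<in> sets borel" "Z \<subseteq> ball x R"
    and dens: "\<And>y k. y \<in> Z \<Longrightarrow> w * (r / 2 ^ k) ^ d \<le> M y (r / 2 ^ k)"
  shows "hausdorff_outer d Z \<le> ennreal (10 ^ d / w) * emeasure \<mu> Z"
  unfolding hausdorff_outer_def
proof (rule SUP_least)
  fix \<delta> :: real assume "\<delta> \<in> {0<..}"
  then have \<delta>: "\<delta> > 0" by simp
  have main: "hausdorff_content d \<delta> Z \<le> ennreal (10 ^ d / w) * (emeasure \<mu> Z + ennreal e)" if e: "e > 0" for e
  proof -
    obtain U where U: "open U" "Z \<subseteq> U" "emeasure \<mu> U \<le> emeasure \<mu> Z + ennreal e"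
      using open_superset_measure[OF Z e] by blast
    have "\<forall>y. \<exists>k::nat. y \<in> Z \<longrightarrow> 10 * (r / 2 ^ k) \<le> \<delta> \<and> cball y (r / 2 ^ k) \<subseteq> U"
    proof (intro allI)
      fix y
      show "\<exists>k::nat. y \<in> Z \<longrightarrow> 10 * (r / 2 ^ k) \<le> \<delta> \<and> cball y (r / 2 ^ k) \<subseteq> U"
      proof (cases "y \<in> Z")
        case True
        then obtain t where t: "t > 0" "cball y t \<subseteq> U" using U open_contains_cball by blast
        define q where "q = min t (\<delta> / 10)"
        have q: "q > 0" using t \<delta> by (simp add: q_def)
        obtain n where "(1 / 2) ^ n < q / r" using real_arch_pow_inv[of "q / r" "1 / 2"] q r by auto
        then have "r / 2 ^ n \<le> q" using r by (simp add: power_one_over field_simps)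
        then have n: "r / 2 ^ n \<le> t" "r / 2 ^ n \<le> \<delta> / 10" by (auto simp: q_def)
        have "cball y (r / 2 ^ n) \<subseteq> U" using n(1) t(2) subset_cball[of "r / 2 ^ n" t y] by blast
        moreover have "10 * (r / 2 ^ n) \<le> \<delta>" using n(2) by linarith
        ultimately show ?thesis by blast
      qed simp
    qed
    then obtain k where k: "\<And>y. y \<in> Z \<Longrightarrow> 10 * (r / 2 ^ k y) \<le> \<delta>" "\<And>y. y \<in> Z \<Longrightarrow> cball y (r / 2 ^ k y) \<subseteq> U" by metis
    define t where "t y = r / 2 ^ k y" for y
    have t0: "0 < t y" for y using r by (simp add: t_def)
    obtain I where I: "countable I" "I \<subseteq> Z" "pairwise (\<lambda>i j. disjnt (cball i (t i)) (cball j (t j))) I"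
      "Z \<subseteq> (\<Union>i\<in>I. cball i (5 * t i))"
    proof (rule Vitali_covering_lemma_cballs[where S=Z and K=Z and a="\<lambda>y. y" and r=t and B="\<delta>"])
      show "Z \<subseteq> (\<Union>i\<in>Z. cball i (t i))"
      proof
        fix y assume "y \<in> Z"
        then show "y \<in> (\<Union>i\<in>Z. cball i (t i))" using t0[of y] by (intro UN_I[of y]) auto
      qed
      show "0 < t i \<and> t i \<le> \<delta>" if "i \<in> Z" for i using t0[of i] k(1)[OF that] by (simp add: t_def)
    qed (rule that)
    define n where "n = to_nat_on I"
    have n_inj: "inj_on n I" unfolding n_def by (rule inj_on_to_nat_on[OF I(1)])
    define V where "V j = (if j \<in> n ` I then cball (the_inv_into I n j) (5 * t (the_inv_into I n j)) else {})" for j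
    define B where "B j = (if j \<in> n ` I then ball (the_inv_into I n j) (t (the_inv_into I n j)) else {})" for j
    have inv: "the_inv_into I n (n i) = i" if "i \<in> I" for i using the_inv_into_f_f[OF n_inj that] .
    have "hausdorff_content d \<delta> Z \<le> (\<Sum>j. ennreal (diameter (V j) ^ d))"
    proof (rule hausdorff_content_le)
      show "Z \<subseteq> (\<Union>j. V j)"
      proof
        fix z assume "z \<in> Z"
        then obtain i where i: "i \<in> I" "z \<in> cball i (5 * t i)" using I(4) by blast
        then have "z \<in> V (n i)" using inv by (simp add: V_def)
        then show "z \<in> (\<Union>j. V j)" by blast
      qed
      show "diameter (V j) \<le> \<delta>" for j
      proof (cases "j \<in> n ` I")
        case True
        then obtain i where i: "i \<in> I" "j = n i" by auto
        have "diameter (V j) = 10 * t i" using i inv t0[of i] by (simp add: V_def)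
        then show ?thesis using k(1)[of i] i I(2) by (auto simp: t_def)
      qed (use \<delta> in \<open>simp add: V_def\<close>)
    qed (simp add: V_def)
    also have "\<dots> \<le> (\<Sum>j. ennreal (10 ^ d / w) * emeasure \<mu> (B j))"
    proof (intro suminf_le)
      fix j
      show "ennreal (diameter (V j) ^ d) \<le> ennreal (10 ^ d / w) * emeasure \<mu> (B j)"
      proof (cases "j \<in> n ` I")
        case True
        then obtain i where i: "i \<in> I" "j = n i" by auto
        have "diameter (V j) = 10 * t i" using i inv t0[of i] by (simp add: V_def)
        moreover have "(10 * t i) ^ d \<le> 10 ^ d / w * M i (t i)"
        proof -
          have "w * t i ^ d \<le> M i (t i)" using dens[of i "k i"] i I(2) by (auto simp: t_def)
          then have "10 ^ d / w * (w * t i ^ d) \<le> 10 ^ d / w * M i (t i)" using w by (intro mult_left_mono) auto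
          then show ?thesis using w by (simp add: power_mult_distrib)
        qed
        moreover have "B j = ball i (t i)" using i inv by (simp add: B_def)
        ultimately show ?thesis using w by (simp add: emeasure_ball_eq ennreal_mult[symmetric] ennreal_leI)
      qed (use d in \<open>simp add: V_def power_0_left\<close>)
    qed auto
    also have "\<dots> = ennreal (10 ^ d / w) * (\<Sum>j. emeasure \<mu> (B j))" by simp
    also have "(\<Sum>j. emeasure \<mu> (B j)) = emeasure \<mu> (\<Union>j. B j)"
    proof (rule suminf_emeasure)
      have "B i \<inter> B j = {}" if "i \<noteq> j" for i j
      proof (cases "i \<in> n ` I \<and> j \<in> n ` I")
        case True
        then obtain p q where pq: "p \<in> I" "q \<in> I" "i = n p" "j = n q" by auto
        then have "disjnt (cball p (t p)) (cball q (t q))" using I(3) that by (auto simp: pairwise_def)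
        then have "disjnt (ball p (t p)) (ball q (t q))" using ball_subset_cball by (meson disjnt_subset1 disjnt_subset2)
        then show ?thesis using pq inv by (auto simp: B_def disjnt_iff)
      qed (auto simp: B_def)
      then show "disjoint_family B" by (auto simp: disjoint_family_on_def)
    qed (auto simp: B_def)
    also have "\<dots> \<le> emeasure \<mu> U"
    proof (rule emeasure_mono)
      have "ball i (t i) \<subseteq> U" if "i \<in> I" for i
        using k(2)[of i, folded t_def] that I(2) ball_subset_cball[of i "t i"] by blast
      then show "(\<Union>j. B j) \<subseteq> U" using inv by (auto simp: B_def split: if_splits)
    qed (use U in auto)
    also have "\<dots> \<le> emeasure \<mu> Z + ennreal e" by (rule U(3))
    finally show ?thesis by (simp add: mult_left_mono)
  qed
  show "hausdorff_content d \<delta> Z \<le> ennreal (10 ^ d / w) * emeasure \<mu> Z"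
  proof (rule ennreal_le_epsilon)
    fix e :: real assume e: "e > 0"
    have "hausdorff_content d \<delta> Z \<le> ennreal (10 ^ d / w) * (emeasure \<mu> Z + ennreal (e * w / 10 ^ d))"
      by (rule main) (use e w in simp)
    also have "\<dots> = ennreal (10 ^ d / w) * emeasure \<mu> Z + ennreal e"
      using e w by (simp add: distrib_left ennreal_mult[symmetric])
    finally show "hausdorff_content d \<delta> Z \<le> ennreal (10 ^ d / w) * emeasure \<mu> Z + ennreal e" .
  qed
qed

end

section \<open>From alpha numbers to flatness\<close>

lemma affine_isometric_param:
  fixes V :: "'a::euclidean_space set"
  assumes V: "affine V" "aff_dim V = int CARD('d::finite)" and q: "q \<in> V"
  shows "\<exists>\<phi> :: real^'d \<Rightarrow> 'a. isometric \<phi> \<and> V = range (\<lambda>u. q + \<phi> u)"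
proof -
  define T where "T = (\<lambda>x. x - q) ` V"
  have T: "subspace T" unfolding T_def by (rule affine_diffs_subspace_subtract[OF V(1) q])
  have "aff_dim V = int (dim T)" unfolding T_def using q by (intro aff_dim_eq_dim_subtract hull_inc)
  then have dim: "dim (UNIV :: (real^'d) set) = dim T" using V(2) by simp
  obtain \<phi> :: "real^'d \<Rightarrow> 'a" where \<phi>: "linear \<phi>" "\<phi> ` UNIV = T" "\<And>x. norm (\<phi> x) = norm x"
    by (rule isometries_subspaces[OF subspace_UNIV T dim]) (use that in blast)
  have "V = (\<lambda>x. q + x) ` T" by (simp add: T_def image_image)
  also have "\<dots> = range (\<lambda>u. q + \<phi> u)" unfolding \<phi>(2)[symmetric] by (simp add: image_image)
  finally show ?thesis using \<phi> by (auto simp: isometric_def)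
qed

lemma scale_measure_eq_density: "scale_measure c N = density N (\<lambda>_. c)"
  by (rule measure_eqI) (simp_all add: emeasure_density_const)

lemma integral_scale_measure:
  fixes f :: "'a \<Rightarrow> real"
  assumes "f \<in> borel_measurable N" "0 \<le> c"
  shows "(\<integral>x. f x \<partial>scale_measure (ennreal c) N) = c * (\<integral>x. f x \<partial>N)"
  unfolding scale_measure_eq_density using assms by (subst integral_density) auto

lemma distr_hausdorff_measure_scaleR:
  assumes t: "t > 0"
  shows "distr (hausdorff_measure TYPE('d::finite)) borel (\<lambda>u. t *\<^sub>R u)
     = scale_measure (ennreal (1 / t ^ CARD('d))) (hausdorff_measure TYPE('d) :: (real^'d) measure)"
proof (rule measure_eqI)
  let ?H = "hausdorff_measure TYPE('d) :: (real^'d) measure"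
  let ?h = "\<lambda>u. t *\<^sub>R u :: real^'d"
  fix A assume "A \<in> sets (distr ?H borel ?h)"
  then have A: "A \<in> sets borel" by simp
  have m: "?h \<in> borel_measurable borel" by measurable
  have pre: "?h -` A \<in> sets borel" using measurable_sets[OF m A] by (simp add: space_borel)
  have im: "?h ` (?h -` A) = A"
  proof -
    have "surj ?h" by (rule surjI[of _ "\<lambda>u. u /\<^sub>R t"]) (use t in simp)
    then show ?thesis by (rule surj_image_vimage_eq)
  qed
  have "emeasure ?H (?h ` (?h -` A)) = ennreal (t ^ CARD('d)) * emeasure ?H (?h -` A)"
    using t pre A im by (intro emeasure_hausdorff_measure_similarity) (auto simp: dist_norm scaleR_diff_right[symmetric])
  then have "ennreal (1 / t ^ CARD('d)) * emeasure ?H A = emeasure ?H (?h -` A)"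
    unfolding im using t by (simp add: mult.assoc[symmetric] ennreal_mult[symmetric])
  then show "emeasure (distr ?H borel ?h) A = emeasure (scale_measure (ennreal (1 / t ^ CARD('d))) ?H) A"
    using A m by (simp add: emeasure_distr space_hausdorff_measure)
qed simp

lemma plane_measure_integral:
  fixes \<phi> :: "real^'d::finite \<Rightarrow> 'a::euclidean_space" and \<psi> :: "'a \<Rightarrow> real"
  assumes \<phi>: "isometric \<phi>" and q: "norm q < 1 / 2" and V: "V = range (\<lambda>u. q + \<phi> u)" "affine V"
  shows "\<exists>e>0. \<forall>\<psi>\<in>borel_measurable borel. (\<integral>x. (\<psi> x :: real) \<partial>plane_measure TYPE('d) V) = (\<integral>u. \<psi> (q + \<phi> u) \<partial>hausdorff_measure TYPE('d)) / e"
proof -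
  let ?H = "hausdorff_measure TYPE('d) :: (real^'d) measure"
  let ?Hn = "hausdorff_measure TYPE('d) :: 'a measure"
  let ?h = "\<lambda>u. q + \<phi> u"
  have Vb: "V \<in> sets borel" using affine_closed[OF V(2)] by auto
  have dd: "density ?Hn (indicator V) = distr ?H borel ?h"
    using Vb unfolding V(1) by (intro distr_hausdorff_measure_isometry isometric_dist[OF \<phi>])
  have hc: "continuous_on UNIV ?h"
    by (intro continuous_intros linear_continuous_on[OF linear_conv_bounded_linear[THEN iffD1, OF isometric_linear[OF \<phi>]]])
  then have hm: "?h \<in> borel_measurable borel" by (rule borel_measurable_continuous_onI)
  then have hm': "?h \<in> measurable ?H borel" by (simp cong: measurable_cong_sets)
  have "emeasure ?Hn (V \<inter> ball 0 1) = emeasure (density ?Hn (indicator V)) (ball 0 1)"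
  proof -
    have "emeasure (density ?Hn (indicator V)) (ball 0 1) = (\<integral>\<^sup>+y. indicator V y * indicator (ball 0 1) y \<partial>?Hn)"
      using Vb by (intro emeasure_density borel_measurable_indicator) auto
    also have "\<dots> = (\<integral>\<^sup>+y. indicator (V \<inter> ball 0 1) y \<partial>?Hn)"
      by (rule nn_integral_cong) (auto split: split_indicator)
    finally show ?thesis using Vb by (subst (asm) nn_integral_indicator) auto
  qed
  also have "\<dots> = emeasure ?H (?h -` ball 0 1)"
    unfolding dd using hm' by (simp add: emeasure_distr space_hausdorff_measure)
  finally have e_eq: "emeasure ?Hn (V \<inter> ball 0 1) = emeasure ?H (?h -` ball 0 1)" .
  have pre: "?h -` ball 0 1 \<in> sets ?H" using measurable_sets[OF hm, of "ball 0 1"] by (simp add: space_borel)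
  have up: "emeasure ?H (?h -` ball 0 1) \<le> emeasure ?H (ball 0 2)"
  proof (rule emeasure_mono)
    show "?h -` ball 0 1 \<subseteq> ball 0 2"
    proof
      fix u assume "u \<in> ?h -` ball 0 1"
      then have "norm (q + \<phi> u) < 1" by simp
      moreover have "norm (\<phi> u) \<le> norm (q + \<phi> u) + norm q" using norm_triangle_ineq4[of "q + \<phi> u" q] by simp
      ultimately show "u \<in> ball 0 2" using q isometric_norm[OF \<phi>, of u] by simp
    qed
  qed simp
  have low: "emeasure ?H (ball 0 (1 / 2)) \<le> emeasure ?H (?h -` ball 0 1)"
  proof (rule emeasure_mono)
    show "ball 0 (1 / 2) \<subseteq> ?h -` ball 0 1"
    proof
      fix u :: "real^'d" assume "u \<in> ball 0 (1 / 2)"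
      then have "norm u < 1 / 2" by simp
      then show "u \<in> ?h -` ball 0 1"
        using q isometric_norm[OF \<phi>, of u] norm_triangle_ineq[of q "\<phi> u"] by simp
    qed
  qed (rule pre)
  define e where "e = measure ?H (?h -` ball 0 1)"
  have "emeasure ?H (?h -` ball 0 1) < top"
    using up by (rule le_less_trans) (simp add: emeasure_hausdorff_measure_ball)
  then have em: "emeasure ?H (?h -` ball 0 1) = ennreal e" unfolding e_def by (simp add: emeasure_eq_ennreal_measure)
  have "ennreal ((1 / 2) ^ CARD('d)) \<le> ennreal e" using low by (simp add: emeasure_hausdorff_measure_ball em)
  then have e: "0 < e" by (smt (verit) ennreal_le_iff2 zero_less_power zero_less_divide_1_iff)
  have "plane_measure TYPE('d) V = scale_measure (ennreal (1 / e)) (distr ?H borel ?h)"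
    unfolding plane_measure_def dd e_eq em using e by (simp add: divide_ennreal flip: ennreal_1)
  then have "(\<integral>x. \<psi> x \<partial>plane_measure TYPE('d) V) = (\<integral>u. \<psi> (q + \<phi> u) \<partial>?H) / e"
    if "\<psi> \<in> borel_measurable borel" for \<psi> :: "'a \<Rightarrow> real"
    using that e hm' by (simp add: integral_scale_measure integral_distr)
  then show ?thesis using e by blast
qed

context doubling_radon begin

lemma flat_of_wasserstein1:
  fixes V :: "'a set"
  assumes z: "z \<in> S" and t: "t > 0" and V: "V \<in> planes_near_origin CARD('d::finite)"
    and W: "wasserstein1 (blowup \<mu> z t) (plane_measure TYPE('d) V) \<le> ennreal \<delta>" and \<delta>: "0 \<le> \<delta>"
  shows "\<exists>(\<phi> :: real^'d \<Rightarrow> 'a) m. flat \<mu> z t \<phi> m \<delta>"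
proof -
  let ?H = "hausdorff_measure TYPE('d) :: (real^'d) measure"
  have V1: "affine V" "aff_dim V = int CARD('d)" using V by (auto simp: planes_near_origin_def)
  obtain q where q: "q \<in> V" "norm q < 1 / 2" using V by (auto simp: planes_near_origin_def)
  obtain \<phi> :: "real^'d \<Rightarrow> 'a" where \<phi>: "isometric \<phi>" "V = range (\<lambda>u. q + \<phi> u)"
    using affine_isometric_param[OF V1 q(1)] by blast
  obtain e where e: "e > 0" and pm: "\<And>\<psi>. \<psi> \<in> borel_measurable borel \<Longrightarrow>
      (\<integral>x. (\<psi> x :: real) \<partial>plane_measure TYPE('d) V) = (\<integral>u. \<psi> (q + \<phi> u) \<partial>?H) / e"
    using plane_measure_integral[OF \<phi>(1) q(2) \<phi>(2) V1(1)] by blast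
  define m where "m = M z t / (e * t ^ CARD('d))"
  have Mp: "0 < M z t" by (rule M_pos[OF z t])
  have "\<bar>(\<integral>x. \<psi> x \<partial>\<mu>) - m * (\<integral>u. \<psi> (z + t *\<^sub>R q + \<phi> u) \<partial>?H)\<bar> \<le> \<delta> * t * M z t"
    if \<psi>: "1-lipschitz_on UNIV \<psi>" "\<And>x. x \<notin> ball z t \<Longrightarrow> \<psi> x = 0" for \<psi> :: "'a \<Rightarrow> real"
  proof -
    define \<psi>' where "\<psi>' x = \<psi> (z + t *\<^sub>R x) / t" for x
    have lip: "1-lipschitz_on UNIV \<psi>'"
    proof (rule lipschitz_onI)
      fix x y
      have "dist (\<psi> (z + t *\<^sub>R x)) (\<psi> (z + t *\<^sub>R y)) \<le> 1 * dist (z + t *\<^sub>R x) (z + t *\<^sub>R y)"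
        by (rule lipschitz_onD[OF \<psi>(1)]) auto
      also have "\<dots> = t * dist x y" using t by (simp add: dist_norm scaleR_diff_right[symmetric])
      finally show "dist (\<psi>' x) (\<psi>' y) \<le> 1 * dist x y"
        using t by (simp add: \<psi>'_def dist_real_def diff_divide_distrib[symmetric] abs_divide divide_le_eq mult.commute)
    qed simp
    have out: "\<psi>' x = 0" if "x \<notin> ball 0 1" for x
    proof -
      have "z + t *\<^sub>R x \<notin> ball z t" using that t by (simp add: dist_norm)
      then show ?thesis using \<psi>(2) by (simp add: \<psi>'_def)
    qed
    have cont: "continuous_on UNIV \<psi>" "continuous_on UNIV \<psi>'"
      using lipschitz_on_continuous_on \<psi>(1) lip by blast+
    then have meas: "\<psi> \<in> borel_measurable borel" "\<psi>' \<in> borel_measurable borel"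
      by (auto intro: borel_measurable_continuous_onI)
    have "ennreal \<bar>(\<integral>x. \<psi>' x \<partial>blowup \<mu> z t) - (\<integral>x. \<psi>' x \<partial>plane_measure TYPE('d) V)\<bar>
       \<le> wasserstein1 (blowup \<mu> z t) (plane_measure TYPE('d) V)"
      unfolding wasserstein1_def using lip out by (intro SUP_upper) auto
    also have "\<dots> \<le> ennreal \<delta>" by (rule W)
    finally have 1: "\<bar>(\<integral>x. \<psi>' x \<partial>blowup \<mu> z t) - (\<integral>x. \<psi>' x \<partial>plane_measure TYPE('d) V)\<bar> \<le> \<delta>"
      using \<delta> by simp
    have fm: "(\<lambda>y. (y - z) /\<^sub>R t) \<in> measurable \<mu> borel"
      unfolding measurable_cong_sets[OF sets_mu refl] by measurable
    have "blowup \<mu> z t = scale_measure (ennreal (1 / M z t)) (distr \<mu> borel (\<lambda>y. (y - z) /\<^sub>R t))"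
      unfolding blowup_def emeasure_ball_eq using Mp by (simp add: divide_ennreal flip: ennreal_1)
    then have "(\<integral>x. \<psi>' x \<partial>blowup \<mu> z t) = 1 / M z t * (\<integral>y. \<psi>' ((y - z) /\<^sub>R t) \<partial>\<mu>)"
      using meas fm by (simp add: integral_scale_measure integral_distr)
    also have "(\<integral>y. \<psi>' ((y - z) /\<^sub>R t) \<partial>\<mu>) = (\<integral>y. \<psi> y \<partial>\<mu>) / t"
      using t by (simp add: \<psi>'_def)
    finally have 2: "(\<integral>x. \<psi>' x \<partial>blowup \<mu> z t) = (\<integral>y. \<psi> y \<partial>\<mu>) / (M z t * t)" by simp
    have "(\<integral>x. \<psi>' x \<partial>plane_measure TYPE('d) V) = (\<integral>u. \<psi>' (q + \<phi> u) \<partial>?H) / e" by (rule pm[OF meas(2)])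
    also have "(\<integral>u. \<psi>' (q + \<phi> u) \<partial>?H) = (\<integral>u. \<psi> (z + t *\<^sub>R q + \<phi> (t *\<^sub>R u)) \<partial>?H) / t"
      by (simp add: \<psi>'_def scaleR_add_right add.assoc linear_scale[OF isometric_linear[OF \<phi>(1)]])
    also have "(\<integral>u. \<psi> (z + t *\<^sub>R q + \<phi> (t *\<^sub>R u)) \<partial>?H) = (\<integral>u. \<psi> (z + t *\<^sub>R q + \<phi> u) \<partial>distr ?H borel (\<lambda>u. t *\<^sub>R u))"
    proof (rule integral_distr[symmetric])
      show "(\<lambda>u. \<psi> (z + t *\<^sub>R q + \<phi> u)) \<in> borel_measurable borel"
        using lipschitz_on_continuous_on[OF lipschitz_on_isometric[OF \<phi>(1) \<psi>(1)]] by (rule borel_measurable_continuous_onI)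
      show "(\<lambda>u. t *\<^sub>R u) \<in> measurable ?H borel" by (simp cong: measurable_cong_sets)
    qed
    also have "\<dots> = 1 / t ^ CARD('d) * (\<integral>u. \<psi> (z + t *\<^sub>R q + \<phi> u) \<partial>?H)"
      unfolding distr_hausdorff_measure_scaleR[OF t]
    proof (rule integral_scale_measure)
      have "(\<lambda>u. \<psi> (z + t *\<^sub>R q + \<phi> u)) \<in> borel_measurable borel"
        using lipschitz_on_continuous_on[OF lipschitz_on_isometric[OF \<phi>(1) \<psi>(1)]] by (rule borel_measurable_continuous_onI)
      then show "(\<lambda>u. \<psi> (z + t *\<^sub>R q + \<phi> u)) \<in> borel_measurable ?H" by (simp cong: measurable_cong_sets)
    qed (use t in simp)
    finally have 3: "(\<integral>x. \<psi>' x \<partial>plane_measure TYPE('d) V)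
       = m * (\<integral>u. \<psi> (z + t *\<^sub>R q + \<phi> u) \<partial>?H) / (M z t * t)"
      using Mp by (simp add: m_def)
    have "\<bar>(\<integral>y. \<psi> y \<partial>\<mu>) - m * (\<integral>u. \<psi> (z + t *\<^sub>R q + \<phi> u) \<partial>?H)\<bar> / (M z t * t) \<le> \<delta>"
      using 1 Mp t unfolding 2 3 by (simp add: diff_divide_distrib[symmetric] abs_divide abs_mult)
    then show ?thesis using Mp t by (simp add: pos_divide_le_eq mult.commute mult.left_commute)
  qed
  then have "flat \<mu> z t \<phi> m \<delta>"
    unfolding flat_def plane_approx_def using \<phi>(1) by blast
  then show ?thesis by blast
qed

lemma flat_of_alpha_number:
  assumes z: "z \<in> S" and t: "t > 0" and \<alpha>: "alpha_number TYPE('d::finite) \<mu> z t < ennreal \<delta>"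
  shows "\<exists>(\<phi> :: real^'d \<Rightarrow> 'a) m. flat \<mu> z t \<phi> m \<delta>"
proof -
  have "0 < ennreal \<delta>" using \<alpha> by (rule le_less_trans[OF zero_le])
  then have \<delta>: "0 \<le> \<delta>" by simp
  obtain V where V: "V \<in> planes_near_origin CARD('d)" "wasserstein1 (blowup \<mu> z t) (plane_measure TYPE('d) V) < ennreal \<delta>"
    using \<alpha> unfolding alpha_number_def INF_less_iff by blast
  show ?thesis by (rule flat_of_wasserstein1[OF z t V(1) less_imp_le[OF V(2)] \<delta>])
qed

lemma flat_recenter:
  fixes \<phi> :: "real^'d::finite \<Rightarrow> 'a"
  assumes y: "y \<in> S" and zy: "dist z y < 2 * \<rho>" and \<rho>: "0 < \<rho>" and t: "16 * \<rho> < t" "t \<le> 32 * \<rho>"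
    and fl: "flat \<mu> z t \<phi> m \<delta>" and \<delta>: "0 \<le> \<delta>"
  shows "flat \<mu> y (8 * \<rho>) \<phi> m (4 * C ^ 3 * \<delta>)"
proof (rule flat_shrink[OF fl])
  show "ball y (8 * \<rho>) \<subseteq> ball z t"
  proof
    fix x assume "x \<in> ball y (8 * \<rho>)"
    then have "dist y x < 8 * \<rho>" by simp
    then show "x \<in> ball z t" unfolding mem_ball using zy t(1) \<rho> dist_triangle[of z x y] by linarith
  qed
  have "M z t \<le> C ^ 3 * M y (8 * \<rho>)"
    using zy t(2) \<rho> by (intro M_compare[OF y]) auto
  then have "\<delta> * t * M z t \<le> \<delta> * (32 * \<rho>) * (C ^ 3 * M y (8 * \<rho>))"
    using \<delta> t \<rho> by (intro mult_mono) auto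
  then show "\<delta> * t * M z t \<le> 4 * C ^ 3 * \<delta> * (8 * \<rho>) * M y (8 * \<rho>)" by (simp add: ac_simps)
qed

end

text \<open>The infimum over nearby centres has open sublevel sets. No measurability of the \<open>\<alpha>\<close>-numbers
  themselves is available, and the integrals in the hypothesis may be lower integrals.\<close>

definition scale_alpha :: "'d::finite itself \<Rightarrow> 'a::euclidean_space measure \<Rightarrow> real \<Rightarrow> real \<Rightarrow> nat \<Rightarrow> 'a \<Rightarrow> ennreal" where
  "scale_alpha T \<mu> r c k y = (INF z\<in>measure_support \<mu> \<inter> ball y (c * (r / 2 ^ (k + 4))).
     INF t\<in>{r / 2 ^ k<..2 * (r / 2 ^ k)}. alpha_number T \<mu> z t)"

text \<open>The term \<open>(1 / 2) ^ j\<close> makes the budget strictly larger than an infimum that need not be attained. Scale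
  \<open>j\<close> uses \<open>\<alpha>\<close>-numbers at radii between \<open>16 * (r / 2 ^ j)\<close> and \<open>32 * (r / 2 ^ j)\<close>, which exceed \<open>2 * r\<close> for
  \<open>j < 4\<close>; those scales count as stopped.\<close>

definition scale_budget :: "'d::finite itself \<Rightarrow> 'a::euclidean_space measure \<Rightarrow> real \<Rightarrow> real \<Rightarrow> nat \<Rightarrow> 'a \<Rightarrow> real" where
  "scale_budget T \<mu> r c j y = (if j < 4 then 1 else enn2real (min 1 (scale_alpha T \<mu> r c (j - 4) y))) + (1 / 2) ^ j"

lemma scale_budget_pos: "0 < scale_budget T \<mu> r c j y"
  by (simp add: scale_budget_def add_nonneg_pos)

lemma scale_alpha_measurable: "scale_alpha T \<mu> r c k \<in> borel_measurable borel"
proof (rule borel_measurableI_less)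
  fix l
  have "{y. scale_alpha T \<mu> r c k y < l}
     = (\<Union>z\<in>{z\<in>measure_support \<mu>. (INF t\<in>{r / 2 ^ k<..2 * (r / 2 ^ k)}. alpha_number T \<mu> z t) < l}. ball z (c * (r / 2 ^ (k + 4))))"
    unfolding scale_alpha_def INF_less_iff by (auto simp: dist_commute)
  moreover have "open \<dots>" by blast
  ultimately show "{y \<in> space borel. scale_alpha T \<mu> r c k y < l} \<in> sets borel" by simp
qed

lemma sum_scale_budget_le:
  assumes "(\<Sum>k. scale_alpha T \<mu> r c k y) \<le> ennreal R" "0 \<le> R"
  shows "(\<Sum>i<n. scale_budget T \<mu> r c i y) \<le> 6 + R"
proof -
  define v where "v k = enn2real (min 1 (scale_alpha T \<mu> r c k y))" for k
  define f where "f i = (if i < 4 then 1 else v (i - 4))" for i :: nat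
  have v: "0 \<le> v k" "ennreal (v k) \<le> scale_alpha T \<mu> r c k y" for k
  proof -
    have "min 1 (scale_alpha T \<mu> r c k y) < top" by (simp add: min_less_iff_disj)
    then have "ennreal (v k) = min 1 (scale_alpha T \<mu> r c k y)" unfolding v_def by simp
    then show "ennreal (v k) \<le> scale_alpha T \<mu> r c k y" by simp
  qed (simp add: v_def)
  have "ennreal (\<Sum>k<n. v k) = (\<Sum>k<n. ennreal (v k))" using v(1) by simp
  also have "\<dots> \<le> (\<Sum>k<n. scale_alpha T \<mu> r c k y)" by (intro sum_mono v(2))
  also have "\<dots> \<le> (\<Sum>k. scale_alpha T \<mu> r c k y)" by (intro sum_le_suminf) auto
  also have "\<dots> \<le> ennreal R" by (rule assms(1))
  finally have sv: "(\<Sum>k<n. v k) \<le> R" using assms(2) by simp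
  have "(\<Sum>i<n. f i) \<le> (\<Sum>i<n + 4. f i)" using v(1) by (intro sum_mono2) (auto simp: f_def)
  also have "(\<Sum>i<n + 4. f i) = 4 + (\<Sum>k<n. v k)"
    by (induction n) (simp_all add: f_def eval_nat_numeral)
  finally have 1: "(\<Sum>i<n. f i) \<le> 4 + R" using sv by linarith
  have "(\<Sum>i<n. (1 / 2 :: real) ^ i) = 2 - 2 * (1 / 2) ^ n" by (induction n) simp_all
  then have 2: "(\<Sum>i<n. (1 / 2 :: real) ^ i) \<le> 2" by simp
  have "(\<Sum>i<n. scale_budget T \<mu> r c i y) = (\<Sum>i<n. f i) + (\<Sum>i<n. (1 / 2 :: real) ^ i)"
    unfolding scale_budget_def f_def v_def by (rule sum.distrib)
  then show ?thesis using 1 2 by linarith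
qed

lemma suminf_scale_alpha_le:
  assumes y: "y \<in> measure_support \<mu>" and r: "r > 0"
  shows "(\<Sum>k. scale_alpha T \<mu> r 1 k y) \<le> 2 * (\<integral>\<^sup>+t\<in>{0<..2 * r}. alpha_number T \<mu> y t / ennreal t \<partial>lborel)"
proof -
  define q where "q k = r / 2 ^ k" for k :: nat
  define c where "c k = scale_alpha T \<mu> r 1 k y" for k
  define J where "J k = {q k<..2 * q k}" for k
  have q0: "0 < q k" for k using r by (simp add: q_def)
  have c_le: "c k \<le> alpha_number T \<mu> y t" if "t \<in> J k" for k t
  proof -
    have "y \<in> measure_support \<mu> \<inter> ball y (1 * (r / 2 ^ (k + 4)))" using y r by simp
    moreover have "t \<in> {r / 2 ^ k<..2 * (r / 2 ^ k)}" using that by (simp add: J_def q_def)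
    ultimately show ?thesis unfolding c_def scale_alpha_def by (meson INF_lower INF_lower2)
  qed
  have disj: "disjoint_family J"
  proof -
    have "J i \<inter> J j = {}" if "i < j" for i j
    proof -
      have "(2::real) ^ Suc i \<le> 2 ^ j" using that by (intro power_increasing) auto
      then have "r / 2 ^ j \<le> r / 2 ^ Suc i" using r by (intro divide_left_mono) auto
      then have "2 * q j \<le> q i" by (simp add: q_def)
      then show ?thesis by (auto simp: J_def)
    qed
    then show ?thesis unfolding disjoint_family_on_def by (metis Int_commute linorder_neqE_nat)
  qed
  define g where "g k t = c k * ennreal (1 / (2 * q k)) * indicator (J k) t" for k and t :: real
  have g_int: "2 * (\<integral>\<^sup>+t. g k t \<partial>lborel) = c k" for k
  proof -
    have "(\<integral>\<^sup>+t. g k t \<partial>lborel) = c k * ennreal (1 / (2 * q k)) * emeasure lborel (J k)"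
      unfolding g_def by (rule nn_integral_cmult_indicator) (simp add: J_def)
    also have "emeasure lborel (J k) = ennreal (q k)" using q0[of k] by (simp add: J_def)
    finally have "2 * (\<integral>\<^sup>+t. g k t \<partial>lborel) = c k * (ennreal 2 * (ennreal (1 / (2 * q k)) * ennreal (q k)))"
      by (simp add: ac_simps)
    also have "ennreal (1 / (2 * q k)) * ennreal (q k) = ennreal (1 / (2 * q k) * q k)"
      using q0[of k] by (intro ennreal_mult[symmetric]) auto
    also have "1 / (2 * q k) * q k = 1 / 2" using q0[of k] by simp
    also have "ennreal 2 * ennreal (1 / 2) = 1" by (subst ennreal_mult[symmetric]) simp_all
    finally show ?thesis by simp
  qed
  have "(\<Sum>k. g k t) \<le> alpha_number T \<mu> y t / ennreal t * indicator {0<..2 * r} t" for t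
  proof (cases "\<exists>j. t \<in> J j")
    case True
    then obtain j where j: "t \<in> J j" by blast
    have t: "0 < t" "t \<le> 2 * q j" "t \<le> 2 * r"
    proof -
      show "0 < t" "t \<le> 2 * q j" using j q0[of j] by (auto simp: J_def)
      moreover have "q j \<le> r" using r by (simp add: q_def divide_le_eq)
      ultimately show "t \<le> 2 * r" by linarith
    qed
    have "(\<Sum>k. g k t) = c j * ennreal (1 / (2 * q j))"
      unfolding g_def by (rule suminf_cmult_indicator[OF disj j])
    also have "\<dots> \<le> alpha_number T \<mu> y t * ennreal (1 / t)"
      using c_le[OF j] t by (intro mult_mono ennreal_leI divide_left_mono) auto
    also have "ennreal (1 / t) = inverse (ennreal t)" using t by (simp add: inverse_ennreal inverse_eq_divide)
    finally show ?thesis using t by (simp add: divide_ennreal_def)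
  next
    case False
    then have "g k t = 0" for k by (simp add: g_def)
    then show ?thesis by simp
  qed
  then have "(\<integral>\<^sup>+t. (\<Sum>k. g k t) \<partial>lborel) \<le> (\<integral>\<^sup>+t\<in>{0<..2 * r}. alpha_number T \<mu> y t / ennreal t \<partial>lborel)"
    by (rule nn_integral_mono)
  moreover have "(\<integral>\<^sup>+t. (\<Sum>k. g k t) \<partial>lborel) = (\<Sum>k. \<integral>\<^sup>+t. g k t \<partial>lborel)"
    by (rule nn_integral_suminf) (simp add: g_def J_def)
  moreover have "(\<Sum>k. c k) = 2 * (\<Sum>k. \<integral>\<^sup>+t. g k t \<partial>lborel)" by (simp add: g_int flip: ennreal_suminf_cmult)
  ultimately show ?thesis unfolding c_def[symmetric] by (simp add: mult_left_mono)
qed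

context doubling_radon begin

lemma closed_support: "closed S"
proof -
  have "open (- S)"
  proof (rule openI)
    fix y assume "y \<in> - S"
    then obtain t where t: "t > 0" "emeasure \<mu> (ball y t) = 0" by (auto simp: measure_support_def not_less)
    have "ball y t \<subseteq> - S"
    proof
      fix w assume w: "w \<in> ball y t"
      define u where "u = t - dist y w"
      have u: "u > 0" using w by (simp add: u_def)
      have "ball w u \<subseteq> ball y t"
      proof
        fix v assume "v \<in> ball w u"
        then show "v \<in> ball y t" using dist_triangle[of y v w] by (simp add: u_def)
      qed
      then have "emeasure \<mu> (ball w u) \<le> emeasure \<mu> (ball y t)" by (intro emeasure_mono) auto
      then have "emeasure \<mu> (ball w u) = 0" using t(2) by simp
      then show "w \<in> - S" using u by (auto simp: measure_support_def)
    qed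
    then show "\<exists>e>0. ball y e \<subseteq> - S" using t(1) by blast
  qed
  then show ?thesis by (simp add: closed_def)
qed

lemma null_support: "emeasure \<mu> (- S) = 0"
proof -
  have "\<forall>y. \<exists>t. y \<in> - S \<longrightarrow> t > 0 \<and> emeasure \<mu> (ball y t) = 0" by (auto simp: measure_support_def not_less)
  then obtain t where t: "\<And>y. y \<in> - S \<Longrightarrow> t y > 0" "\<And>y. y \<in> - S \<Longrightarrow> emeasure \<mu> (ball y (t y)) = 0" by metis
  obtain F where F: "F \<subseteq> (\<lambda>y. ball y (t y)) ` (- S)" "countable F" "\<Union> F = \<Union> ((\<lambda>y. ball y (t y)) ` (- S))"
    using Lindelof[of "(\<lambda>y. ball y (t y)) ` (- S)"] by blast
  have "- S \<subseteq> \<Union> F"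
  proof
    fix y assume "y \<in> - S"
    then show "y \<in> \<Union> F" unfolding F(3) using t(1) by (intro UN_I[of y]) auto
  qed
  moreover have "\<Union> F \<in> null_sets \<mu>"
  proof -
    have "(\<Union>A\<in>F. A) \<in> null_sets \<mu>" using F(1) t(2) by (intro null_sets_UN'[OF F(2)]) (auto simp: null_sets_def)
    then show ?thesis by simp
  qed
  moreover have "- S \<in> sets \<mu>" using closed_support by auto
  ultimately have "- S \<in> null_sets \<mu>" by (meson null_sets_subset)
  then show ?thesis by auto
qed

lemma flat_scales_alpha:
  assumes r: "r > 0"
  shows "flat_scales TYPE('d::finite) \<mu> C CARD('d) r (4 * C ^ 3) (scale_budget TYPE('d) \<mu> r 1) (scale_budget TYPE('d) \<mu> r 2)"
proof (intro flat_scales.intro doubling_radon_axioms flat_scales_axioms.intro)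
  have "1 * 1 \<le> 4 * C ^ 3" using C_ge_1 by (intro mult_mono one_le_power) auto
  then show "1 \<le> 4 * C ^ 3" by simp
  show "0 < scale_budget TYPE('d) \<mu> r 1 k y" for k y by (rule scale_budget_pos)
  show "0 \<le> scale_budget TYPE('d) \<mu> r 2 k y" for k y using scale_budget_pos by (rule less_imp_le)
next
  fix k and y z :: 'a assume d: "dist y z \<le> r / 2 ^ k"
  show "scale_budget TYPE('d) \<mu> r 2 k y \<le> scale_budget TYPE('d) \<mu> r 1 k z"
  proof (cases "k < 4")
    case False
    have "ball z (1 * (r / 2 ^ (k - 4 + 4))) \<subseteq> ball y (2 * (r / 2 ^ (k - 4 + 4)))"
    proof
      fix w assume "w \<in> ball z (1 * (r / 2 ^ (k - 4 + 4)))"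
      then have "dist z w < r / 2 ^ k" using False by simp
      then have "dist y w < 2 * (r / 2 ^ k)" using d dist_triangle[of y w z] by linarith
      then show "w \<in> ball y (2 * (r / 2 ^ (k - 4 + 4)))" using False by simp
    qed
    then have "scale_alpha TYPE('d) \<mu> r 2 (k - 4) y \<le> scale_alpha TYPE('d) \<mu> r 1 (k - 4) z"
      unfolding scale_alpha_def by (intro INF_superset_mono) auto
    then have "enn2real (min 1 (scale_alpha TYPE('d) \<mu> r 2 (k - 4) y)) \<le> enn2real (min 1 (scale_alpha TYPE('d) \<mu> r 1 (k - 4) z))"
      by (intro enn2real_mono min.mono) (auto simp: min_less_iff_disj)
    then show ?thesis using False by (simp add: scale_budget_def)
  qed (simp add: scale_budget_def)
next
  fix k and y :: 'a assume y: "y \<in> S" and b: "scale_budget TYPE('d) \<mu> r 2 k y < 1"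
  let ?b = "scale_budget TYPE('d) \<mu> r 2 k y" and ?X = "scale_alpha TYPE('d) \<mu> r 2 (k - 4) y"
  have k: "4 \<le> k"
  proof (rule ccontr)
    assume "\<not> 4 \<le> k"
    then have "1 < ?b" by (simp add: scale_budget_def)
    then show False using b by simp
  qed
  have bX: "?b = enn2real (min 1 ?X) + (1 / 2) ^ k" using k by (simp add: scale_budget_def)
  have fin: "ennreal (enn2real (min 1 ?X)) = min 1 ?X" by (simp add: min_less_iff_disj)
  have lt: "enn2real (min 1 ?X) < ?b" unfolding bX by simp
  then have "min 1 ?X < ennreal ?b"
    using ennreal_lessI[OF le_less_trans[OF enn2real_nonneg lt] lt] unfolding fin by simp
  moreover have "ennreal ?b < 1" using b scale_budget_pos[of "TYPE('d)" \<mu> r 2 k y] by (simp add: ennreal_less_one_iff)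
  ultimately have "?X < ennreal ?b" by (auto simp: min_less_iff_disj dest: less_trans)
  then obtain z t where z: "z \<in> S" "z \<in> ball y (2 * (r / 2 ^ (k - 4 + 4)))"
    and t: "t \<in> {r / 2 ^ (k - 4)<..2 * (r / 2 ^ (k - 4))}" and \<alpha>: "alpha_number TYPE('d) \<mu> z t < ennreal ?b"
    unfolding scale_alpha_def INF_less_iff by blast
  have e: "r / 2 ^ (k - 4) = 16 * (r / 2 ^ k)"
    using k power_add[of "2::real" "k - 4" 4] by simp
  have t': "16 * (r / 2 ^ k) < t" "t \<le> 32 * (r / 2 ^ k)" using t unfolding e by auto
  have t0: "0 < t" by (rule less_trans[OF _ t'(1)]) (use r in simp)
  obtain \<phi> :: "real^'d \<Rightarrow> 'a" and m where fl: "flat \<mu> z t \<phi> m ?b" using flat_of_alpha_number[OF z(1) t0 \<alpha>] by blast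
  have "flat \<mu> y (8 * (r / 2 ^ k)) \<phi> m (4 * C ^ 3 * ?b)"
  proof (rule flat_recenter[OF y _ _ t' fl])
    show "dist z y < 2 * (r / 2 ^ k)" using z(2) k by (simp add: dist_commute)
    show "0 \<le> ?b" by (rule less_imp_le[OF scale_budget_pos])
  qed (use r in simp)
  then show "\<exists>(\<phi> :: real^'d \<Rightarrow> 'a) m. flat \<mu> y (8 * (r / 2 ^ k)) \<phi> m (4 * C ^ 3 * ?b)" by blast
qed (use r in simp_all)

lemma small_budget_set:
  assumes r: "r > 0" and C1: "C1 > 0" and \<gamma>: "\<gamma> > 0"
    and car: "(\<integral>\<^sup>+y\<in>ball x (2 * r). (\<integral>\<^sup>+t\<in>{0<..2 * r}. alpha_number T \<mu> y t / ennreal t \<partial>lborel) \<partial>\<mu>)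
      \<le> ennreal C1 * emeasure \<mu> (ball x r)"
  shows "\<exists>E\<in>sets borel. E \<subseteq> S \<inter> ball x r \<and> measure \<mu> (ball x r - E) \<le> \<gamma> / 2 * M x r \<and>
     (\<forall>y\<in>E. \<forall>n. (\<Sum>i<n. scale_budget T \<mu> r 1 i y) \<le> 6 + 4 * C1 / \<gamma>)"
proof -
  define R where "R = 4 * C1 / \<gamma>"
  have R: "R > 0" using C1 \<gamma> by (simp add: R_def)
  define G where "G y = (\<Sum>k. scale_alpha T \<mu> r 1 k y)" for y
  have Gm: "G \<in> borel_measurable borel"
    unfolding G_def by (intro borel_measurable_suminf_order scale_alpha_measurable)
  have Sb: "S \<in> sets borel" using closed_support by auto
  define F where "F = {y \<in> S \<inter> ball x r. ennreal R < G y}"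
  define E where "E = (S \<inter> ball x r) - F"
  have "{y. ennreal R < G y} \<in> sets borel"
    using measurable_sets[OF Gm, of "{ennreal R<..}"] by (simp add: vimage_def space_borel)
  moreover have "F = S \<inter> ball x r \<inter> {y. ennreal R < G y}" by (auto simp: F_def)
  ultimately have Fm: "F \<in> sets borel" using Sb by auto
  have Em: "E \<in> sets borel" using Sb Fm by (auto simp: E_def)
  have "ennreal (R / 2) * emeasure \<mu> F = (\<integral>\<^sup>+y. ennreal (R / 2) * indicator F y \<partial>\<mu>)"
    using Fm by (intro nn_integral_cmult_indicator[symmetric]) simp
  also have "\<dots> \<le> (\<integral>\<^sup>+y\<in>ball x (2 * r). (\<integral>\<^sup>+t\<in>{0<..2 * r}. alpha_number T \<mu> y t / ennreal t \<partial>lborel) \<partial>\<mu>)"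
  proof (rule nn_integral_mono)
    fix y
    let ?I = "\<integral>\<^sup>+t\<in>{0<..2 * r}. alpha_number T \<mu> y t / ennreal t \<partial>lborel"
    show "ennreal (R / 2) * indicator F y \<le> ?I * indicator (ball x (2 * r)) y"
    proof (cases "y \<in> F")
      case True
      then have y: "y \<in> S" "y \<in> ball x (2 * r)" "ennreal R < G y" using r by (auto simp: F_def)
      have "ennreal R \<le> 2 * ?I"
        using y(3) suminf_scale_alpha_le[OF y(1) r, of T] unfolding G_def by (rule less_imp_le[OF less_le_trans])
      then have "ennreal (1 / 2) * ennreal R \<le> ennreal (1 / 2) * (ennreal 2 * ?I)"
        by (intro mult_left_mono) auto
      also have "\<dots> = (ennreal (1 / 2) * ennreal 2) * ?I" by (simp only: mult.assoc)
      also have "ennreal (1 / 2) * ennreal 2 = 1" by (subst ennreal_mult[symmetric]) simp_all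
      also have "ennreal (1 / 2) * ennreal R = ennreal (R / 2)" using R by (subst ennreal_mult[symmetric]) simp_all
      finally show ?thesis using y True by simp
    qed simp
  qed
  also have "\<dots> \<le> ennreal C1 * emeasure \<mu> (ball x r)" by (rule car)
  finally have 1: "ennreal (R / 2) * emeasure \<mu> F \<le> ennreal C1 * emeasure \<mu> (ball x r)" .
  have Ff: "F \<in> fmeasurable \<mu>" by (rule fmeasurableI2[OF ball_fmeasurable[of x r]]) (use Fm in \<open>auto simp: F_def\<close>)
  then have "emeasure \<mu> F = ennreal (measure \<mu> F)" by (simp add: emeasure_eq_measure2)
  then have "R / 2 * measure \<mu> F \<le> C1 * M x r"
    using 1 R C1 by (simp add: emeasure_ball_eq ennreal_mult[symmetric])
  then have F_small: "measure \<mu> F \<le> \<gamma> / 2 * M x r"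
    using C1 \<gamma> by (simp add: R_def field_simps)
  have "emeasure \<mu> (ball x r - E) \<le> emeasure \<mu> (- S \<union> F)"
    using Sb Fm by (intro emeasure_mono) (auto simp: E_def)
  also have "\<dots> \<le> emeasure \<mu> (- S) + emeasure \<mu> F" using Sb Fm by (intro emeasure_subadditive) auto
  also have "\<dots> = emeasure \<mu> F" by (simp add: null_support)
  finally have "emeasure \<mu> (ball x r - E) \<le> ennreal (measure \<mu> F)" using \<open>emeasure \<mu> F = _\<close> by simp
  then have "measure \<mu> (ball x r - E) \<le> measure \<mu> F" unfolding measure_def by (rule enn2real_leI[rotated]) simp
  then have "measure \<mu> (ball x r - E) \<le> \<gamma> / 2 * M x r" using F_small by linarith
  moreover have "(\<Sum>i<n. scale_budget T \<mu> r 1 i y) \<le> 6 + R" if "y \<in> E" for y n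
  proof (rule sum_scale_budget_le)
    show "(\<Sum>k. scale_alpha T \<mu> r 1 k y) \<le> ennreal R" using that by (auto simp: E_def F_def G_def not_less)
  qed (use R in simp)
  moreover have "E \<subseteq> S \<inter> ball x r" by (auto simp: E_def)
  ultimately show ?thesis using Em unfolding R_def by blast
qed

end

section \<open>Big pieces under the Carleson condition\<close>

definition carleson_density :: "real \<Rightarrow> nat \<Rightarrow> real \<Rightarrow> real \<Rightarrow> real" where
  "carleson_density C d C1 \<gamma> = C * flat_scales.density_const C d (4 * C ^ 3) (6 + 4 * C1 / \<gamma>)"

definition carleson_lip :: "real \<Rightarrow> nat \<Rightarrow> real \<Rightarrow> real \<Rightarrow> real" where
  "carleson_lip C d C1 \<gamma> = lip_const C (nat \<lceil>(6 + 4 * C1 / \<gamma>) / flat_scales.\<epsilon> C d (4 * C ^ 3)\<rceil>) (\<gamma> / 2)"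

context doubling_radon begin

lemma carleson_density_pos: "0 < carleson_density C CARD('d::finite) C1 \<gamma>"
proof -
  note fs = flat_scales_alpha[OF zero_less_one, where 'd='d]
  have "0 < flat_scales.ratio_const C CARD('d)" using flat_scales.ratio_const_ge(3)[OF fs] by linarith
  then show ?thesis unfolding carleson_density_def flat_scales.density_const_def[OF fs] using C_ge_1 by simp
qed

lemma carleson_big_piece:
  assumes x: "x \<in> S" and r: "r > 0" and C1: "C1 > 0" and \<gamma>: "\<gamma> > 0"
    and car: "(\<integral>\<^sup>+y\<in>ball x (2 * r). (\<integral>\<^sup>+t\<in>{0<..2 * r}. alpha_number TYPE('d::finite) \<mu> y t / ennreal t \<partial>lborel) \<partial>\<mu>)
      \<le> ennreal C1 * emeasure \<mu> (ball x r)"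
  shows "\<exists>A\<in>sets borel. A \<subseteq> ball x r \<and> measure \<mu> (ball x r - A) \<le> \<gamma> * M x r \<and>
     (\<exists>f :: 'a \<Rightarrow> real^'d. bi_lipschitz_on (carleson_lip C CARD('d) C1 \<gamma>) A f) \<and>
     (\<forall>y\<in>A. \<forall>k. M y (r / 2 ^ k) \<le> carleson_density C CARD('d) C1 \<gamma> * M x r / r ^ CARD('d) * (r / 2 ^ k) ^ CARD('d) \<and>
        M x r / (r ^ CARD('d) * carleson_density C CARD('d) C1 \<gamma>) * (r / 2 ^ k) ^ CARD('d) \<le> M y (r / 2 ^ k))"
proof -
  let ?d = "CARD('d)" and ?K = "4 * C ^ 3" and ?R = "6 + 4 * C1 / \<gamma>"
  let ?a = "scale_budget TYPE('d) \<mu> r 1" and ?b = "scale_budget TYPE('d) \<mu> r 2"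
  let ?\<epsilon> = "flat_scales.\<epsilon> C ?d ?K" and ?D0 = "carleson_density C ?d C1 \<gamma>"
  let ?Dn = "flat_scales.density_const C ?d ?K ?R"
  define N where "N = nat \<lceil>?R / ?\<epsilon>\<rceil>"
  note fs = flat_scales_alpha[OF r, where 'd='d]
  have s: "flat_scales.s r k = r / 2 ^ k" for k by (rule flat_scales.s_def[OF fs])
  have \<epsilon>: "0 < ?\<epsilon>" by (rule flat_scales.\<epsilon>_bounds(1)[OF fs])
  have "?R / ?\<epsilon> \<le> real N" unfolding N_def by (rule real_nat_ceiling_ge)
  then have N: "?R \<le> real N * ?\<epsilon>" using \<epsilon> by (simp add: divide_le_eq)
  obtain E where E: "E \<in> sets borel" "E \<subseteq> S \<inter> ball x r" "measure \<mu> (ball x r - E) \<le> \<gamma> / 2 * M x r"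
     and bud: "\<And>y n. y \<in> E \<Longrightarrow> (\<Sum>i<n. ?a i y) \<le> ?R"
    using small_budget_set[OF r C1 \<gamma> car] by blast
  have "\<exists>A\<in>sets borel. A \<subseteq> E \<and> measure \<mu> (E - A) \<le> \<gamma> / 2 * measure \<mu> (ball x (flat_scales.s r 0)) \<and>
     (\<exists>f :: 'a \<Rightarrow> real^'d. bi_lipschitz_on (lip_const C N (\<gamma> / 2)) A f \<and> (\<forall>u\<in>A. norm (f u) \<le> flat_scales.s r 0))"
  proof (rule flat_scales.big_piece[OF fs x E(1)])
    show "E \<subseteq> S \<inter> ball x (flat_scales.s r 0)" using E(2) by (simp add: s)
    show "(\<Sum>i\<in>{0..<n}. ?a i y) \<le> real N * ?\<epsilon>" if "y \<in> E" for y n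
      using bud[OF that, of n] N by (simp add: lessThan_atLeast0)
  qed (use \<gamma> in simp)
  then obtain A f where A: "A \<in> sets borel" "A \<subseteq> E" "measure \<mu> (E - A) \<le> \<gamma> / 2 * M x r"
    and f: "bi_lipschitz_on (lip_const C N (\<gamma> / 2)) A (f :: 'a \<Rightarrow> real^'d)"
    by (auto simp: s)
  have "measure \<mu> (ball x r - A) \<le> measure \<mu> ((ball x r - E) \<union> (E - A))"
    using E A by (intro measure_mono_fmeasurable fmeasurableI2[OF ball_fmeasurable[of x r]]) auto
  also have "\<dots> \<le> measure \<mu> (ball x r - E) + measure \<mu> (E - A)"
    using E A by (intro measure_Un_le) auto
  also have "\<dots> \<le> \<gamma> * M x r" using E(3) A(3) by simp
  finally have loss: "measure \<mu> (ball x r - A) \<le> \<gamma> * M x r" .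
  have D0: "0 < ?D0" by (rule carleson_density_pos)
  have Dn: "0 < ?Dn" and D0_eq: "?D0 = C * ?Dn" using D0 C_ge_1 by (auto simp: carleson_density_def zero_less_mult_iff)
  have "M y (r / 2 ^ k) \<le> ?D0 * M x r / r ^ ?d * (r / 2 ^ k) ^ ?d \<and>
        M x r / (r ^ ?d * ?D0) * (r / 2 ^ k) ^ ?d \<le> M y (r / 2 ^ k)" if "y \<in> A" for y k
  proof -
    have y: "y \<in> S" "dist x y < r" "y \<in> E" using that A(2) E(2) by auto
    have p: "0 < (r / 2 ^ k) ^ ?d" "0 < r ^ ?d" using r by simp_all
    have 1: "M y r \<le> C ^ 1 * M x r" using r y by (intro M_compare x) (auto simp: dist_commute)
    have 2: "M x r \<le> C ^ 1 * M y r" using r y by (intro M_compare y(1)) (auto simp: dist_commute)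
    have 3: "M y (r / 2 ^ k) / (r / 2 ^ k) ^ ?d \<le> ?Dn * (M y r / r ^ ?d)"
      and 4: "M y r / r ^ ?d \<le> ?Dn * (M y (r / 2 ^ k) / (r / 2 ^ k) ^ ?d)"
      using flat_scales.density_bound[OF fs y(1) bud[OF y(3)], of k] by (simp_all add: s)
    have "?Dn * (M y r / r ^ ?d) \<le> ?Dn * (C * M x r / r ^ ?d)"
      using 1 Dn p by (intro mult_left_mono divide_right_mono) auto
    with 3 have "M y (r / 2 ^ k) / (r / 2 ^ k) ^ ?d \<le> ?D0 * M x r / r ^ ?d" unfolding D0_eq by (simp add: ac_simps)
    then have up: "M y (r / 2 ^ k) \<le> ?D0 * M x r / r ^ ?d * (r / 2 ^ k) ^ ?d"
      unfolding pos_divide_le_eq[OF p(1)] .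
    have "M x r / r ^ ?d \<le> C * M y r / r ^ ?d" using 2 p by (intro divide_right_mono) auto
    also have "\<dots> \<le> C * (?Dn * (M y (r / 2 ^ k) / (r / 2 ^ k) ^ ?d))"
      using mult_left_mono[OF 4, of C] C_ge_1 by simp
    finally have "M x r / r ^ ?d \<le> ?D0 * M y (r / 2 ^ k) / (r / 2 ^ k) ^ ?d" unfolding D0_eq by (simp add: ac_simps)
    then have "M x r / r ^ ?d * (r / 2 ^ k) ^ ?d \<le> ?D0 * M y (r / 2 ^ k)"
      unfolding pos_le_divide_eq[OF p(1)] .
    then have "M x r / r ^ ?d * (r / 2 ^ k) ^ ?d / ?D0 \<le> M y (r / 2 ^ k)"
      unfolding pos_divide_le_eq[OF D0] by (simp only: mult.commute)
    then show ?thesis using up by (simp add: divide_divide_eq_left mult.commute)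
  qed
  moreover have "A \<subseteq> ball x r" using A(2) E(2) by auto
  ultimately show ?thesis using A(1) loss f unfolding carleson_lip_def N_def by blast
qed

lemma hausdorff_measure_comparison:
  assumes x: "x \<in> S" and r: "r > 0" and D0: "D0 > 0" and Z: "Z \<in> sets borel" "Z \<subseteq> ball x r"
    and up: "\<And>y k. y \<in> Z \<Longrightarrow> M y (r / 2 ^ k) \<le> D0 * M x r / r ^ CARD('d::finite) * (r / 2 ^ k) ^ CARD('d)"
    and low: "\<And>y k. y \<in> Z \<Longrightarrow> M x r / (r ^ CARD('d) * D0) * (r / 2 ^ k) ^ CARD('d) \<le> M y (r / 2 ^ k)"
    and L: "10 ^ CARD('d) * D0 \<le> L" "D0 * 2 ^ CARD('d) * (2 * real CARD('d)) ^ CARD('d) \<le> L"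
  shows "ennreal (inverse L) * (emeasure (hausdorff_measure TYPE('d)) Z / ennreal (r ^ CARD('d)))
            \<le> emeasure \<mu> Z / emeasure \<mu> (ball x r)"
    and "emeasure \<mu> Z / emeasure \<mu> (ball x r)
            \<le> ennreal L * (emeasure (hausdorff_measure TYPE('d)) Z / ennreal (r ^ CARD('d)))"
proof -
  let ?d = "CARD('d)"
  have Mp: "0 < M x r" by (rule M_pos[OF x r])
  have rd: "0 < r ^ ?d" using r by simp
  have d0: "0 < ?d" by simp
  have L0: "0 < L" using L(1) D0 by (intro less_le_trans[OF _ L(1)]) simp
  define z where "z = measure \<mu> Z"
  have "Z \<in> fmeasurable \<mu>" by (rule fmeasurableI2[OF ball_fmeasurable[of x r]]) (use Z in auto)
  then have z: "emeasure \<mu> Z = ennreal z" unfolding z_def by (rule emeasure_eq_measure2)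
  have z0: "0 \<le> z" by (simp add: z_def)
  have 1: "emeasure \<mu> Z \<le> ennreal (D0 * M x r / r ^ ?d * 2 ^ ?d) * hausdorff_outer ?d Z"
    by (rule emeasure_le_hausdorff_outer[OF r d0 _ Z(1) up]) (use D0 Mp rd in simp_all)
  have 2: "hausdorff_outer ?d Z \<le> ennreal (10 ^ ?d / (M x r / (r ^ ?d * D0))) * emeasure \<mu> Z"
    by (rule hausdorff_outer_le_emeasure[OF r d0 _ Z low]) (use D0 Mp rd in simp_all)
  define h where "h = enn2real (hausdorff_outer ?d Z)"
  have "hausdorff_outer ?d Z < top"
    using 2 unfolding z by (rule le_less_trans) (simp add: ennreal_mult_less_top)
  then have h: "hausdorff_outer ?d Z = ennreal h" by (simp add: h_def)
  have h0: "0 \<le> h" by (simp add: h_def)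
  let ?B = "hausdorff_outer ?d (ball (0::real^'d) 1)"
  define c where "c = enn2real ?B"
  have c: "?B = ennreal c" using hausdorff_outer_unit_ball_finite[where 'd='d] by (simp add: c_def less_top)
  have c1: "1 \<le> c" "c \<le> (2 * real ?d) ^ ?d"
    using hausdorff_outer_unit_ball_ge[where 'd='d] hausdorff_outer_unit_ball_le[where 'd='d]
    unfolding c by (auto simp: ennreal_le_iff2)
  have H: "emeasure (hausdorff_measure TYPE('d)) Z = ennreal (h / c)"
    using emeasure_hausdorff_measure[OF Z(1), where 'd='d] c1 h0 unfolding c h by (simp add: divide_ennreal)
  have lhs: "emeasure (hausdorff_measure TYPE('d)) Z / ennreal (r ^ ?d) = ennreal (h / c / r ^ ?d)"
    unfolding H using h0 c1 rd by (intro divide_ennreal) auto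
  have rhs: "emeasure \<mu> Z / emeasure \<mu> (ball x r) = ennreal (z / M x r)"
    unfolding z emeasure_ball_eq using z0 Mp by (intro divide_ennreal)
  have q0: "0 \<le> h / c / r ^ ?d" using h0 c1 rd by simp
  have "ennreal h \<le> ennreal (10 ^ ?d / (M x r / (r ^ ?d * D0)) * z)"
    using 2 z0 Mp D0 rd unfolding h z by (subst ennreal_mult) auto
  then have "h \<le> 10 ^ ?d / (M x r / (r ^ ?d * D0)) * z"
    using z0 Mp D0 rd by (subst (asm) ennreal_le_iff) auto
  also have "\<dots> = (10 ^ ?d * D0 * (z / M x r)) * r ^ ?d" by simp
  finally have "h / r ^ ?d \<le> 10 ^ ?d * D0 * (z / M x r)" unfolding pos_divide_le_eq[OF rd] .
  also have "\<dots> \<le> L * (z / M x r)" using L(1) z0 Mp by (intro mult_right_mono) auto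
  finally have "h / r ^ ?d \<le> L * (z / M x r)" .
  moreover have "h / c / r ^ ?d \<le> h / r ^ ?d"
  proof -
    have "h / c \<le> h / 1" using c1 h0 by (intro divide_left_mono) auto
    then show ?thesis using rd by (intro divide_right_mono) auto
  qed
  ultimately have "h / c / r ^ ?d \<le> L * (z / M x r)" by linarith
  then have "inverse L * (h / c / r ^ ?d) \<le> inverse L * (L * (z / M x r))" using L0 by (intro mult_left_mono) auto
  also have "\<dots> = z / M x r" using L0 by simp
  finally have "inverse L * (h / c / r ^ ?d) \<le> z / M x r" .
  then show "ennreal (inverse L) * (emeasure (hausdorff_measure TYPE('d)) Z / ennreal (r ^ ?d))
            \<le> emeasure \<mu> Z / emeasure \<mu> (ball x r)"
    unfolding lhs rhs using L0 q0 by (simp only: ennreal_mult[symmetric] less_imp_le inverse_nonnegative_iff_nonnegative ennreal_leI)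
  have "ennreal z \<le> ennreal (D0 * M x r / r ^ ?d * 2 ^ ?d * h)"
    using 1 h0 Mp D0 rd unfolding h z by (subst ennreal_mult) auto
  then have "z \<le> D0 * M x r / r ^ ?d * 2 ^ ?d * h"
    using h0 Mp D0 rd by (subst (asm) ennreal_le_iff) auto
  also have "\<dots> = (D0 * 2 ^ ?d * c * (h / c / r ^ ?d)) * M x r" using c1 by simp
  finally have "z / M x r \<le> D0 * 2 ^ ?d * c * (h / c / r ^ ?d)" unfolding pos_divide_le_eq[OF Mp] .
  also have "\<dots> \<le> L * (h / c / r ^ ?d)"
  proof (rule mult_right_mono[OF _ q0])
    have "D0 * 2 ^ ?d * c \<le> D0 * 2 ^ ?d * (2 * real ?d) ^ ?d" using c1(2) D0 by (intro mult_left_mono) auto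
    then show "D0 * 2 ^ ?d * c \<le> L" using L(2) by linarith
  qed
  finally have "z / M x r \<le> L * (h / c / r ^ ?d)" .
  then show "emeasure \<mu> Z / emeasure \<mu> (ball x r)
            \<le> ennreal L * (emeasure (hausdorff_measure TYPE('d)) Z / ennreal (r ^ ?d))"
    unfolding lhs rhs using L0 q0 by (simp only: ennreal_mult[symmetric] less_imp_le ennreal_leI)
qed

end

lemma absolutely_continuous_restrict_space:
  assumes A: "A \<in> sets borel" and "sets \<mu> = sets borel" "sets \<nu> = sets borel"
    and null: "\<And>Z. Z \<in> sets borel \<Longrightarrow> Z \<subseteq> A \<Longrightarrow> emeasure \<mu> Z = 0 \<Longrightarrow> emeasure \<nu> Z = 0"
  shows "absolutely_continuous (restrict_space \<mu> A) (restrict_space \<nu> A)"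
  unfolding absolutely_continuous_def
proof
  fix Z assume "Z \<in> null_sets (restrict_space \<mu> A)"
  then have "Z \<subseteq> A" "Z \<in> null_sets \<mu>" using A assms(2) by (auto simp: null_sets_restrict_space)
  then have "Z \<in> null_sets \<nu>" using null[of Z] assms by (auto simp: null_sets_def)
  then show "Z \<in> null_sets (restrict_space \<nu> A)" using \<open>Z \<subseteq> A\<close> A assms(3) by (auto simp: null_sets_restrict_space)
qed

theorem theorem1p7:
  fixes C_delta C1 \<gamma> :: real
  assumes "CARD('d::finite) \<le> CARD('n::finite)"
    and "C_delta \<ge> 1" and "C1 > 0" and "\<gamma> > 0"
  shows "\<exists>L>0. \<forall>(\<mu> :: (real^'n) measure) x r.
    radon_measure \<mu> \<and> doubling_measure C_delta \<mu> \<and> x \<in> measure_support \<mu> \<and> r > 0 \<and>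
    (\<integral>\<^sup>+y\<in>ball x (2 * r). (\<integral>\<^sup>+t\<in>{0<..2 * r}. alpha_number TYPE('d) \<mu> y t / ennreal t \<partial>lborel) \<partial>\<mu>)
      \<le> ennreal C1 * emeasure \<mu> (ball x r)
    \<longrightarrow>
    (\<exists>A\<in>sets borel. A \<subseteq> ball x r \<and>
       emeasure \<mu> (ball x r - A) \<le> ennreal \<gamma> * emeasure \<mu> (ball x r) \<and>
       (\<exists>f :: real^'n \<Rightarrow> real^'d. bi_lipschitz_on L A f) \<and>
       absolutely_continuous (restrict_space \<mu> A) (restrict_space (hausdorff_measure TYPE('d)) A) \<and>
       absolutely_continuous (restrict_space (hausdorff_measure TYPE('d)) A) (restrict_space \<mu> A) \<and>
       (\<forall>Z\<in>sets borel. Z \<subseteq> A \<longrightarrow>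
          ennreal (inverse L) * (emeasure (hausdorff_measure TYPE('d)) Z / ennreal (r ^ CARD('d)))
            \<le> emeasure \<mu> Z / emeasure \<mu> (ball x r) \<and>
          emeasure \<mu> Z / emeasure \<mu> (ball x r)
            \<le> ennreal L * (emeasure (hausdorff_measure TYPE('d)) Z / ennreal (r ^ CARD('d)))))"
proof -
  let ?d = "CARD('d)"
  define D0 where "D0 = max 1 (carleson_density C_delta ?d C1 \<gamma>)"
  define l where "l = carleson_lip C_delta ?d C1 \<gamma>"
  define L where "L = l + 10 ^ ?d * D0 + D0 * 2 ^ ?d * (2 * real ?d) ^ ?d"
  have D0: "1 \<le> D0" by (simp add: D0_def)
  have l: "1 \<le> l" unfolding l_def carleson_lip_def by (rule lip_const_ge_1)
  have t: "0 \<le> 10 ^ ?d * D0" "0 \<le> D0 * 2 ^ ?d * (2 * real ?d) ^ ?d" using D0 by simp_all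
  have L: "l \<le> L" "10 ^ ?d * D0 \<le> L" "D0 * 2 ^ ?d * (2 * real ?d) ^ ?d \<le> L" "0 < L"
    unfolding L_def using l t by linarith+
  show ?thesis
  proof (intro exI[of _ L] conjI L(4) allI impI)
    fix \<mu> :: "(real^'n) measure" and x :: "real^'n" and r :: real
    assume as: "radon_measure \<mu> \<and> doubling_measure C_delta \<mu> \<and> x \<in> measure_support \<mu> \<and> r > 0 \<and>
    (\<integral>\<^sup>+y\<in>ball x (2 * r). (\<integral>\<^sup>+t\<in>{0<..2 * r}. alpha_number TYPE('d) \<mu> y t / ennreal t \<partial>lborel) \<partial>\<mu>)
      \<le> ennreal C1 * emeasure \<mu> (ball x r)"
    interpret doubling_radon \<mu> C_delta using as assms(2) by unfold_locales auto
    have x: "x \<in> S" and r: "r > 0" using as by auto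
    have D0_eq: "D0 \<ge> carleson_density C_delta ?d C1 \<gamma>" by (simp add: D0_def)
    have Dp: "0 < carleson_density C_delta ?d C1 \<gamma>" by (rule carleson_density_pos)
    have Mp: "0 < M x r" by (rule M_pos[OF x r])
    obtain A and f :: "real^'n \<Rightarrow> real^'d" where A: "A \<in> sets borel" "A \<subseteq> ball x r" "measure \<mu> (ball x r - A) \<le> \<gamma> * M x r"
      and f: "bi_lipschitz_on l A f"
      and up: "\<And>y k. y \<in> A \<Longrightarrow> M y (r / 2 ^ k) \<le> carleson_density C_delta ?d C1 \<gamma> * M x r / r ^ ?d * (r / 2 ^ k) ^ ?d"
      and low: "\<And>y k. y \<in> A \<Longrightarrow> M x r / (r ^ ?d * carleson_density C_delta ?d C1 \<gamma>) * (r / 2 ^ k) ^ ?d \<le> M y (r / 2 ^ k)"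
      using carleson_big_piece[OF x r assms(3,4), where 'd='d] as unfolding l_def by blast
    have up': "M y (r / 2 ^ k) \<le> D0 * M x r / r ^ ?d * (r / 2 ^ k) ^ ?d" if "y \<in> A" for y k
      by (rule order_trans[OF up[OF that]])
        (use D0_eq Mp r in \<open>intro mult_right_mono divide_right_mono, auto\<close>)
    have low': "M x r / (r ^ ?d * D0) * (r / 2 ^ k) ^ ?d \<le> M y (r / 2 ^ k)" if "y \<in> A" for y k
      by (rule order_trans[OF _ low[OF that]])
        (use D0_eq Dp Mp r D0 in \<open>intro mult_right_mono divide_left_mono mult_left_mono mult_pos_pos, auto\<close>)
    have D00: "0 < D0" using D0 by linarith
    have cmp: "ennreal (inverse L) * (emeasure (hausdorff_measure TYPE('d)) Z / ennreal (r ^ ?d)) \<le> emeasure \<mu> Z / emeasure \<mu> (ball x r)"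
      "emeasure \<mu> Z / emeasure \<mu> (ball x r) \<le> ennreal L * (emeasure (hausdorff_measure TYPE('d)) Z / ennreal (r ^ ?d))"
      if Z: "Z \<in> sets borel" "Z \<subseteq> A" for Z
    proof -
      have Zx: "Z \<subseteq> ball x r" using Z A by auto
      note * = hausdorff_measure_comparison[OF x r D00 Z(1) Zx up' low' L(2,3)]
      show "ennreal (inverse L) * (emeasure (hausdorff_measure TYPE('d)) Z / ennreal (r ^ ?d)) \<le> emeasure \<mu> Z / emeasure \<mu> (ball x r)"
        by (rule *(1)) (use Z in auto)
      show "emeasure \<mu> Z / emeasure \<mu> (ball x r) \<le> ennreal L * (emeasure (hausdorff_measure TYPE('d)) Z / ennreal (r ^ ?d))"
        by (rule *(2)) (use Z in auto)
    qed
    have "emeasure \<mu> (ball x r - A) = ennreal (measure \<mu> (ball x r - A))"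
      by (intro emeasure_eq_measure2 fmeasurableI2[OF ball_fmeasurable[of x r]]) (use A in auto)
    then have loss: "emeasure \<mu> (ball x r - A) \<le> ennreal \<gamma> * emeasure \<mu> (ball x r)"
      using A(3) assms(4) by (simp add: emeasure_ball_eq ennreal_mult[symmetric] ennreal_leI)
    have ac1: "absolutely_continuous (restrict_space \<mu> A) (restrict_space (hausdorff_measure TYPE('d)) A)"
    proof (rule absolutely_continuous_restrict_space[OF A(1)])
      fix Z assume Z: "Z \<in> sets borel" "Z \<subseteq> A" "emeasure \<mu> Z = 0"
      then have "ennreal (inverse L) * (emeasure (hausdorff_measure TYPE('d)) Z / ennreal (r ^ ?d)) = 0"
        using cmp(1)[of Z] by simp
      then show "emeasure (hausdorff_measure TYPE('d)) Z = 0" using L(4) r by (auto simp: ennreal_divide_eq_0_iff)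
    qed simp_all
    have ac2: "absolutely_continuous (restrict_space (hausdorff_measure TYPE('d)) A) (restrict_space \<mu> A)"
    proof (rule absolutely_continuous_restrict_space[OF A(1)])
      fix Z assume Z: "Z \<in> sets borel" "Z \<subseteq> A" "emeasure (hausdorff_measure TYPE('d)) Z = 0"
      then have "emeasure \<mu> Z / emeasure \<mu> (ball x r) = 0" using cmp(2)[of Z] by simp
      then show "emeasure \<mu> Z = 0" using finite_ball[of x r] by (auto simp: ennreal_divide_eq_0_iff)
    qed simp_all
    have "bi_lipschitz_on L A f" using bi_lipschitz_on_mono[OF f _ L(1)] l by simp
    then show "\<exists>A\<in>sets borel. A \<subseteq> ball x r \<and>
       emeasure \<mu> (ball x r - A) \<le> ennreal \<gamma> * emeasure \<mu> (ball x r) \<and>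
       (\<exists>f :: real^'n \<Rightarrow> real^'d. bi_lipschitz_on L A f) \<and>
       absolutely_continuous (restrict_space \<mu> A) (restrict_space (hausdorff_measure TYPE('d)) A) \<and>
       absolutely_continuous (restrict_space (hausdorff_measure TYPE('d)) A) (restrict_space \<mu> A) \<and>
       (\<forall>Z\<in>sets borel. Z \<subseteq> A \<longrightarrow>
          ennreal (inverse L) * (emeasure (hausdorff_measure TYPE('d)) Z / ennreal (r ^ CARD('d)))
            \<le> emeasure \<mu> Z / emeasure \<mu> (ball x r) \<and>
          emeasure \<mu> Z / emeasure \<mu> (ball x r)
            \<le> ennreal L * (emeasure (hausdorff_measure TYPE('d)) Z / ennreal (r ^ CARD('d))))"
      using A loss ac1 ac2 cmp by blast
  qed
qed

end
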